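(* Let $\Bbbk$ be a field of characteristic zero. The Poisson algebra $A(n,a)$ satisfies the Poisson Dixmier-Moeglin equivalence for any $a\in\Bbbk$ and any integer $n\geq1$.
   Context: Let $A=\Bbbk[X_0,\dots,X_n]$ be the commutative polynomial ring, $\partial_i=\partial/\partial X_i$, and define the derivations $\Delta=\sum_{i=1}^{n}X_{i-1}\partial_i$ and $\Gamma_a=\sum_{i=0}^n (a+i)X_i\partial_i$ of $A$. Then $A(n,a)$ is the Poisson algebra $A$ with bracket $\{f,g\}_a=\Delta(f)\Gamma_a(g)-\Gamma_a(f)\Delta(g)$. Let $A$ be a Poisson $\Bbbk$-algebra and let $\operatorname{PSpec}(A)$ be the set of Poisson prime ideals (prime ideals $P$ with $\{A,P\}\subseteq P$) with the Zariski topology. For $P\in\operatorname{PSpec}(A)$: $P$ is locally closed if $\{P\}$ is a locally closed point of $\operatorname{PSpec}(A)$; $P$ is Poisson rational if the field $Z_P(\operatorname{Frac}(A/P))$ (the Poisson centre of the fraction field of $A/P$ with the induced bracket) is algebraic over $\Bbbk$; $P$ is Poisson primitive if it is the largest Poisson ideal contained in some maximal ideal of the commutative ring $A$. The Poisson Dixmier-Moeglin equivalence holds for $A$ if the sets of Poisson primitive ideals, locally closed Poisson prime ideals and Poisson rational ideals coincide. *)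

theory Defs
  imports
    "HOL-Library.Poly_Mapping"
    "HOL-Algebra.Algebra"
    "HOL-Analysis.Abstract_Topology"
begin

section \<open>Poisson algebras\<close>

record 'a poisson_ring = "'a ring" +
  bracket :: "['a, 'a] \<Rightarrow> 'a"  (\<open>\<lbrace>_,/ _\<rbrace>\<index>\<close>)

text \<open>As in \<^theory>\<open>HOL-Algebra.Embedded_Algebras\<close>, the base field is a subfield \<open>K\<close> of the
  (nonzero, commutative) algebra. Antisymmetry gives the remaining halves of bilinearity.\<close>

locale poisson_algebra = cring R
  for K and R :: "('a, 'm) poisson_ring_scheme" (structure) +
  assumes subfield_K: "subfield K R"
    and bracket_closed: "\<lbrakk>x \<in> carrier R; y \<in> carrier R\<rbrakk> \<Longrightarrow> \<lbrace>x, y\<rbrace> \<in> carrier R"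
    and bracket_add: "\<lbrakk>x \<in> carrier R; y \<in> carrier R; z \<in> carrier R\<rbrakk> \<Longrightarrow>
          \<lbrace>x \<oplus> y, z\<rbrace> = \<lbrace>x, z\<rbrace> \<oplus> \<lbrace>y, z\<rbrace>"
    and bracket_scale: "\<lbrakk>c \<in> K; x \<in> carrier R; y \<in> carrier R\<rbrakk> \<Longrightarrow>
          \<lbrace>c \<otimes> x, y\<rbrace> = c \<otimes> \<lbrace>x, y\<rbrace>"
    and bracket_self: "x \<in> carrier R \<Longrightarrow> \<lbrace>x, x\<rbrace> = \<zero>"
    and bracket_anti: "\<lbrakk>x \<in> carrier R; y \<in> carrier R\<rbrakk> \<Longrightarrow> \<lbrace>x, y\<rbrace> = \<ominus> \<lbrace>y, x\<rbrace>"
    and bracket_jacobi: "\<lbrakk>x \<in> carrier R; y \<in> carrier R; z \<in> carrier R\<rbrakk> \<Longrightarrow>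
          \<lbrace>x, \<lbrace>y, z\<rbrace>\<rbrace> \<oplus> \<lbrace>y, \<lbrace>z, x\<rbrace>\<rbrace> \<oplus> \<lbrace>z, \<lbrace>x, y\<rbrace>\<rbrace> = \<zero>"
    and bracket_leibniz: "\<lbrakk>x \<in> carrier R; y \<in> carrier R; z \<in> carrier R\<rbrakk> \<Longrightarrow>
          \<lbrace>x \<otimes> y, z\<rbrace> = x \<otimes> \<lbrace>y, z\<rbrace> \<oplus> \<lbrace>x, z\<rbrace> \<otimes> y"

definition poisson_ideal :: "'a set \<Rightarrow> ('a, 'm) poisson_ring_scheme \<Rightarrow> bool" where
  "poisson_ideal I R \<longleftrightarrow> ideal I R \<and> (\<forall>a\<in>carrier R. \<forall>b\<in>I. \<lbrace>a, b\<rbrace>\<^bsub>R\<^esub> \<in> I)"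

definition poisson_center :: "('a, 'm) poisson_ring_scheme \<Rightarrow> 'a set" where
  "poisson_center R = {z \<in> carrier R. \<forall>x\<in>carrier R. \<lbrace>z, x\<rbrace>\<^bsub>R\<^esub> = \<zero>\<^bsub>R\<^esub>}"


section \<open>The Poisson spectrum\<close>

definition PSpec :: "('a, 'm) poisson_ring_scheme \<Rightarrow> 'a set set" where
  "PSpec R = {P. primeideal P R \<and> poisson_ideal P R}"

definition zariski_closed :: "('a, 'm) poisson_ring_scheme \<Rightarrow> 'a set \<Rightarrow> 'a set set" where
  "zariski_closed R S = {P \<in> PSpec R. S \<subseteq> P}"

definition zariski_topology :: "('a, 'm) poisson_ring_scheme \<Rightarrow> 'a set topology" where
  "zariski_topology R = topology (\<lambda>U. \<exists>S\<subseteq>carrier R. U = PSpec R - zariski_closed R S)"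

lemma istopology_zariski:
  "istopology (\<lambda>U. \<exists>S\<subseteq>carrier R. U = PSpec R - zariski_closed R S)"
  unfolding istopology_def
proof (intro conjI allI impI)
  fix U V
  assume "\<exists>S\<subseteq>carrier R. U = PSpec R - zariski_closed R S"
    and "\<exists>T\<subseteq>carrier R. V = PSpec R - zariski_closed R T"
  then obtain S T where S: "S \<subseteq> carrier R" "U = PSpec R - zariski_closed R S"
    and T: "T \<subseteq> carrier R" "V = PSpec R - zariski_closed R T" by blast
  let ?W = "{s \<otimes>\<^bsub>R\<^esub> t |s t. s \<in> S \<and> t \<in> T}"
  have W: "?W \<subseteq> P \<longleftrightarrow> S \<subseteq> P \<or> T \<subseteq> P" if "P \<in> PSpec R" for P
  proof -
    interpret primeideal P R using that by (simp add: PSpec_def)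
    show ?thesis
    proof
      assume W: "?W \<subseteq> P"
      show "S \<subseteq> P \<or> T \<subseteq> P"
      proof (rule ccontr)
        assume "\<not> ?thesis"
        then obtain s t where st: "s \<in> S" "s \<notin> P" "t \<in> T" "t \<notin> P" by blast
        then have "s \<otimes>\<^bsub>R\<^esub> t \<in> P" using W by blast
        then show False using I_prime[of s t] st S T by blast
      qed
    next
      assume "S \<subseteq> P \<or> T \<subseteq> P"
      then show "?W \<subseteq> P" using S T by (auto intro: I_l_closed I_r_closed)
    qed
  qed
  have sub: "?W \<subseteq> carrier R" if "P \<in> PSpec R" for P
  proof -
    interpret primeideal P R using that by (simp add: PSpec_def)
    show ?thesis using S T by auto
  qed
  show "\<exists>W\<subseteq>carrier R. U \<inter> V = PSpec R - zariski_closed R W"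
  proof (cases "PSpec R = {}")
    case True
    then show ?thesis using S by auto
  next
    case False
    then have "?W \<subseteq> carrier R" using sub by blast
    moreover have "zariski_closed R ?W = zariski_closed R S \<union> zariski_closed R T"
      unfolding zariski_closed_def using W by blast
    then have "U \<inter> V = PSpec R - zariski_closed R ?W"
      unfolding S T by blast
    ultimately show ?thesis by blast
  qed
next
  fix \<U>
  assume "\<forall>U\<in>\<U>. \<exists>S\<subseteq>carrier R. U = PSpec R - zariski_closed R S"
  then obtain S where S: "\<And>U. U \<in> \<U> \<Longrightarrow> S U \<subseteq> carrier R"
    "\<And>U. U \<in> \<U> \<Longrightarrow> U = PSpec R - zariski_closed R (S U)" by metis
  have "\<Union>\<U> = (\<Union>U\<in>\<U>. PSpec R - zariski_closed R (S U))"
    using S(2) by auto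
  also have "\<dots> = PSpec R - zariski_closed R (\<Union>U\<in>\<U>. S U)"
    by (auto simp: zariski_closed_def)
  finally show "\<exists>T\<subseteq>carrier R. \<Union>\<U> = PSpec R - zariski_closed R T"
    using S(1) by (intro exI[of _ "\<Union>U\<in>\<U>. S U"]) auto
qed

lemma openin_zariski_topology:
  "openin (zariski_topology R) U \<longleftrightarrow> (\<exists>S\<subseteq>carrier R. U = PSpec R - zariski_closed R S)"
  unfolding zariski_topology_def by (simp add: istopology_zariski topology_inverse')

definition locally_closed_in :: "'a topology \<Rightarrow> 'a set \<Rightarrow> bool" where
  "locally_closed_in T S \<longleftrightarrow> (\<exists>U C. openin T U \<and> closedin T C \<and> S = U \<inter> C)"


section \<open>Quotients and fraction fields of Poisson algebras\<close>

text \<open>The induced bracket is defined on cosets in the same way as \<^const>\<open>rcoset_mult\<close>.\<close>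

definition poisson_quotient ::
  "('a, 'm) poisson_ring_scheme \<Rightarrow> 'a set \<Rightarrow> 'a set poisson_ring" where
  "poisson_quotient R P =
    \<lparr>carrier = carrier (R Quot P), monoid.mult = monoid.mult (R Quot P), one = one (R Quot P),
     ring.zero = ring.zero (R Quot P), add = add (R Quot P),
     bracket = (\<lambda>S T. \<Union>a\<in>S. \<Union>b\<in>T. P +>\<^bsub>R\<^esub> \<lbrace>a, b\<rbrace>\<^bsub>R\<^esub>)\<rparr>"

lemma poisson_quotient_sel:
  "carrier (poisson_quotient R P) = carrier (R Quot P)"
  "monoid.mult (poisson_quotient R P) = monoid.mult (R Quot P)"
  "one (poisson_quotient R P) = one (R Quot P)"
  "ring.zero (poisson_quotient R P) = ring.zero (R Quot P)"
  "add (poisson_quotient R P) = add (R Quot P)"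
  by (simp_all add: poisson_quotient_def)

lemma (in poisson_algebra) bracket_add_right:
  assumes "x \<in> carrier R" "y \<in> carrier R" "z \<in> carrier R"
  shows "\<lbrace>x, y \<oplus> z\<rbrace> = \<lbrace>x, y\<rbrace> \<oplus> \<lbrace>x, z\<rbrace>"
  using assms bracket_anti[of x "y \<oplus> z"] bracket_anti[of x y] bracket_anti[of x z]
    bracket_add[of y z x] by (simp add: bracket_closed minus_add)

lemma (in poisson_algebra) bracket_coset:
  assumes P: "poisson_ideal P R" and xy: "x \<in> carrier R" "y \<in> carrier R"
  shows "\<lbrace>P +> x, P +> y\<rbrace>\<^bsub>poisson_quotient R P\<^esub> = P +> \<lbrace>x, y\<rbrace>"
proof -
  interpret I: ideal P R using P by (simp add: poisson_ideal_def)
  have left: "\<lbrace>a, b\<rbrace> \<in> P" if "a \<in> carrier R" "b \<in> P" for a b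
    using P that by (simp add: poisson_ideal_def)
  have right: "\<lbrace>b, a\<rbrace> \<in> P" if "a \<in> carrier R" "b \<in> P" for a b
    using left[OF that] bracket_anti[of b a] that I.a_inv_closed I.Icarr by simp
  have eq: "P +> \<lbrace>a, b\<rbrace> = P +> \<lbrace>x, y\<rbrace>" if ab: "a \<in> P +> x" "b \<in> P +> y" for a b
  proof -
    obtain p q where pq: "p \<in> P" "a = p \<oplus> x" "q \<in> P" "b = q \<oplus> y"
      using ab by (auto simp: a_r_coset_def')
    have c: "p \<in> carrier R" "q \<in> carrier R" using pq I.Icarr by auto
    have "\<lbrace>a, b\<rbrace> = (\<lbrace>p, q\<rbrace> \<oplus> \<lbrace>p, y\<rbrace> \<oplus> \<lbrace>x, q\<rbrace>) \<oplus> \<lbrace>x, y\<rbrace>"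
      using c xy by (simp add: pq bracket_add bracket_add_right bracket_closed a_ac)
    moreover have "\<lbrace>p, q\<rbrace> \<oplus> \<lbrace>p, y\<rbrace> \<oplus> \<lbrace>x, q\<rbrace> \<in> P"
      using c pq xy by (intro I.a_closed left right)
    ultimately have "\<lbrace>a, b\<rbrace> \<in> P +> \<lbrace>x, y\<rbrace>" by (auto simp: a_r_coset_def')
    then show ?thesis using a_repr_independence[OF _ bracket_closed[OF xy]] I.a_subgroup by simp
  qed
  have "x \<in> P +> x" "y \<in> P +> y" using xy I.a_rcos_self by auto
  then have "(\<Union>a\<in>P +> x. \<Union>b\<in>P +> y. P +> \<lbrace>a, b\<rbrace>) = P +> \<lbrace>x, y\<rbrace>" using eq by blast
  then show ?thesis by (simp add: poisson_quotient_def)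
qed

lemma (in poisson_algebra) poisson_algebra_quotient:
  assumes P: "P \<in> PSpec R"
  shows "domain (poisson_quotient R P)"
    and "poisson_algebra ((\<lambda>c. P +> c) ` K) (poisson_quotient R P)"
proof -
  interpret I: primeideal P R using P by (simp add: PSpec_def)
  let ?Q = "poisson_quotient R P"
  have br: "\<lbrace>P +> x, P +> y\<rbrace>\<^bsub>?Q\<^esub> = P +> \<lbrace>x, y\<rbrace>" if "x \<in> carrier R" "y \<in> carrier R" for x y
    using P bracket_coset that by (simp add: PSpec_def)
  interpret D: "domain" "R Quot P" by (rule I.quotient_is_domain)
  have "cring ?Q"
  proof (rule cringI)
    show "abelian_group ?Q"
    proof (rule abelian_groupI)
      show "\<exists>y\<in>carrier ?Q. y \<oplus>\<^bsub>?Q\<^esub> x = \<zero>\<^bsub>?Q\<^esub>" if "x \<in> carrier ?Q" for x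
        using that D.l_neg D.a_inv_closed unfolding poisson_quotient_sel by blast
    qed (simp_all only: poisson_quotient_sel D.a_closed D.zero_closed D.a_ac
        D.l_zero D.r_zero)
    show "comm_monoid ?Q"
      by (rule comm_monoidI)
        (simp_all only: poisson_quotient_sel D.m_closed D.one_closed D.m_ac
          D.l_one D.r_one)
  qed (simp_all only: poisson_quotient_sel D.l_distr D.a_closed D.m_closed)
  then show domain: "domain ?Q"
    using D.one_not_zero D.integral
    by (simp add: domain_def domain_axioms_def poisson_quotient_sel)
  then interpret Q: "domain" ?Q .
  have hom: "ring_hom_ring R ?Q (\<lambda>x. P +> x)"
    using I.rcos_ring_hom
    by (intro ring_hom_ringI2 ring_axioms Q.ring_axioms) (simp add: ring_hom_def poisson_quotient_sel)
  then interpret H: ring_hom_ring R ?Q "\<lambda>x. P +> x" .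
  have car: "\<exists>a\<in>carrier R. x = P +> a" if "x \<in> carrier ?Q" for x
    using that unfolding poisson_quotient_sel FactRing_def A_RCOSETS_def' by auto
  show "poisson_algebra ((\<lambda>c. P +> c) ` K) ?Q"
  proof (intro poisson_algebra.intro poisson_algebra_axioms.intro)
    show "cring ?Q" by (rule Q.cring_axioms)
    show "subfield ((\<lambda>c. P +> c) ` K) ?Q"
      using H.img_is_subfield(2)[OF subfield_K] Q.one_not_zero by simp
  next
    fix x y z assume "x \<in> carrier ?Q" "y \<in> carrier ?Q" "z \<in> carrier ?Q"
    then obtain a b c where abc: "x = P +> a" "y = P +> b" "z = P +> c"
      "a \<in> carrier R" "b \<in> carrier R" "c \<in> carrier R" using car by metis
    note simps = br bracket_closed abc(4-6) a_closed m_closed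
    show "\<lbrace>x \<oplus>\<^bsub>?Q\<^esub> y, z\<rbrace>\<^bsub>?Q\<^esub> = \<lbrace>x, z\<rbrace>\<^bsub>?Q\<^esub> \<oplus>\<^bsub>?Q\<^esub> \<lbrace>y, z\<rbrace>\<^bsub>?Q\<^esub>"
      unfolding abc(1-3) by (simp only: simps H.hom_add[symmetric] bracket_add)
    show "\<lbrace>x, \<lbrace>y, z\<rbrace>\<^bsub>?Q\<^esub>\<rbrace>\<^bsub>?Q\<^esub> \<oplus>\<^bsub>?Q\<^esub> \<lbrace>y, \<lbrace>z, x\<rbrace>\<^bsub>?Q\<^esub>\<rbrace>\<^bsub>?Q\<^esub> \<oplus>\<^bsub>?Q\<^esub> \<lbrace>z, \<lbrace>x, y\<rbrace>\<^bsub>?Q\<^esub>\<rbrace>\<^bsub>?Q\<^esub> = \<zero>\<^bsub>?Q\<^esub>"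
      unfolding abc(1-3) by (simp only: simps H.hom_add[symmetric] bracket_jacobi H.hom_zero)
    show "\<lbrace>x \<otimes>\<^bsub>?Q\<^esub> y, z\<rbrace>\<^bsub>?Q\<^esub> = x \<otimes>\<^bsub>?Q\<^esub> \<lbrace>y, z\<rbrace>\<^bsub>?Q\<^esub> \<oplus>\<^bsub>?Q\<^esub> \<lbrace>x, z\<rbrace>\<^bsub>?Q\<^esub> \<otimes>\<^bsub>?Q\<^esub> y"
      unfolding abc(1-3)
      by (simp only: simps H.hom_add[symmetric] H.hom_mult[symmetric] bracket_leibniz)
  next
    fix x y assume "x \<in> carrier ?Q" "y \<in> carrier ?Q"
    then obtain a b where ab: "x = P +> a" "y = P +> b"
      "a \<in> carrier R" "b \<in> carrier R" using car by metis
    note simps = br bracket_closed ab(3-4) a_closed m_closed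
    show "\<lbrace>x, y\<rbrace>\<^bsub>?Q\<^esub> \<in> carrier ?Q"
      unfolding ab(1-2) by (simp only: simps H.hom_closed)
    show "\<lbrace>x, x\<rbrace>\<^bsub>?Q\<^esub> = \<zero>\<^bsub>?Q\<^esub>"
      unfolding ab(1-2) by (simp only: simps bracket_self H.hom_zero)
    show "\<lbrace>x, y\<rbrace>\<^bsub>?Q\<^esub> = \<ominus>\<^bsub>?Q\<^esub> \<lbrace>y, x\<rbrace>\<^bsub>?Q\<^esub>"
      unfolding ab(1-2) using bracket_anti[OF ab(3,4)]
      by (simp only: simps H.hom_a_inv[symmetric])
    show "\<lbrace>c \<otimes>\<^bsub>?Q\<^esub> x, y\<rbrace>\<^bsub>?Q\<^esub> = c \<otimes>\<^bsub>?Q\<^esub> \<lbrace>x, y\<rbrace>\<^bsub>?Q\<^esub>" if c: "c \<in> (\<lambda>c. P +> c) ` K" for c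
    proof -
      obtain k where k: "k \<in> K" "c = P +> k" using c by blast
      then have "k \<in> carrier R" using subfieldE(3)[OF subfield_K] by blast
      then show ?thesis
        unfolding ab(1-2) k(2) by (simp only: simps k H.hom_mult[symmetric] bracket_scale)
    qed
  qed
qed

text \<open>The fraction \<open>a/b\<close> is the set of pairs \<open>(c, d)\<close> with \<open>d \<noteq> 0\<close> and \<open>ad = cb\<close>.\<close>

definition fraction :: "('a, 'm) ring_scheme \<Rightarrow> 'a \<Rightarrow> 'a \<Rightarrow> ('a \<times> 'a) set" where
  "fraction R a b = {(c, d). c \<in> carrier R \<and> d \<in> carrier R - {\<zero>\<^bsub>R\<^esub>} \<and> a \<otimes>\<^bsub>R\<^esub> d = c \<otimes>\<^bsub>R\<^esub> b}"

text \<open>The bracket is the unique biderivation extending that of \<open>R\<close>: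
  \<open>{a/b, c/d} = ({a,c}bd - {a,d}bc - {b,c}ad + {b,d}ac) / (b\<^sup>2d\<^sup>2)\<close>.\<close>

definition poisson_Frac ::
  "('a, 'm) poisson_ring_scheme \<Rightarrow> ('a \<times> 'a) set poisson_ring" where
  "poisson_Frac R =
    \<lparr>carrier = {fraction R a b |a b. a \<in> carrier R \<and> b \<in> carrier R - {\<zero>\<^bsub>R\<^esub>}},
     monoid.mult = (\<lambda>S T. \<Union>(a, b)\<in>S. \<Union>(c, d)\<in>T. fraction R (a \<otimes>\<^bsub>R\<^esub> c) (b \<otimes>\<^bsub>R\<^esub> d)),
     one = fraction R \<one>\<^bsub>R\<^esub> \<one>\<^bsub>R\<^esub>,
     ring.zero = fraction R \<zero>\<^bsub>R\<^esub> \<one>\<^bsub>R\<^esub>,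
     add = (\<lambda>S T. \<Union>(a, b)\<in>S. \<Union>(c, d)\<in>T.
       fraction R (a \<otimes>\<^bsub>R\<^esub> d \<oplus>\<^bsub>R\<^esub> c \<otimes>\<^bsub>R\<^esub> b) (b \<otimes>\<^bsub>R\<^esub> d)),
     bracket = (\<lambda>S T. \<Union>(a, b)\<in>S. \<Union>(c, d)\<in>T.
       fraction R
         (\<lbrace>a, c\<rbrace>\<^bsub>R\<^esub> \<otimes>\<^bsub>R\<^esub> (b \<otimes>\<^bsub>R\<^esub> d) \<ominus>\<^bsub>R\<^esub> \<lbrace>a, d\<rbrace>\<^bsub>R\<^esub> \<otimes>\<^bsub>R\<^esub> (b \<otimes>\<^bsub>R\<^esub> c)
          \<ominus>\<^bsub>R\<^esub> \<lbrace>b, c\<rbrace>\<^bsub>R\<^esub> \<otimes>\<^bsub>R\<^esub> (a \<otimes>\<^bsub>R\<^esub> d) \<oplus>\<^bsub>R\<^esub> \<lbrace>b, d\<rbrace>\<^bsub>R\<^esub> \<otimes>\<^bsub>R\<^esub> (a \<otimes>\<^bsub>R\<^esub> c))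
         ((b \<otimes>\<^bsub>R\<^esub> b) \<otimes>\<^bsub>R\<^esub> (d \<otimes>\<^bsub>R\<^esub> d)))\<rparr>"


lemma (in "domain") fraction_eq_iff:
  assumes "a \<in> carrier R" "b \<in> carrier R - {\<zero>}" "c \<in> carrier R" "d \<in> carrier R - {\<zero>}"
  shows "fraction R a b = fraction R c d \<longleftrightarrow> a \<otimes> d = c \<otimes> b"
proof
  assume "fraction R a b = fraction R c d"
  moreover have "(c, d) \<in> fraction R c d" using assms by (simp add: fraction_def)
  ultimately show "a \<otimes> d = c \<otimes> b" by (auto simp: fraction_def)
next
  have *: "fraction R a b \<subseteq> fraction R c d" if "a \<otimes> d = c \<otimes> b"
    "a \<in> carrier R" "b \<in> carrier R - {\<zero>}" "c \<in> carrier R" "d \<in> carrier R - {\<zero>}" for a b c d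
  proof clarify
    fix x y assume "(x, y) \<in> fraction R a b"
    then have xy: "x \<in> carrier R" "y \<in> carrier R - {\<zero>}" "a \<otimes> y = x \<otimes> b" by (auto simp: fraction_def)
    have "b \<otimes> (c \<otimes> y) = (c \<otimes> b) \<otimes> y" using that(2-5) xy(1,2) by (simp add: m_ac)
    also have "\<dots> = (a \<otimes> y) \<otimes> d" unfolding that(1)[symmetric] using that(2-5) xy(1,2) by (simp add: m_ac)
    also have "\<dots> = b \<otimes> (x \<otimes> d)" unfolding xy(3) using that(2-5) xy(1,2) by (simp add: m_ac)
    finally have "c \<otimes> y = x \<otimes> d" using that(2-5) xy(1,2) m_lcancel[of b "c \<otimes> y" "x \<otimes> d"] by auto
    then show "(x, y) \<in> fraction R c d" using xy by (auto simp: fraction_def)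
  qed
  assume "a \<otimes> d = c \<otimes> b"
  then show "fraction R a b = fraction R c d"
    using *[OF _ assms] *[OF _ assms(3,4,1,2)] by auto
qed

lemma (in "domain") fraction_lift2:
  assumes ab: "a \<in> carrier R" "b \<in> carrier R - {\<zero>}" and cd: "c \<in> carrier R" "d \<in> carrier R - {\<zero>}"
    and eq: "\<And>a' b' c' d'. \<lbrakk>a' \<in> carrier R; b' \<in> carrier R - {\<zero>}; c' \<in> carrier R;
      d' \<in> carrier R - {\<zero>}; a \<otimes> b' = a' \<otimes> b; c \<otimes> d' = c' \<otimes> d\<rbrakk> \<Longrightarrow> F a' b' c' d' = F a b c d"
  shows "(\<Union>(a', b')\<in>fraction R a b. \<Union>(c', d')\<in>fraction R c d. F a' b' c' d') = F a b c d"
proof -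
  have "(a, b) \<in> fraction R a b" "(c, d) \<in> fraction R c d" using ab cd by (auto simp: fraction_def)
  moreover have "F a' b' c' d' = F a b c d" if "(a', b') \<in> fraction R a b" "(c', d') \<in> fraction R c d"
    for a' b' c' d' using that by (intro eq) (auto simp: fraction_def)
  ultimately show ?thesis by fast
qed

lemma (in "domain") mult_nonzero:
  "b \<in> carrier R - {\<zero>} \<Longrightarrow> d \<in> carrier R - {\<zero>} \<Longrightarrow> b \<otimes> d \<in> carrier R - {\<zero>}"
  using integral by auto

context
  fixes R :: "('a, 'm) poisson_ring_scheme" (structure)
  assumes "domain": "domain R"
begin

interpretation "domain" R by (rule "domain")

lemma fraction_mult:
  assumes "a \<in> carrier R" "b \<in> carrier R - {\<zero>}" "c \<in> carrier R" "d \<in> carrier R - {\<zero>}"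
  shows "fraction R a b \<otimes>\<^bsub>poisson_Frac R\<^esub> fraction R c d = fraction R (a \<otimes> c) (b \<otimes> d)"
  unfolding poisson_Frac_def monoid.simps ring.simps poisson_ring.simps
proof (rule fraction_lift2[OF assms])
  fix a' b' c' d'
  assume *: "a' \<in> carrier R" "b' \<in> carrier R - {\<zero>}" "c' \<in> carrier R" "d' \<in> carrier R - {\<zero>}"
    and eq: "a \<otimes> b' = a' \<otimes> b" "c \<otimes> d' = c' \<otimes> d"
  have "(a' \<otimes> c') \<otimes> (b \<otimes> d) = (a' \<otimes> b) \<otimes> (c' \<otimes> d)"
    using * assms by (simp add: m_ac)
  also have "\<dots> = (a \<otimes> c) \<otimes> (b' \<otimes> d')"
    unfolding eq[symmetric] using * assms by (simp add: m_ac)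
  finally show "fraction R (a' \<otimes> c') (b' \<otimes> d') = fraction R (a \<otimes> c) (b \<otimes> d)"
    using * assms mult_nonzero by (subst fraction_eq_iff) auto
qed

lemma fraction_add:
  assumes "a \<in> carrier R" "b \<in> carrier R - {\<zero>}" "c \<in> carrier R" "d \<in> carrier R - {\<zero>}"
  shows "fraction R a b \<oplus>\<^bsub>poisson_Frac R\<^esub> fraction R c d = fraction R (a \<otimes> d \<oplus> c \<otimes> b) (b \<otimes> d)"
  unfolding poisson_Frac_def monoid.simps ring.simps poisson_ring.simps
proof (rule fraction_lift2[OF assms])
  fix a' b' c' d'
  assume *: "a' \<in> carrier R" "b' \<in> carrier R - {\<zero>}" "c' \<in> carrier R" "d' \<in> carrier R - {\<zero>}"
    and eq: "a \<otimes> b' = a' \<otimes> b" "c \<otimes> d' = c' \<otimes> d"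
  have "(a' \<otimes> d' \<oplus> c' \<otimes> b') \<otimes> (b \<otimes> d) = (a' \<otimes> b) \<otimes> (d' \<otimes> d) \<oplus> (c' \<otimes> d) \<otimes> (b' \<otimes> b)"
    using * assms by (simp add: m_ac l_distr r_distr)
  also have "\<dots> = (a \<otimes> d \<oplus> c \<otimes> b) \<otimes> (b' \<otimes> d')"
    unfolding eq[symmetric] using * assms by (simp add: m_ac l_distr r_distr)
  finally show "fraction R (a' \<otimes> d' \<oplus> c' \<otimes> b') (b' \<otimes> d') = fraction R (a \<otimes> d \<oplus> c \<otimes> b) (b \<otimes> d)"
    using * assms mult_nonzero by (subst fraction_eq_iff) auto
qed

lemma exchange:
  assumes "p \<in> carrier R" "q \<in> carrier R" "r \<in> carrier R" "s \<in> carrier R" "p \<oplus> q = r \<oplus> s"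
  shows "q \<ominus> r = s \<ominus> p"
proof -
  have "q \<ominus> r = \<ominus> p \<oplus> (p \<oplus> q) \<ominus> r" using assms(1-4) by (simp add: r_neg1)
  also have "\<dots> = \<ominus> p \<oplus> (r \<oplus> s \<ominus> r)"
    unfolding assms(5) using assms(1-4) by (simp add: a_minus_def a_ac)
  also have "r \<oplus> s \<ominus> r = s"
    using assms(1-4) by (simp add: a_minus_def a_comm[of r s] a_assoc r_neg)
  also have "\<ominus> p \<oplus> s = s \<ominus> p"
    using assms(1-4) by (simp add: a_minus_def a_comm)
  finally show ?thesis .
qed

lemma quotient_rule_well_defined:
  assumes D_closed: "\<And>x. x \<in> carrier R \<Longrightarrow> D x \<in> carrier R"
    and D_mult: "\<And>x y. x \<in> carrier R \<Longrightarrow> y \<in> carrier R \<Longrightarrow> D (x \<otimes> y) = x \<otimes> D y \<oplus> D x \<otimes> y"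
    and car: "a \<in> carrier R" "b \<in> carrier R" "a' \<in> carrier R" "b' \<in> carrier R"
    and eq: "a \<otimes> b' = a' \<otimes> b"
  shows "(D a \<otimes> b \<ominus> D b \<otimes> a) \<otimes> (b' \<otimes> b') = (D a' \<otimes> b' \<ominus> D b' \<otimes> a') \<otimes> (b \<otimes> b)"
proof -
  note [simp] = D_closed car
  have "a \<otimes> D b' \<oplus> D a \<otimes> b' = a' \<otimes> D b \<oplus> D a' \<otimes> b"
    using D_mult[of a b'] D_mult[of a' b] eq by simp
  then have "(a \<otimes> D b' \<oplus> D a \<otimes> b') \<otimes> (b \<otimes> b') = (a' \<otimes> D b \<oplus> D a' \<otimes> b) \<otimes> (b \<otimes> b')" by simp
  then have "(a \<otimes> b') \<otimes> (D b' \<otimes> b) \<oplus> D a \<otimes> b \<otimes> (b' \<otimes> b') =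
      (a' \<otimes> b) \<otimes> (D b \<otimes> b') \<oplus> D a' \<otimes> b' \<otimes> (b \<otimes> b)"
    by (simp add: m_ac l_distr r_distr)
  then have "D a \<otimes> b \<otimes> (b' \<otimes> b') \<ominus> (a' \<otimes> b) \<otimes> (D b \<otimes> b') =
      D a' \<otimes> b' \<otimes> (b \<otimes> b) \<ominus> (a \<otimes> b') \<otimes> (D b' \<otimes> b)"
    by (rule exchange[rotated -1]) auto
  then have "D a \<otimes> b \<otimes> (b' \<otimes> b') \<ominus> (a \<otimes> b') \<otimes> (D b \<otimes> b') =
      D a' \<otimes> b' \<otimes> (b \<otimes> b) \<ominus> (a' \<otimes> b) \<otimes> (D b' \<otimes> b)"
    by (simp only: eq)
  then show ?thesis
    by (simp add: m_ac l_distr r_distr a_minus_def l_minus r_minus)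
qed

end

context
  fixes K and R :: "('a, 'm) poisson_ring_scheme" (structure)
  assumes "domain": "domain R" and PA: "poisson_algebra K R"
begin

interpretation "domain" R by (rule "domain")
interpretation poisson_algebra K R by (rule PA)

lemma fraction_bracket:
  fixes a b c d
  defines "N \<equiv> \<lambda>a b c d. \<lbrace>a, c\<rbrace> \<otimes> (b \<otimes> d) \<ominus> \<lbrace>a, d\<rbrace> \<otimes> (b \<otimes> c) \<ominus> \<lbrace>b, c\<rbrace> \<otimes> (a \<otimes> d) \<oplus> \<lbrace>b, d\<rbrace> \<otimes> (a \<otimes> c)"
  assumes abcd: "a \<in> carrier R" "b \<in> carrier R - {\<zero>}" "c \<in> carrier R" "d \<in> carrier R - {\<zero>}"
  shows "\<lbrace>fraction R a b, fraction R c d\<rbrace>\<^bsub>poisson_Frac R\<^esub> =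
    fraction R (N a b c d) ((b \<otimes> b) \<otimes> (d \<otimes> d))"
proof -
  note bracket_closed [simp]
  have closed: "N a b c d \<in> carrier R"
    if "a \<in> carrier R" "b \<in> carrier R" "c \<in> carrier R" "d \<in> carrier R" for a b c d
    using that unfolding N_def by simp
  have left: "N a' b' c d \<otimes> (b \<otimes> b) = N a b c d \<otimes> (b' \<otimes> b')"
    if car: "a \<in> carrier R" "b \<in> carrier R" "c \<in> carrier R" "d \<in> carrier R"
      "a' \<in> carrier R" "b' \<in> carrier R" and eq: "a \<otimes> b' = a' \<otimes> b" for a b c d a' b'
  proof -
    define D where "D x = \<lbrace>x, c\<rbrace> \<otimes> d \<ominus> \<lbrace>x, d\<rbrace> \<otimes> c" for x
    have N: "N x y c d = D x \<otimes> y \<ominus> D y \<otimes> x" if "x \<in> carrier R" "y \<in> carrier R" for x y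
      using that car unfolding N_def D_def
      by (simp add: a_minus_def l_distr r_distr l_minus r_minus minus_add m_ac a_ac)
    show ?thesis
      unfolding N[OF car(1,2)] N[OF car(5,6)]
    proof (rule quotient_rule_well_defined[OF "domain", symmetric])
      show "D x \<in> carrier R" if "x \<in> carrier R" for x
        using that car by (simp add: D_def)
      show "D (x \<otimes> y) = x \<otimes> D y \<oplus> D x \<otimes> y" if "x \<in> carrier R" "y \<in> carrier R" for x y
        using that car
        by (simp add: D_def bracket_leibniz a_minus_def l_distr r_distr l_minus r_minus
            minus_add m_ac a_ac)
    qed (use car eq in auto)
  qed
  have swap: "N a b c d = \<ominus> N c d a b"
    if "a \<in> carrier R" "b \<in> carrier R" "c \<in> carrier R" "d \<in> carrier R" for a b c d
    using that bracket_anti[of c a] bracket_anti[of d a] bracket_anti[of c b] bracket_anti[of d b]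
    unfolding N_def by (simp add: a_minus_def l_minus r_minus minus_add m_ac a_ac)
  have lift: "fraction R (N a' b' c' d') (b' \<otimes> b' \<otimes> (d' \<otimes> d')) =
      fraction R (N a b c d) (b \<otimes> b \<otimes> (d \<otimes> d))"
    if *: "a' \<in> carrier R" "b' \<in> carrier R - {\<zero>}" "c' \<in> carrier R" "d' \<in> carrier R - {\<zero>}"
    and eq: "a \<otimes> b' = a' \<otimes> b" "c \<otimes> d' = c' \<otimes> d" for a' b' c' d'
  proof -
    note car = *(1,3) abcd(1,3) *(2,4)[THEN DiffD1] abcd(2,4)[THEN DiffD1]
    have 1: "N a' b' c' d' \<otimes> (b \<otimes> b) = N a b c' d' \<otimes> (b' \<otimes> b')"
      using car eq by (intro left)
    have 2: "N a b c' d' \<otimes> (d \<otimes> d) = N a b c d \<otimes> (d' \<otimes> d')"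
      using left[of c d a b c' d'] car eq
      by (simp add: swap[of a b] closed l_minus)
    have "N a' b' c' d' \<otimes> ((b \<otimes> b) \<otimes> (d \<otimes> d)) = N a' b' c' d' \<otimes> (b \<otimes> b) \<otimes> (d \<otimes> d)"
      using car closed by (simp add: m_assoc)
    also have "\<dots> = N a b c' d' \<otimes> (d \<otimes> d) \<otimes> (b' \<otimes> b')"
      unfolding 1 using car closed by (simp add: m_ac)
    also have "\<dots> = N a b c d \<otimes> ((b' \<otimes> b') \<otimes> (d' \<otimes> d'))"
      unfolding 2 using car closed by (simp add: m_ac)
    finally show ?thesis
      by (intro fraction_eq_iff[THEN iffD2] closed mult_nonzero car *(2,4) abcd(2,4))
  qed
  let ?F = "\<lambda>a b c d. fraction R (N a b c d) (b \<otimes> b \<otimes> (d \<otimes> d))"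
  have "(\<Union>(a', b')\<in>fraction R a b. \<Union>(c', d')\<in>fraction R c d. ?F a' b' c' d') = ?F a b c d"
    by (rule fraction_lift2[of a b c d ?F, OF abcd lift])
  then show ?thesis
    unfolding poisson_Frac_def poisson_ring.select_convs N_def .
qed

end


section \<open>The Poisson Dixmier-Moeglin equivalence\<close>

definition poisson_locally_closed :: "('a, 'm) poisson_ring_scheme \<Rightarrow> 'a set \<Rightarrow> bool" where
  "poisson_locally_closed R P \<longleftrightarrow> P \<in> PSpec R \<and> locally_closed_in (zariski_topology R) {P}"

text \<open>The base field of \<open>Frac(R/P)\<close> is the image of \<open>K\<close>.\<close>

definition poisson_rational :: "'a set \<Rightarrow> ('a, 'm) poisson_ring_scheme \<Rightarrow> 'a set \<Rightarrow> bool" where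
  "poisson_rational K R P \<longleftrightarrow> P \<in> PSpec R \<and>
    (let Q = poisson_quotient R P; F = poisson_Frac Q
     in \<forall>z\<in>poisson_center F.
          (ring.algebraic F over ((\<lambda>c. fraction Q (P +>\<^bsub>R\<^esub> c) \<one>\<^bsub>Q\<^esub>) ` K)) z)"

definition poisson_primitive :: "('a, 'm) poisson_ring_scheme \<Rightarrow> 'a set \<Rightarrow> bool" where
  "poisson_primitive R P \<longleftrightarrow> P \<in> PSpec R \<and>
    (\<exists>M. maximalideal M R \<and> P \<subseteq> M \<and> (\<forall>I. poisson_ideal I R \<and> I \<subseteq> M \<longrightarrow> I \<subseteq> P))"

definition poisson_dixmier_moeglin :: "'a set \<Rightarrow> ('a, 'm) poisson_ring_scheme \<Rightarrow> bool" where
  "poisson_dixmier_moeglin K R \<longleftrightarrow>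
    {P. poisson_primitive R P} = {P. poisson_locally_closed R P} \<and>
    {P. poisson_locally_closed R P} = {P. poisson_rational K R P}"


section \<open>The Poisson algebras $A(n,a)$\<close>

text \<open>Monomials are finitely supported exponent functions; a polynomial maps monomials to
  coefficients.\<close>

type_synonym 'k mpoly = "(nat \<Rightarrow>\<^sub>0 nat) \<Rightarrow>\<^sub>0 'k"

definition mpoly_const :: "'k::zero \<Rightarrow> 'k mpoly" where
  "mpoly_const c = Poly_Mapping.single 0 c"

definition mpoly_var :: "nat \<Rightarrow> 'k::zero_neq_one mpoly" where
  "mpoly_var i = Poly_Mapping.single (Poly_Mapping.single i 1) 1"

text \<open>The natural subtraction is harmless: the coefficient vanishes when \<open>i\<close> does not
  occur in \<open>m\<close>.\<close>

definition mpoly_pderiv :: "nat \<Rightarrow> 'k::semiring_1 mpoly \<Rightarrow> 'k mpoly" where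
  "mpoly_pderiv i p = (\<Sum>m\<in>Poly_Mapping.keys p. Poly_Mapping.single (m - Poly_Mapping.single i 1)
     (of_nat (Poly_Mapping.lookup m i) * Poly_Mapping.lookup p m))"

definition Delta :: "nat \<Rightarrow> 'k::comm_ring_1 mpoly \<Rightarrow> 'k mpoly" where
  "Delta n f = (\<Sum>i=1..n. mpoly_var (i - 1) * mpoly_pderiv i f)"

definition Gamma :: "nat \<Rightarrow> 'k::comm_ring_1 \<Rightarrow> 'k mpoly \<Rightarrow> 'k mpoly" where
  "Gamma n a f = (\<Sum>i=0..n. mpoly_const (a + of_nat i) * mpoly_var i * mpoly_pderiv i f)"

definition mpoly_carrier :: "nat \<Rightarrow> 'k::comm_ring_1 mpoly set" where
  "mpoly_carrier n = {p. \<forall>m\<in>Poly_Mapping.keys p. Poly_Mapping.keys m \<subseteq> {0..n}}"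

definition A_poisson :: "nat \<Rightarrow> 'k::comm_ring_1 \<Rightarrow> 'k mpoly poisson_ring" where
  "A_poisson n a =
    \<lparr>carrier = mpoly_carrier n,
     monoid.mult = (*), one = 1, ring.zero = 0, add = (+),
     bracket = (\<lambda>f g. Delta n f * Gamma n a g - Gamma n a f * Delta n g)\<rparr>"

lemma mpoly_pderiv_superset:
  assumes "finite M" "Poly_Mapping.keys p \<subseteq> M"
  shows "mpoly_pderiv i p = (\<Sum>m\<in>M. Poly_Mapping.single (m - Poly_Mapping.single i 1)
     (of_nat (Poly_Mapping.lookup m i) * Poly_Mapping.lookup p m))"
  unfolding mpoly_pderiv_def using assms
  by (intro sum.mono_neutral_left) (auto simp: in_keys_iff)

lemma mpoly_pderiv_add: "mpoly_pderiv i (p + q) = mpoly_pderiv i p + mpoly_pderiv i q"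
proof -
  let ?M = "Poly_Mapping.keys p \<union> Poly_Mapping.keys q"
  show ?thesis
    using Poly_Mapping.keys_add[of p q]
    by (simp add: mpoly_pderiv_superset[where M = ?M] lookup_add distrib_left single_add sum.distrib)
qed

lemma mpoly_pderiv_single:
  "mpoly_pderiv i (Poly_Mapping.single m c) =
    Poly_Mapping.single (m - Poly_Mapping.single i 1) (of_nat (Poly_Mapping.lookup m i) * c)"
  by (subst mpoly_pderiv_superset[where M = "{m}"]) auto

lemma mpoly_pderiv_0 [simp]: "mpoly_pderiv i 0 = 0"
  by (simp add: mpoly_pderiv_def)

lemma mpoly_induct [case_names zero single add]:
  assumes "P 0" "\<And>m c. P (Poly_Mapping.single m c)" "\<And>p q. P p \<Longrightarrow> P q \<Longrightarrow> P (p + q)"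
  shows "P p"
proof (induction p rule: update_induct)
  case const
  then show ?case by (rule assms)
next
  case (update f m c)
  have "Poly_Mapping.update m c f = f + Poly_Mapping.single m c"
    using update(1) by (intro poly_mapping_eqI)
      (auto simp: lookup_update lookup_add lookup_single in_keys_iff when_def)
  then show ?case using assms update by simp
qed

lemma exponent_diff_add:
  assumes "Poly_Mapping.lookup k i \<noteq> (0::nat)"
  shows "k - Poly_Mapping.single i 1 + l = k + l - Poly_Mapping.single i 1"
  using assms
  by (intro poly_mapping_eqI) (auto simp: lookup_add lookup_minus lookup_single when_def)

lemma mpoly_pderiv_single_mult_single:
  fixes c d :: "'k::comm_ring_1" and k l i
  defines "p \<equiv> Poly_Mapping.single k c" and "q \<equiv> Poly_Mapping.single l d"
  shows "mpoly_pderiv i (p * q) = mpoly_pderiv i p * q + p * mpoly_pderiv i q"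
proof -
  let ?e = "Poly_Mapping.single i (1::nat)"
  have A: "Poly_Mapping.single (k - ?e + l) (of_nat (Poly_Mapping.lookup k i) * c * d) =
      Poly_Mapping.single (k + l - ?e) (of_nat (Poly_Mapping.lookup k i) * c * d)"
    by (cases "Poly_Mapping.lookup k i = 0") (simp_all add: exponent_diff_add[simplified])
  have B: "Poly_Mapping.single (k + (l - ?e)) (of_nat (Poly_Mapping.lookup l i) * c * d) =
      Poly_Mapping.single (k + l - ?e) (of_nat (Poly_Mapping.lookup l i) * c * d)"
    using exponent_diff_add[of l i k]
    by (cases "Poly_Mapping.lookup l i = 0") (simp_all add: add.commute)
  show ?thesis
    using A B unfolding p_def q_def
    by (simp add: mult_single mpoly_pderiv_single lookup_add single_add[symmetric] algebra_simps)
qed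

lemma mpoly_pderiv_mult:
  fixes p q :: "'k::comm_ring_1 mpoly"
  shows "mpoly_pderiv i (p * q) = mpoly_pderiv i p * q + p * mpoly_pderiv i q"
proof (induction p rule: mpoly_induct)
  case (single m c)
  show ?case
    by (induction q rule: mpoly_induct)
      (simp_all add: mpoly_pderiv_single_mult_single mpoly_pderiv_add algebra_simps)
qed (simp_all add: mpoly_pderiv_add algebra_simps)

lemma mpoly_pderiv_const [simp]: "mpoly_pderiv i (mpoly_const c) = 0"
  by (simp add: mpoly_const_def mpoly_pderiv_single)

lemma mpoly_pderiv_var [simp]:
  "mpoly_pderiv i (mpoly_var j :: 'k::comm_ring_1 mpoly) = (if i = j then 1 else 0)"
  by (simp add: mpoly_var_def mpoly_pderiv_single lookup_single when_def)


lemma mpoly_const_simps: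
  "mpoly_const (c + d) = mpoly_const c + mpoly_const (d :: 'k::comm_ring_1)"
  "mpoly_const (c * d) = mpoly_const c * mpoly_const d"
  "mpoly_const (- c) = - mpoly_const c"
  "mpoly_const 0 = (0 :: 'k mpoly)"
  "mpoly_const 1 = (1 :: 'k mpoly)"
  by (simp_all add: mpoly_const_def single_add mult_single single_uminus)

lemma derivation_eq_0:
  fixes D :: "'k::comm_ring_1 mpoly \<Rightarrow> 'k mpoly"
  assumes add: "\<And>p q. D (p + q) = D p + D q"
    and mult: "\<And>p q. D (p * q) = D p * q + p * D q"
    and const: "\<And>c. D (mpoly_const c) = 0" and var: "\<And>i. D (mpoly_var i) = 0"
  shows "D p = 0"
proof (induction p rule: mpoly_induct)
  case zero
  show ?case using const[of 0] by (simp add: mpoly_const_simps)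
next
  case (add p q)
  then show ?case by (simp add: assms)
next
  case (single m c)
  have one: "D 1 = 0" using const[of 1] by (simp add: mpoly_const_simps)
  have *: "D (Poly_Mapping.single (Poly_Mapping.single i k) 1) = 0" for i k
  proof (induction k)
    case (Suc k)
    have "Poly_Mapping.single (Poly_Mapping.single i (Suc k)) 1 =
        mpoly_var i * (Poly_Mapping.single (Poly_Mapping.single i k) 1 :: 'k mpoly)"
      by (simp add: mpoly_var_def mult_single flip: single_add)
    then show ?case by (simp add: mult var Suc)
  qed (simp add: one)
  show ?case
  proof (induction m rule: update_induct)
    case const
    then show ?case using assms(3)[of c] by (simp add: mpoly_const_def)
  next
    case (update f i k)
    have "Poly_Mapping.update i k f = Poly_Mapping.single i k + f"
      using update(1) by (intro poly_mapping_eqI)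
        (auto simp: lookup_update lookup_add lookup_single in_keys_iff when_def)
    then have "Poly_Mapping.single (Poly_Mapping.update i k f) c =
        Poly_Mapping.single (Poly_Mapping.single i k) 1 * Poly_Mapping.single f c"
      by (simp add: mult_single)
    then show ?case by (simp add: mult * update)
  qed
qed

lemma Delta_add: "Delta n (f + g) = Delta n f + Delta n g"
  by (simp add: Delta_def mpoly_pderiv_add distrib_left sum.distrib)

lemma Delta_mult: "Delta n (f * g) = Delta n f * g + f * Delta n g"
  by (simp add: Delta_def mpoly_pderiv_mult sum_distrib_left sum_distrib_right
      algebra_simps sum.distrib)

lemma Delta_const [simp]: "Delta n (mpoly_const c) = 0"
  by (simp add: Delta_def)

lemma Delta_var:
  "Delta n (mpoly_var i) = (if i \<in> {1..n} then mpoly_var (i - 1) else 0)"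
  by (simp add: Delta_def if_distrib[of "\<lambda>x. _ * x"] cong: if_cong)

lemma Gamma_add: "Gamma n a (f + g) = Gamma n a f + Gamma n a g"
  by (simp add: Gamma_def mpoly_pderiv_add distrib_left sum.distrib)

lemma Gamma_mult: "Gamma n a (f * g) = Gamma n a f * g + f * Gamma n a g"
  by (simp add: Gamma_def mpoly_pderiv_mult sum_distrib_left sum_distrib_right
      algebra_simps sum.distrib)

lemma Gamma_const [simp]: "Gamma n a (mpoly_const c) = 0"
  by (simp add: Gamma_def)

lemma Gamma_var:
  "Gamma n a (mpoly_var i) = (if i \<le> n then mpoly_const (a + of_nat i) * mpoly_var i else 0)"
  by (simp add: Gamma_def if_distrib[of "\<lambda>x. _ * x"] cong: if_cong)

lemma Delta_0 [simp]: "Delta n 0 = 0"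
  by (simp add: Delta_def)

lemma Delta_uminus: "Delta n (- f) = - Delta n f"
  by (simp add: eq_neg_iff_add_eq_0 flip: Delta_add)

lemma Gamma_0 [simp]: "Gamma n a 0 = 0"
  by (simp add: Gamma_def)

lemma Gamma_uminus: "Gamma n a (- f) = - Gamma n a f"
  by (simp add: eq_neg_iff_add_eq_0 flip: Gamma_add)

lemma Delta_diff: "Delta n (f - g) = Delta n f - Delta n g"
  using Delta_add[of n f "- g"] by (simp add: Delta_uminus)

lemma Gamma_diff: "Gamma n a (f - g) = Gamma n a f - Gamma n a g"
  using Gamma_add[of n a f "- g"] by (simp add: Gamma_uminus)

lemma Delta_Gamma: "Delta n (Gamma n a f) = Gamma n a (Delta n f) + Delta n f"
proof -
  have "Delta n (Gamma n a f) - Gamma n a (Delta n f) - Delta n f = 0"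
  proof (rule derivation_eq_0[where D = "\<lambda>f. Delta n (Gamma n a f) - Gamma n a (Delta n f) - Delta n f"])
    fix i
    show "Delta n (Gamma n a (mpoly_var i)) - Gamma n a (Delta n (mpoly_var i)) -
        Delta n (mpoly_var i) = 0"
      by (cases i) (simp_all add: Delta_var Gamma_var Delta_mult Delta_add mpoly_const_simps distrib_right)
  qed (simp_all add: Delta_add Gamma_add Delta_mult Gamma_mult algebra_simps)
  then show ?thesis by (simp add: algebra_simps)
qed

lemma mpoly_carrier_intros:
  "mpoly_const c \<in> mpoly_carrier n"
  "i \<le> n \<Longrightarrow> mpoly_var i \<in> mpoly_carrier n"
  "p \<in> mpoly_carrier n \<Longrightarrow> q \<in> mpoly_carrier n \<Longrightarrow> p + q \<in> mpoly_carrier n"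
  "p \<in> mpoly_carrier n \<Longrightarrow> - p \<in> mpoly_carrier n"
  "p \<in> mpoly_carrier n \<Longrightarrow> q \<in> mpoly_carrier n \<Longrightarrow> p - q \<in> mpoly_carrier n"
  "0 \<in> mpoly_carrier n" "1 \<in> mpoly_carrier n"
  using Poly_Mapping.keys_add[of p q] keys_diff[of p q]
  by (auto simp: mpoly_carrier_def mpoly_const_def mpoly_var_def subset_iff)

lemma mpoly_carrier_mult:
  assumes "p \<in> mpoly_carrier n" "q \<in> mpoly_carrier n"
  shows "p * q \<in> mpoly_carrier n"
  unfolding mpoly_carrier_def
proof safe
  fix m i assume "m \<in> Poly_Mapping.keys (p * q)" and i: "i \<in> Poly_Mapping.keys m"
  then obtain k l where "m = k + l" "k \<in> Poly_Mapping.keys p" "l \<in> Poly_Mapping.keys q"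
    using keys_mult[of p q] by blast
  then show "i \<in> {0..n}"
    using assms i Poly_Mapping.keys_add[of k l] by (auto simp: mpoly_carrier_def subset_iff)
qed

lemma mpoly_carrier_sum:
  "(\<And>i. i \<in> I \<Longrightarrow> f i \<in> mpoly_carrier n) \<Longrightarrow> sum f I \<in> mpoly_carrier n"
  by (induction I rule: infinite_finite_induct) (auto intro: mpoly_carrier_intros)

lemma mpoly_carrier_pderiv:
  assumes "p \<in> mpoly_carrier n"
  shows "mpoly_pderiv i p \<in> mpoly_carrier n"
  unfolding mpoly_pderiv_def
proof (rule mpoly_carrier_sum)
  fix m assume "m \<in> Poly_Mapping.keys p"
  then have "Poly_Mapping.keys m \<subseteq> {0..n}" using assms by (auto simp: mpoly_carrier_def)
  moreover have "Poly_Mapping.keys (m - Poly_Mapping.single i 1) \<subseteq> Poly_Mapping.keys m"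
    by (auto simp: in_keys_iff lookup_minus)
  ultimately show "Poly_Mapping.single (m - Poly_Mapping.single i 1) c \<in> mpoly_carrier n" for c
    by (auto simp: mpoly_carrier_def)
qed

lemma mpoly_carrier_Delta: "p \<in> mpoly_carrier n \<Longrightarrow> Delta n p \<in> mpoly_carrier n"
  unfolding Delta_def
  by (intro mpoly_carrier_sum mpoly_carrier_mult mpoly_carrier_pderiv mpoly_carrier_intros) auto

lemma mpoly_carrier_Gamma: "p \<in> mpoly_carrier n \<Longrightarrow> Gamma n a p \<in> mpoly_carrier n"
  unfolding Gamma_def
  by (intro mpoly_carrier_sum mpoly_carrier_mult mpoly_carrier_pderiv mpoly_carrier_intros) auto

lemma A_poisson_sel:
  "carrier (A_poisson n a) = mpoly_carrier n"
  "x \<otimes>\<^bsub>A_poisson n a\<^esub> y = x * y"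
  "\<one>\<^bsub>A_poisson n a\<^esub> = 1"
  "\<zero>\<^bsub>A_poisson n a\<^esub> = 0"
  "x \<oplus>\<^bsub>A_poisson n a\<^esub> y = x + y"
  "\<lbrace>x, y\<rbrace>\<^bsub>A_poisson n a\<^esub> = Delta n x * Gamma n a y - Gamma n a x * Delta n y"
  by (simp_all add: A_poisson_def)

lemma cring_A_poisson: "cring (A_poisson n a)"
proof (rule cringI)
  show "abelian_group (A_poisson n a)"
  proof (rule abelian_groupI)
    fix x assume "x \<in> carrier (A_poisson n a)"
    then show "\<exists>y\<in>carrier (A_poisson n a). y \<oplus>\<^bsub>A_poisson n a\<^esub> x = \<zero>\<^bsub>A_poisson n a\<^esub>"
      by (intro bexI[of _ "- x"]) (auto simp: A_poisson_sel intro: mpoly_carrier_intros)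
  qed (auto simp: A_poisson_sel algebra_simps intro: mpoly_carrier_intros)
  show "comm_monoid (A_poisson n a)"
    by (rule comm_monoidI)
      (auto simp: A_poisson_sel algebra_simps intro: mpoly_carrier_intros mpoly_carrier_mult)
qed (auto simp: A_poisson_sel algebra_simps)

lemma A_poisson_uminus:
  assumes "x \<in> mpoly_carrier n"
  shows "\<ominus>\<^bsub>A_poisson n a\<^esub> x = - x"
proof -
  interpret cring "A_poisson n a" by (rule cring_A_poisson)
  show ?thesis
    using assms by (intro minus_equality) (auto simp: A_poisson_sel intro: mpoly_carrier_intros)
qed

lemma subfield_A_poisson: "subfield (range mpoly_const) (A_poisson n (a :: 'k::field))"
proof -
  interpret cring "A_poisson n a" by (rule cring_A_poisson)
  have "subring (range mpoly_const) (A_poisson n a)"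
  proof (rule subringI)
    fix h assume "h \<in> range (mpoly_const :: 'k \<Rightarrow> _)"
    then obtain c where h: "h = mpoly_const c" by blast
    then have "\<ominus>\<^bsub>A_poisson n a\<^esub> h = mpoly_const (- c)"
      by (simp add: A_poisson_uminus mpoly_carrier_intros mpoly_const_simps)
    then show "\<ominus>\<^bsub>A_poisson n a\<^esub> h \<in> range mpoly_const" by blast
  qed (auto simp: A_poisson_sel mpoly_carrier_intros simp flip: mpoly_const_simps)
  moreover have "Units (A_poisson n a\<lparr>carrier := range mpoly_const\<rparr>) = range mpoly_const - {0}"
  proof
    show "Units (A_poisson n a\<lparr>carrier := range mpoly_const\<rparr>) \<subseteq> range mpoly_const - {0}"
      by (auto simp: Units_def A_poisson_sel)
    show "range mpoly_const - {0} \<subseteq> Units (A_poisson n a\<lparr>carrier := range mpoly_const\<rparr>)"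
    proof
      fix h assume "h \<in> range (mpoly_const :: 'k \<Rightarrow> _) - {0}"
      then obtain c :: 'k where h: "h = mpoly_const c" "h \<noteq> 0" by blast
      then have c: "h = mpoly_const c" "c \<noteq> 0" by (auto simp: mpoly_const_simps)
      then have "mpoly_const (inverse c) * h = 1" "h * mpoly_const (inverse c) = 1"
        by (simp_all flip: mpoly_const_simps)
      then show "h \<in> Units (A_poisson n a\<lparr>carrier := range mpoly_const\<rparr>)"
        using c by (auto simp: Units_def A_poisson_sel)
    qed
  qed
  ultimately show ?thesis
    by (intro subfieldI subcringI') (simp_all add: A_poisson_sel)
qed

lemma poisson_algebra_A_poisson:
  "poisson_algebra (range mpoly_const) (A_poisson n (a :: 'k::field))"
proof (intro poisson_algebra.intro poisson_algebra_axioms.intro)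
  have closed: "\<lbrace>x, y\<rbrace>\<^bsub>A_poisson n a\<^esub> \<in> carrier (A_poisson n a)"
    if "x \<in> carrier (A_poisson n a)" "y \<in> carrier (A_poisson n a)" for x y
    using that unfolding A_poisson_sel
    by (intro mpoly_carrier_intros mpoly_carrier_mult mpoly_carrier_Delta mpoly_carrier_Gamma)
  fix x y z
  assume *: "x \<in> carrier (A_poisson n a)" "y \<in> carrier (A_poisson n a)"
  then show "\<lbrace>x, y\<rbrace>\<^bsub>A_poisson n a\<^esub> \<in> carrier (A_poisson n a)" by (rule closed)
  show "\<lbrace>x, y\<rbrace>\<^bsub>A_poisson n a\<^esub> = \<ominus>\<^bsub>A_poisson n a\<^esub> \<lbrace>y, x\<rbrace>\<^bsub>A_poisson n a\<^esub>"
    using closed[OF *(2,1)] by (simp add: A_poisson_uminus A_poisson_sel mult.commute)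
qed (auto simp: A_poisson_sel Delta_diff Gamma_diff Delta_add Gamma_add Delta_mult Gamma_mult
      Delta_Gamma algebra_simps intro: subfield_A_poisson cring_A_poisson)

end

theory Submission
  imports Defs
begin

text \<open>A Poisson prime \<open>P\<close> of \<open>A = A(n,a)\<close> either contains all brackets or is stable under \<open>\<Delta>\<close> and
  \<open>\<Gamma>\<close>: in the plane over \<open>Frac (A/P)\<close>, every \<open>(\<Delta> x, \<Gamma> x)\<close> with \<open>x \<in> P\<close> is parallel to all
  \<open>(\<Delta> g, \<Gamma> g)\<close>. In the first case all three properties say that \<open>P\<close> is maximal.

  Rational implies locally closed: let \<open>c = X\<^sub>i\<close> be the first variable outside a stable \<open>P\<close> and
  \<open>s = X\<^sub>i\<^sub>+\<^sub>1 / X\<^sub>i\<close>, so that \<open>\<Delta> s = 1\<close> modulo \<open>P\<close>. The Dixmier map \<open>\<Sum> (-s)\<^sup>k / k! \<Delta>\<^sup>k\<close> sends the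
  variables to generators \<open>y\<^sub>j\<close> of the kernel of \<open>\<Delta>\<close>, which are eigenvectors of \<open>\<Gamma>\<close>. A stable prime
  \<open>Q\<close> above \<open>P\<close> contains a \<open>\<Gamma>\<close>-eigenvector \<open>h \<notin> P\<close> of this kernel. Its quotient by a monomial in
  the \<open>y\<^sub>j\<close> of the same weight is Poisson central, hence algebraic, so \<open>Q\<close> contains \<open>c\<close> or one of the
  nonzero \<open>y\<^sub>j\<close>.

  Locally closed implies primitive: a maximal ideal over \<open>P\<close> avoiding the separating element exists
  by Zariski's lemma, and its \<open>(\<Delta>, \<Gamma>)\<close>-core is a Poisson prime, hence \<open>P\<close>.

  Primitive implies rational: the denominators of a Poisson central fraction form a Poisson ideal,
  so the fraction can be evaluated in the residue field of the maximal ideal, which is algebraic.\<close>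


section \<open>Zariski's lemma\<close>

text \<open>The field \<open>'k\<close> is not assumed algebraically closed, so a maximal ideal need
  not be a point; what is available is that its residue field is algebraic, which is the use of
  Zariski's lemma. Fractions are mostly kept out of the argument: being algebraic or Poisson central
  is restated as membership of a polynomial in \<open>P\<close> (\<open>algebraic_mod\<close>,
  \<open>poisson_central_mod\<close>), and the Dixmier map is multiplied by a power of
  \<open>X_i\<close>, which suffices because \<Delta> is locally nilpotent on polynomials. The first
  variable outside \<open>P\<close> is taken because \<Delta> maps it into \<open>P\<close>, so it
  is a constant for \<Delta> modulo \<open>P\<close>. Its index is below \<open>n\<close>, as
  otherwise \<Delta> would map everything, and hence all brackets, into \<open>P\<close>. Two kernel
  elements of equal weight have a quotient killed by both derivations, which makes it central. An
  algebraic relation for \<open>v/u\<close> is homogeneous in \<open>u\<close> and \<open>v\<close>,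
  so \<open>u\<close> in \<open>Q\<close> forces the leading term, hence \<open>v\<close>, into
  \<open>Q\<close>. Characteristic zero serves the coefficients \<open>1/k!\<close> and the binomial
  coefficient in the primality of a core.\<close>

lemma (in domain) one_plus_mult_eval:
  assumes K: "subfield K R" and x: "x \<in> carrier R"
    and b: "b \<in> simple_extension K x" "b \<noteq> \<zero>"
  obtains p where "p \<in> carrier (K[X])" "length p \<ge> 2" "eval p x = b \<otimes> x \<oplus> \<one>"
proof -
  have KR: "K \<subseteq> carrier R" and sub: "subring K R"
    using subfieldE(3,1)[OF K] .
  obtain B where B: "B \<in> carrier (K[X])" "eval B x = b"
    using b(1) unfolding simple_extension_as_eval_img[OF KR x] by blast
  have Bne: "B \<noteq> []" using B b(2) by auto
  have setB: "set B \<subseteq> carrier R"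
    using B(1) KR unfolding univ_poly_carrier[symmetric] polynomial_def by auto
  \<comment> \<open>Coefficient lists start with the leading coefficient, so appending
    \<open>\<one>\<close> turns \<open>B\<close> into \<open>B X + 1\<close>, of positive degree
    because \<open>B\<close> is nonempty.\<close>
  have "B @ [\<one>] \<in> carrier (K[X])"
    using B(1) Bne subringE(3)[OF sub]
    unfolding univ_poly_carrier[symmetric] polynomial_def by auto
  moreover have "eval (B @ [\<one>]) x = b \<otimes> x \<oplus> \<one>"
    using eval_append_aux[OF setB one_closed x] B(2) by simp
  moreover have "length (B @ [\<one>]) \<ge> 2" using Bne by (cases B) auto
  ultimately show ?thesis using that by blast
qed

text \<open>For transcendental \<open>x\<close> evaluation is injective on \<open>K[X]\<close>,
  where the units are the nonzero constants, whereas \<open>b x + 1\<close> comes from a polynomial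
  of positive degree.\<close>

lemma (in domain) one_plus_mult_transcendental:
  assumes K: "subfield K R" and x: "x \<in> carrier R" and tr: "\<not> (algebraic over K) x"
    and b: "b \<in> simple_extension K x" "b \<noteq> \<zero>"
  shows "b \<otimes> x \<oplus> \<one> \<noteq> \<zero>"
    and "k \<in> simple_extension K x \<Longrightarrow> (b \<otimes> x \<oplus> \<one>) \<otimes> k \<noteq> \<one>"
proof -
  have KR: "K \<subseteq> carrier R" and sub: "subring K R"
    using subfieldE(3,1)[OF K] .
  have tr': "(transcendental over K) x" using tr by (simp add: over_def)
  interpret UP: "domain" "K[X]" by (rule univ_poly_is_domain[OF sub])
  obtain p where p: "p \<in> carrier (K[X])" "length p \<ge> 2" and ev: "eval p x = b \<otimes> x \<oplus> \<one>"
    using one_plus_mult_eval[OF K x b] .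
  have "p \<noteq> []" using p(2) by auto
  then show "b \<otimes> x \<oplus> \<one> \<noteq> \<zero>" using algebraicI[of p K x] p(1) ev tr by auto
  assume "k \<in> simple_extension K x"
  then obtain C where C: "C \<in> carrier (K[X])" "eval C x = k"
    unfolding simple_extension_as_eval_img[OF KR x] by blast
  note hom = ring_hom_memE[OF eval_is_hom[OF sub x]]
  show "(b \<otimes> x \<oplus> \<one>) \<otimes> k \<noteq> \<one>"
  proof
    assume "(b \<otimes> x \<oplus> \<one>) \<otimes> k = \<one>"
    then have "eval (p \<otimes>\<^bsub>K[X]\<^esub> C) x = eval \<one>\<^bsub>K[X]\<^esub> x"
      using hom(2)[OF p(1) C(1)] hom(4) ev C(2) by simp
    then have pC: "p \<otimes>\<^bsub>K[X]\<^esub> C = \<one>\<^bsub>K[X]\<^esub>"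
      by (rule inj_onD[OF tr'[unfolded over_def transcendental_def] _ UP.m_closed[OF p(1) C(1)] UP.one_closed])
    then have "p \<in> Units (K[X])"
      using p C(1) UP.m_comm[of p C] unfolding Units_def by auto
    then show False
      using univ_poly_units_incl[OF sub] p(2) by auto
  qed
qed

text \<open>If \<open>E\<close> is spanned over \<open>L = K(x)\<close> by \<open>u\<^sub>1, \<dots>, u\<^sub>d\<close> and \<open>x\<close> is transcendental, a common
  denominator \<open>b\<close> of finitely many structure constants gives \<open>E \<subseteq> \<Sum> K[x]\<^sub>b u\<^sub>i\<close>, hence
  \<open>L = K[x]\<^sub>b\<close>, although \<open>1 + x b\<close> is not invertible in \<open>K[x]\<^sub>b\<close>.\<close>

lemma (in field) generated_over_rational_function_field_imp_algebraic:
  assumes K: "subfield K R" and x: "x \<in> carrier R" and xs: "set xs \<subseteq> carrier R"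
    and gen: "finite_extension K (x # xs) = carrier R"
    and L: "subfield L R" and dim: "finite_dimension L (carrier R)"
    and Leq: "L = {a \<otimes> inv b |a b. a \<in> simple_extension K x \<and> b \<in> simple_extension K x - {\<zero>}}"
  shows "(algebraic over K) x"
proof (rule ccontr)
  assume tr: "\<not> (algebraic over K) x"
  let ?S = "simple_extension K x"
  have KR: "K \<subseteq> carrier R" and sub: "subring K R"
    using subfieldE(3,1)[OF K] .
  have S: "subring ?S R" by (rule simple_extension_is_subring[OF sub x])
  note S' = subringE[OF S]
  have SR: "\<And>s. s \<in> ?S \<Longrightarrow> s \<in> carrier R" using S'(1) by blast
  have LR: "L \<subseteq> carrier R" and Ls: "subring L R" using subfieldE(3,1)[OF L] .
  note L' = subringE[OF Ls]
  have xS: "x \<in> ?S" by (rule simple_extension_mem[OF sub x])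
  have KS: "K \<subseteq> ?S" by (rule simple_extension_incl[OF KR x])
  have quotI: "p \<otimes> inv q \<in> L" if "p \<in> ?S" "q \<in> ?S" "q \<noteq> \<zero>" for p q
    unfolding Leq using that by blast
  have SL: "?S \<subseteq> L"
  proof
    fix s assume s: "s \<in> ?S"
    show "s \<in> L" using quotI[OF s S'(3)] SR[OF s] by simp
  qed
  \<comment> \<open>For nonzero \<open>b\<close> in \<open>K[x]\<close> this is the localization
    \<open>K[x]_b\<close> inside \<open>L\<close>.\<close>
  define T where "T b = {l \<in> L. \<exists>m::nat. b [^] m \<otimes> l \<in> ?S}" for b
  have powS: "b [^] (m::nat) \<in> ?S" if "b \<in> ?S" for b m
    using that by (induction m) (auto simp: S')
  have T_S: "?S \<subseteq> T b" if "b \<in> ?S" for b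
    unfolding T_def using SL S'(6) powS[OF that] by blast
  have T_mult: "l \<otimes> l' \<in> T b" if lb: "b \<in> ?S" "l \<in> T b" "l' \<in> T b" for l l' b
  proof -
    obtain m m' :: nat where "b [^] m \<otimes> l \<in> ?S" "b [^] m' \<otimes> l' \<in> ?S" using lb(2,3) unfolding T_def by blast
    then have "(b [^] m \<otimes> l) \<otimes> (b [^] m' \<otimes> l') \<in> ?S" by (rule S'(6))
    moreover have "(b [^] m \<otimes> l) \<otimes> (b [^] m' \<otimes> l') = b [^] (m + m') \<otimes> (l \<otimes> l')"
      using that SR LR by (auto simp: T_def nat_pow_mult[symmetric] m_ac subset_iff)
    ultimately show ?thesis unfolding T_def using that L'(6) by (auto simp: T_def)
  qed
  have T_add: "l \<oplus> l' \<in> T b" if lb: "b \<in> ?S" "l \<in> T b" "l' \<in> T b" for l l' b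
  proof -
    obtain m m' :: nat where m: "b [^] m \<otimes> l \<in> ?S" "b [^] m' \<otimes> l' \<in> ?S" using lb(2,3) unfolding T_def by blast
    have "b [^] m' \<otimes> (b [^] m \<otimes> l) \<oplus> b [^] m \<otimes> (b [^] m' \<otimes> l') \<in> ?S"
      by (intro S'(7) S'(6)[OF powS[OF lb(1)]] m)
    moreover have "b [^] m' \<otimes> (b [^] m \<otimes> l) \<oplus> b [^] m \<otimes> (b [^] m' \<otimes> l') = b [^] (m + m') \<otimes> (l \<oplus> l')"
      using that SR LR by (auto simp: T_def nat_pow_mult[symmetric] m_ac r_distr subset_iff)
    ultimately show ?thesis unfolding T_def using that L'(7) by (auto simp: T_def)
  qed
  have T_mono: "T b \<subseteq> T (b \<otimes> c)" if "b \<in> ?S" "c \<in> ?S" for b c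
  proof
    fix l assume l: "l \<in> T b"
    then obtain m :: nat where "b [^] m \<otimes> l \<in> ?S" unfolding T_def by blast
    then have "c [^] m \<otimes> (b [^] m \<otimes> l) \<in> ?S" by (rule S'(6)[OF powS[OF that(2)]])
    moreover have "c [^] m \<otimes> (b [^] m \<otimes> l) = (b \<otimes> c) [^] m \<otimes> l"
      using that SR LR l by (auto simp: T_def nat_pow_distrib m_ac subset_iff)
    ultimately show "l \<in> T (b \<otimes> c)" using l by (auto simp: T_def)
  qed
  obtain Us where Us: "set Us \<subseteq> carrier R" "independent L Us" "Span L Us = carrier R"
    using dim exists_base[OF L] unfolding finite_dimension_def by metis
  have Une: "Us \<noteq> []"
  proof
    assume "Us = []"
    then have "carrier R = {\<zero>}" using Us(3) by simp
    then show False using one_not_zero by blast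
  qed
  \<comment> \<open>The module over \<open>T b\<close> spanned by the \<open>L\<close>-basis
    \<open>Us\<close>.\<close>
  define M where "M b = {combine Ks Us |Ks. set Ks \<subseteq> T b \<and> length Ks = length Us}" for b
  have TR: "T b \<subseteq> carrier R" for b using LR by (auto simp: T_def)
  have M_mono: "M b \<subseteq> M (b \<otimes> c)" if "b \<in> ?S" "c \<in> ?S" for b c
    unfolding M_def using T_mono[OF that] by blast
  have ex1: "\<exists>b\<in>?S - {\<zero>}. set Ks \<subseteq> T b" if "set Ks \<subseteq> L" for Ks
    using that
  proof (induction Ks)
    case Nil
    then show ?case using S'(3) one_not_zero by auto
  next
    case (Cons l Ks)
    then obtain b where b: "b \<in> ?S - {\<zero>}" "set Ks \<subseteq> T b" by auto
    obtain a c where ac: "l = a \<otimes> inv c" "a \<in> ?S" "c \<in> ?S - {\<zero>}" using Cons(2) Leq by auto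
    have "c [^] (1::nat) \<otimes> l = a" using ac SR field_Units by (simp add: m_lcomm)
    then have "l \<in> T c" using Cons(2) ac(2) unfolding T_def by (simp, metis)
    then have "l \<in> T (b \<otimes> c)" using T_mono[of c b] ac b m_comm[of b c] SR by auto
    moreover have "set Ks \<subseteq> T (b \<otimes> c)" using T_mono[of b c] ac b by auto
    moreover have "b \<otimes> c \<in> ?S - {\<zero>}" using ac b SR S'(6) integral[of b c] by auto
    ultimately show ?case by auto
  qed
  have ex2: "\<exists>b\<in>?S - {\<zero>}. V \<subseteq> M b" if "finite V" "V \<subseteq> carrier R" for V
    using that
  proof (induction V)
    case empty
    then show ?case using S'(3) one_not_zero by auto
  next
    case (insert v V)
    then obtain b where b: "b \<in> ?S - {\<zero>}" "V \<subseteq> M b" by auto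
    obtain Ks where Ks: "set Ks \<subseteq> L" "length Ks = length Us" "v = combine Ks Us"
      using insert(4) Span_mem_iff_length_version[OF L Us(1)] Us(3) by auto
    obtain c where c: "c \<in> ?S - {\<zero>}" "set Ks \<subseteq> T c" using ex1[OF Ks(1)] by blast
    then have "v \<in> M c" using Ks by (auto simp: M_def)
    then have "v \<in> M (b \<otimes> c)" using M_mono[of c b] b c m_comm[of b c] SR by auto
    moreover have "V \<subseteq> M (b \<otimes> c)" using M_mono[of b c] b c by auto
    moreover have "b \<otimes> c \<in> ?S - {\<zero>}" using b c SR S'(6) integral[of b c] by auto
    ultimately show ?case by auto
  qed
  \<comment> \<open>The products of generators with basis vectors are the structure constants in
    vector form: once they lie in \<open>M b\<close>, linearity makes \<open>M b\<close> closed
    under multiplication by \<open>xs\<close>.\<close>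
  let ?V = "insert \<one> (\<Union>y\<in>set xs. (\<lambda>u. y \<otimes> u) ` set Us)"
  obtain b where b: "b \<in> ?S" "b \<noteq> \<zero>" and V: "?V \<subseteq> M b"
    using ex2[of ?V] xs Us(1) by auto
  have MR: "M b \<subseteq> carrier R" unfolding M_def using TR[of b] Us(1) combine_in_carrier by blast
  have MI: "combine Ks Us \<in> M b" if "set Ks \<subseteq> T b" "length Ks = length Us" for Ks
    unfolding M_def using that by blast
  have M_add: "v \<oplus> w \<in> M b" if "v \<in> M b" "w \<in> M b" for v w
  proof -
    obtain Ks Js where *: "set Ks \<subseteq> T b" "length Ks = length Us" "v = combine Ks Us"
      "set Js \<subseteq> T b" "length Js = length Us" "w = combine Js Us" using \<open>v \<in> M b\<close> \<open>w \<in> M b\<close> unfolding M_def by blast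
    have "v \<oplus> w = combine (map2 (\<oplus>) Ks Js) Us"
      using * combine_add[OF *(2,5)] TR[of b] Us(1) by auto
    moreover have "set (map2 (\<oplus>) Ks Js) \<subseteq> T b"
    proof
      fix l assume "l \<in> set (map2 (\<oplus>) Ks Js)"
      then obtain i j where "(i, j) \<in> set (zip Ks Js)" "l = i \<oplus> j" by auto
      then show "l \<in> T b"
        using *(1,4) set_zip_leftD[of i j Ks Js] set_zip_rightD[of i j Ks Js]
        by (auto intro!: T_add[OF b(1)])
    qed
    moreover have "length (map2 (\<oplus>) Ks Js) = length Us" using * by simp
    ultimately show ?thesis using MI by metis
  qed
  have M_smult: "l \<otimes> v \<in> M b" if "l \<in> T b" "v \<in> M b" for v l
  proof -
    obtain Ks where *: "set Ks \<subseteq> T b" "length Ks = length Us" "v = combine Ks Us"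
      using \<open>v \<in> M b\<close> unfolding M_def by blast
    have "l \<otimes> v = combine (map ((\<otimes>) l) Ks) Us"
      using * that TR[of b] Us(1) by (auto simp: combine_r_distr subset_iff)
    moreover have "set (map ((\<otimes>) l) Ks) \<subseteq> T b"
      using * T_mult[OF b(1) that(1)] by auto
    moreover have "length (map ((\<otimes>) l) Ks) = length Us" using * by simp
    ultimately show ?thesis using MI by metis
  qed
  have M_zero: "\<zero> \<in> M b"
    using MI[of "replicate (length Us) \<zero>"] combine_replicate[OF Us(1)] T_S[OF b(1)] S'(2)
    by (simp add: subset_iff)
  have M_comb: "combine Ks Vs \<in> M b" if "set Ks \<subseteq> T b" "set Vs \<subseteq> M b" for Ks Vs
    using that
    by (induction Ks Vs rule: combine.induct) (auto intro!: M_add M_smult M_zero)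
  \<comment> \<open>The multiplier ring of \<open>M b\<close>. It contains \<open>K\<close>,
    \<open>x\<close> and \<open>xs\<close>, hence everything, and \<open>1\<close> in
    \<open>M b\<close> then puts every \<open>r\<close> into \<open>M b\<close>.\<close>
  define N where "N = {r \<in> carrier R. \<forall>v\<in>M b. r \<otimes> v \<in> M b}"
  have "subring N R"
  proof (rule subringI)
    show "\<ominus> h \<in> N" if "h \<in> N" for h
    proof -
      have "\<ominus> \<one> \<in> T b" using S'(3,5) T_S[OF b(1)] by blast
      then have "\<ominus> \<one> \<otimes> (h \<otimes> v) \<in> M b" if "v \<in> M b" for v
        using M_smult that \<open>h \<in> N\<close> by (auto simp: N_def)
      then show ?thesis using that MR by (auto simp: N_def l_minus subset_iff)
    qed
    show "h1 \<otimes> h2 \<in> N" if "h1 \<in> N" "h2 \<in> N" for h1 h2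
      using that MR by (auto simp: N_def m_assoc subset_iff)
    show "h1 \<oplus> h2 \<in> N" if "h1 \<in> N" "h2 \<in> N" for h1 h2
      using that MR M_add by (auto simp: N_def l_distr subset_iff)
  qed (use MR in \<open>auto simp: N_def subset_iff\<close>)
  moreover have SN: "?S \<subseteq> N"
    using T_S[OF b(1)] M_smult SR by (auto simp: N_def)
  moreover have "set xs \<subseteq> N"
  proof
    fix y assume y: "y \<in> set xs"
    have "y \<otimes> v \<in> M b" if v: "v \<in> M b" for v
    proof -
      obtain Ks where *: "set Ks \<subseteq> T b" "v = combine Ks Us" using v unfolding M_def by blast
      have "v \<otimes> y = combine Ks (map (\<lambda>u. u \<otimes> y) Us)"
        unfolding *(2) using * TR[of b] Us(1) y xs by (intro combine_l_distr) auto
      moreover have "set (map (\<lambda>u. u \<otimes> y) Us) \<subseteq> M b"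
      proof
        fix w assume "w \<in> set (map (\<lambda>u. u \<otimes> y) Us)"
        then obtain u where u: "u \<in> set Us" "w = u \<otimes> y" by auto
        then have "w = y \<otimes> u" using y xs Us(1) by (auto intro: m_comm)
        then show "w \<in> M b" using V u y by auto
      qed
      ultimately have "v \<otimes> y \<in> M b" using M_comb * by auto
      then show ?thesis using m_comm[OF subsetD[OF MR v] subsetD[OF xs y]] by simp
    qed
    then show "y \<in> N" using y xs by (auto simp: N_def)
  qed
  ultimately have "finite_extension K (x # xs) \<subseteq> N"
    using KS xS by (intro finite_extension_subring_incl) auto
  then have RN: "carrier R \<subseteq> N" using gen by simp
  have RM: "carrier R \<subseteq> M b"
  proof
    fix r assume r: "r \<in> carrier R"
    then have "\<forall>v\<in>M b. r \<otimes> v \<in> M b" using RN unfolding N_def by blast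
    then have "r \<otimes> \<one> \<in> M b" using V by blast
    then show "r \<in> M b" using r by simp
  qed
  \<comment> \<open>Compare coordinates of \<open>l u\<close> for the first basis vector
    \<open>u\<close>: over \<open>L\<close> only \<open>(l, 0, ..., 0)\<close> is possible, while
    membership in \<open>M b\<close> supplies coordinates in \<open>T b\<close>.\<close>
  have LT: "L \<subseteq> T b"
  proof
    fix l assume l: "l \<in> L"
    obtain u Vs where uv: "Us = u # Vs" using Une by (cases Us) auto
    let ?Ks = "l # replicate (length Vs) \<zero>"
    have lu: "combine ?Ks Us \<in> carrier R"
      using l LR Us(1) uv by (intro combine_in_carrier) auto
    have "\<exists>!Ks. set Ks \<subseteq> L \<and> length Ks = length Us \<and> combine ?Ks Us = combine Ks Us"
      using unique_decomposition[OF L Us(2), of "combine ?Ks Us"] lu Us(3) by simp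
    moreover have "set ?Ks \<subseteq> L" "length ?Ks = length Us" using l L'(2) uv by auto
    moreover obtain Js where "set Js \<subseteq> T b" "length Js = length Us" "combine ?Ks Us = combine Js Us"
      using lu RM unfolding M_def by blast
    moreover have "T b \<subseteq> L" by (auto simp: T_def)
    ultimately have "?Ks = Js" by blast
    then show "l \<in> T b" using \<open>set Js \<subseteq> T b\<close> by auto
  qed
  define w where "w = b \<otimes> x \<oplus> \<one>"
  have w: "w \<in> ?S" unfolding w_def using b(1) xS S' by auto
  have "w \<noteq> \<zero>"
    unfolding w_def by (rule one_plus_mult_transcendental(1)[OF K x tr b])
  then have "inv w \<in> L" using quotI[OF S'(3) w] SR[OF w] field_Units by simp
  then obtain m :: nat where m: "b [^] m \<otimes> inv w \<in> ?S" using LT unfolding T_def by blast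
  have wU: "w \<in> Units R" using SR[OF w] \<open>w \<noteq> \<zero>\<close> field_Units by simp
  have "w \<otimes> (b [^] m \<otimes> inv w) = b [^] m \<otimes> (w \<otimes> inv w)"
    using SR[OF w] SR[OF b(1)] wU by (intro m_lcomm) auto
  then have "b [^] m = w \<otimes> (b [^] m \<otimes> inv w)" using wU SR[OF b(1)] by simp
  then have "\<exists>k\<in>?S. b [^] m = w \<otimes> k" using m by blast
  \<comment> \<open>\<open>w\<close> and \<open>b\<close> are coprime, since
    \<open>1 = w - x b\<close>. So \<open>b ^ m = w b ^ m - x b ^ (m+1)\<close> is divisible by
    \<open>w\<close> as soon as \<open>b ^ (m+1)\<close> is, and descent to \<open>m = 0\<close>
    makes \<open>w\<close> a unit of \<open>K[x]\<close>.\<close>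
  then have "\<exists>k\<in>?S. \<one> = w \<otimes> k"
  proof (induction m)
    case (Suc m)
    then obtain k where k: "k \<in> ?S" "b [^] Suc m = w \<otimes> k" by blast
    have c: "b \<in> carrier R" "k \<in> carrier R" "w \<in> carrier R" "x \<in> carrier R"
      using b k w x SR by auto
    have "b [^] m \<otimes> w = x \<otimes> b [^] Suc m \<oplus> b [^] m"
      using c by (simp add: w_def r_distr m_ac)
    then have "b [^] m = b [^] m \<otimes> w \<ominus> x \<otimes> b [^] Suc m"
      using c by (simp add: a_minus_def a_assoc a_comm[of "x \<otimes> (b [^] m \<otimes> b)"] r_neg)
    also have "\<dots> = w \<otimes> (b [^] m \<ominus> x \<otimes> k)"
      unfolding k(2) using c by (simp add: r_distr a_minus_def m_ac r_minus)
    finally have "b [^] m = w \<otimes> (b [^] m \<ominus> x \<otimes> k)" .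
    moreover have "b [^] m \<ominus> x \<otimes> k \<in> ?S"
      unfolding a_minus_def using powS[OF b(1)] xS k(1) by (intro S'(5-7))
    ultimately show ?case using Suc(1) by blast
  qed auto
  then show False
    using one_plus_mult_transcendental(2)[OF K x tr b] unfolding w_def by metis
qed

text \<open>Induction on the generators proves finite dimension, for all base fields at once because
  the hypothesis is applied twice: over \<open>K(x)\<close>, to show that \<open>x\<close> is
  algebraic, and then over \<open>K[x]\<close>, which is thereby a field. The tower over
  \<open>K[x]\<close> finishes the step.\<close>

theorem (in field) zariski_lemma:
  assumes "subfield K R" "set xs \<subseteq> carrier R" "finite_extension K xs = carrier R"
    and "y \<in> carrier R"
  shows "(algebraic over K) y"
proof -
  have "finite_dimension K (carrier R)"
    using assms(1-3)
  proof (induction xs arbitrary: K)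
    case Nil
    then show ?case using dimension_one[OF Nil(1)] by (auto intro: finite_dimensionI)
  next
    case (Cons x xs)
    let ?S = "simple_extension K x"
    have x: "x \<in> carrier R" and xs: "set xs \<subseteq> carrier R" using Cons(3) by auto
    have KR: "K \<subseteq> carrier R" and sub: "subring K R" using subfieldE(3,1)[OF Cons(2)] .
    have S: "subring ?S R" by (rule simple_extension_is_subring[OF sub x])
    note S' = subringE[OF S]
    have SR: "s \<in> carrier R" if "s \<in> ?S" for s using S'(1) that by blast
    have xS: "x \<in> ?S" by (rule simple_extension_mem[OF sub x])
    have KS: "K \<subseteq> ?S" by (rule simple_extension_incl[OF KR x])
    have gen: "finite_extension L xs = carrier R" if L: "subring L R" "?S \<subseteq> L" for L
    proof
      have E: "subring (finite_extension L xs) R" by (rule finite_extension_is_subring[OF L(1) xs])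
      show "finite_extension L xs \<subseteq> carrier R" by (rule subringE(1)[OF E])
      have "L \<subseteq> finite_extension L xs"
        by (rule finite_extension_incl[OF subringE(1)[OF L(1)] xs])
      then have "finite_extension K (x # xs) \<subseteq> finite_extension L xs"
        using KS xS L(2) finite_extension_mem[OF L(1) xs]
        by (intro finite_extension_subring_incl[OF E]) auto
      then show "carrier R \<subseteq> finite_extension L xs" using Cons(4) by simp
    qed
    have alg: "(algebraic over K) x"
    proof -
      define L where "L = {a \<otimes> inv b |a b. a \<in> ?S \<and> b \<in> ?S - {\<zero>}}"
      have quotI: "p \<otimes> inv q \<in> L" if "p \<in> ?S" "q \<in> ?S" "q \<noteq> \<zero>" for p q
        unfolding L_def using that by blast
      have SL: "?S \<subseteq> L"
      proof
        fix s assume s: "s \<in> ?S"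
        show "s \<in> L" using quotI[OF s S'(3)] SR[OF s] by simp
      qed
      have LE: "\<exists>p\<in>?S. \<exists>q\<in>?S - {\<zero>}. l = p \<otimes> inv q" if "l \<in> L" for l
        using that unfolding L_def by blast
      have U: "q \<in> Units R" "q \<in> carrier R" "q \<noteq> \<zero>" if "q \<in> ?S - {\<zero>}" for q
        using that SR field_Units by auto
      have L: "subring L R"
      proof (rule subringI)
        show "L \<subseteq> carrier R" unfolding L_def using U SR by auto
        show "\<one> \<in> L" using SL S'(3) by blast
        fix h assume "h \<in> L"
        then obtain p q where h: "p \<in> ?S" "q \<in> ?S - {\<zero>}" "h = p \<otimes> inv q" using LE by blast
        have "\<ominus> h = \<ominus> p \<otimes> inv q" using h SR U by (simp add: l_minus)
        then show "\<ominus> h \<in> L" using quotI[OF S'(5)[OF h(1)]] h(2) by simp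
        fix h' assume "h' \<in> L"
        then obtain p' q' where h': "p' \<in> ?S" "q' \<in> ?S - {\<zero>}" "h' = p' \<otimes> inv q'" using LE by blast
        note c = SR[OF h(1)] SR[OF h'(1)] U[OF h(2)] U[OF h'(2)]
        have i: "inv (q \<otimes> q') = inv q \<otimes> inv q'"
        proof (rule comm_inv_char)
          have "q \<otimes> q' \<otimes> (inv q \<otimes> inv q') = (q \<otimes> inv q) \<otimes> (q' \<otimes> inv q')"
            using c Units_inv_closed by (simp only: m_ac m_closed)
          then show "q \<otimes> q' \<otimes> (inv q \<otimes> inv q') = \<one>" using c by simp
        qed (use c in auto)
        have nz: "q \<otimes> q' \<in> ?S" "q \<otimes> q' \<noteq> \<zero>"
          using S'(6) h(2) h'(2) integral[of q q'] c by auto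
        have "h \<otimes> h' = (p \<otimes> p') \<otimes> inv (q \<otimes> q')"
          unfolding h(3) h'(3) i using c by (simp add: m_ac)
        then show "h \<otimes> h' \<in> L" using quotI[OF S'(6)[OF h(1) h'(1)] nz] by simp
        have 1: "(p \<otimes> q') \<otimes> inv (q \<otimes> q') = (p \<otimes> inv q) \<otimes> (q' \<otimes> inv q')"
          unfolding i using c Units_inv_closed by (simp only: m_ac m_closed)
        have 2: "(p' \<otimes> q) \<otimes> inv (q \<otimes> q') = (p' \<otimes> inv q') \<otimes> (q \<otimes> inv q)"
          unfolding i using c Units_inv_closed by (simp only: m_ac m_closed)
        have "h \<oplus> h' = (p \<otimes> q') \<otimes> inv (q \<otimes> q') \<oplus> (p' \<otimes> q) \<otimes> inv (q \<otimes> q')"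
          unfolding 1 2 h(3) h'(3) using c by simp
        also have "\<dots> = (p \<otimes> q' \<oplus> p' \<otimes> q) \<otimes> inv (q \<otimes> q')"
          unfolding i using c by (simp add: l_distr)
        finally show "h \<oplus> h' \<in> L"
          using quotI[OF _ nz, of "p \<otimes> q' \<oplus> p' \<otimes> q"] S'(6,7) h(1,2) h'(1,2) by simp
      qed
      have "subfield L R"
      proof (rule subfieldI'[OF L])
        fix k assume "k \<in> L - {\<zero>}"
        then obtain p q where k: "p \<in> ?S" "q \<in> ?S - {\<zero>}" "k = p \<otimes> inv q" "k \<noteq> \<zero>" using LE by blast
        have p: "p \<noteq> \<zero>" using k U by auto
        then have pU: "p \<in> Units R" using SR[OF k(1)] field_Units by simp
        have "inv k = q \<otimes> inv p"
        proof (rule comm_inv_char)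
          have "k \<otimes> (q \<otimes> inv p) = (p \<otimes> inv p) \<otimes> (q \<otimes> inv q)"
            unfolding k(3) using pU U[OF k(2)] Units_inv_closed SR[OF k(1)] by (simp only: m_ac m_closed)
          then show "k \<otimes> (q \<otimes> inv p) = \<one>" using pU U[OF k(2)] by simp
        qed (use k(3) pU U[OF k(2)] SR[OF k(1)] in auto)
        then show "inv k \<in> L" using quotI[of q p] k p by simp
      qed
      moreover have "finite_dimension L (carrier R)"
        by (rule Cons.IH[OF calculation xs gen[OF L SL]])
      ultimately show ?thesis
        using generated_over_rational_function_field_imp_algebraic[OF Cons(2) x xs Cons(4) _ _ L_def]
        by blast
    qed
    have Sf: "subfield ?S R" using simple_extension_is_subfield[OF Cons(2) x] alg by blast
    have "finite_dimension ?S (carrier R)"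
      by (rule Cons.IH[OF Sf xs gen[OF S order.refl]])
    moreover have "finite_dimension K ?S"
      using dimension_simple_extension[OF Cons(2) x alg] by (rule finite_dimensionI)
    ultimately show ?case using telescopic_base_dim(1)[OF Cons(2) Sf] by blast
  qed
  then show ?thesis
    by (rule finite_dimension_imp_algebraic[OF assms(1) carrier_is_subring _ assms(4)])
qed

section \<open>Ideals of the polynomial ring and residue fields\<close>

lemma mpoly_carrier_power: "p \<in> mpoly_carrier n \<Longrightarrow> p ^ m \<in> mpoly_carrier n"
  by (induction m) (auto intro: mpoly_carrier_intros mpoly_carrier_mult)

text \<open>Ideals of \<open>A_poisson n a\<close> seen as sets of polynomials, so that computations
  use the ring operations of the type \<open>'k mpoly\<close> instead of those of the
  record.\<close>

locale mpoly_ideal =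
  fixes n :: nat and I :: "'k::field_char_0 mpoly set"
  assumes sub: "I \<subseteq> mpoly_carrier n"
    and zero: "0 \<in> I"
    and add: "\<lbrakk>x \<in> I; y \<in> I\<rbrakk> \<Longrightarrow> x + y \<in> I"
    and mult: "\<lbrakk>r \<in> mpoly_carrier n; x \<in> I\<rbrakk> \<Longrightarrow> r * x \<in> I"
begin

lemma uminus: "x \<in> I \<Longrightarrow> - x \<in> I"
  using mult[of "-1" x] by (simp add: mpoly_carrier_intros)

lemma diff: "\<lbrakk>x \<in> I; y \<in> I\<rbrakk> \<Longrightarrow> x - y \<in> I"
  using add[of x "- y"] uminus by simp

lemma mult_right: "\<lbrakk>x \<in> I; r \<in> mpoly_carrier n\<rbrakk> \<Longrightarrow> x * r \<in> I"
  using mult[of r x] by (simp add: mult.commute)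

lemma sum_mem: "(\<And>i. i \<in> A \<Longrightarrow> f i \<in> I) \<Longrightarrow> sum f A \<in> I"
  by (induction A rule: infinite_finite_induct) (auto intro: zero add)

lemma diff_cancel: "\<lbrakk>x - y \<in> I; y \<in> I\<rbrakk> \<Longrightarrow> x \<in> I"
  using add[of "x - y" y] by simp

lemma diff_cancel': "\<lbrakk>x - y \<in> I; x \<in> I\<rbrakk> \<Longrightarrow> y \<in> I"
  using diff[of x "x - y"] by simp

end

locale mpoly_prime = mpoly_ideal +
  assumes one: "1 \<notin> I"
    and prime: "\<lbrakk>x \<in> mpoly_carrier n; y \<in> mpoly_carrier n; x * y \<in> I\<rbrakk> \<Longrightarrow> x \<in> I \<or> y \<in> I"
begin

lemma const: "mpoly_const c \<in> I \<longleftrightarrow> c = 0"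
proof
  assume c: "mpoly_const c \<in> I"
  show "c = 0"
  proof (rule ccontr)
    assume "c \<noteq> 0"
    have "mpoly_const (inverse c) * mpoly_const c \<in> I"
      by (intro mult c mpoly_carrier_intros)
    then show False using one \<open>c \<noteq> 0\<close> by (simp flip: mpoly_const_simps)
  qed
qed (simp add: mpoly_const_simps zero)

lemma power: "\<lbrakk>x \<in> mpoly_carrier n; x ^ m \<in> I\<rbrakk> \<Longrightarrow> x \<in> I"
proof (induction m)
  case (Suc m)
  then show ?case using prime[of x "x ^ m"] by (auto intro: mpoly_carrier_power)
qed (use one in simp)

end

lemma ideal_A_poisson_iff: "ideal I (A_poisson n a) \<longleftrightarrow> mpoly_ideal n I"
proof
  assume "ideal I (A_poisson n a)"
  then interpret ideal I "A_poisson n a" .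
  show "mpoly_ideal n I"
    using a_subset additive_subgroup.zero_closed[OF additive_subgroup_axioms]
      additive_subgroup.a_closed[OF additive_subgroup_axioms] I_l_closed
    by unfold_locales (auto simp: A_poisson_sel)
next
  assume "mpoly_ideal n I"
  then interpret I: mpoly_ideal n I .
  interpret cring "A_poisson n a" by (rule cring_A_poisson)
  show "ideal I (A_poisson n a)"
  proof (rule idealI[OF ring_axioms])
    show "subgroup I (add_monoid (A_poisson n a))"
    proof (rule add.subgroupI)
      show "\<ominus>\<^bsub>A_poisson n a\<^esub> x \<in> I" if "x \<in> I" for x
        using A_poisson_uminus[of x n a] I.uminus[OF that] I.sub that by auto
    qed (use I.sub I.zero I.add in \<open>auto simp: A_poisson_sel\<close>)
  qed (auto simp: A_poisson_sel I.mult I.mult_right)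
qed

lemma primeideal_A_poisson_iff: "primeideal I (A_poisson n a) \<longleftrightarrow> mpoly_prime n I"
proof
  assume "primeideal I (A_poisson n a)"
  then interpret primeideal I "A_poisson n a" .
  interpret I: mpoly_ideal n I using ideal_axioms by (simp add: ideal_A_poisson_iff)
  show "mpoly_prime n I"
  proof unfold_locales
    show "1 \<notin> I" using one_imp_carrier I_notcarr by (auto simp: A_poisson_sel)
  qed (use I_prime in \<open>auto simp: A_poisson_sel\<close>)
next
  assume "mpoly_prime n I"
  then interpret mpoly_prime n I .
  show "primeideal I (A_poisson n a)"
  proof (intro primeideal.intro primeideal_axioms.intro)
    show "ideal I (A_poisson n a)" by (simp add: ideal_A_poisson_iff mpoly_ideal_axioms)
    show "carrier (A_poisson n a) \<noteq> I" using one mpoly_carrier_intros(7) by (auto simp: A_poisson_sel)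
  qed (use prime in \<open>auto simp: A_poisson_sel cring_A_poisson\<close>)
qed

section \<open>The field of fractions of a domain\<close>

context
  fixes R :: "('a, 'm) poisson_ring_scheme" (structure)
  assumes dom: "domain R"
begin

interpretation "domain" R by (rule dom)

lemma poisson_Frac_carrierE:
  assumes "z \<in> carrier (poisson_Frac R)"
  obtains a b where "z = fraction R a b" "a \<in> carrier R" "b \<in> carrier R - {\<zero>}"
  using assms by (auto simp: poisson_Frac_def)

lemma poisson_Frac_fraction_closed:
  "\<lbrakk>a \<in> carrier R; b \<in> carrier R - {\<zero>}\<rbrakk> \<Longrightarrow> fraction R a b \<in> carrier (poisson_Frac R)"
  by (auto simp: poisson_Frac_def)

lemma poisson_Frac_one: "\<one>\<^bsub>poisson_Frac R\<^esub> = fraction R \<one> \<one>"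
  and poisson_Frac_zero: "\<zero>\<^bsub>poisson_Frac R\<^esub> = fraction R \<zero> \<one>"
  by (simp_all add: poisson_Frac_def)

lemma fraction_eq_zero_iff:
  "\<lbrakk>a \<in> carrier R; b \<in> carrier R - {\<zero>}\<rbrakk> \<Longrightarrow> fraction R a b = \<zero>\<^bsub>poisson_Frac R\<^esub> \<longleftrightarrow> a = \<zero>"
  unfolding poisson_Frac_zero by (subst fraction_eq_iff) auto

lemma field_poisson_Frac: "field (poisson_Frac R)"
proof -
  let ?F = "poisson_Frac R"
  have "cring ?F"
  proof (rule cringI)
    show "abelian_group ?F"
    proof (rule abelian_groupI)
      fix x y assume "x \<in> carrier ?F" "y \<in> carrier ?F"
      then obtain a b c d where *: "x = fraction R a b" "a \<in> carrier R" "b \<in> carrier R - {\<zero>}"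
        "y = fraction R c d" "c \<in> carrier R" "d \<in> carrier R - {\<zero>}"
        by (auto elim!: poisson_Frac_carrierE)
      note nz' = mult_nonzero[OF *(3,6)]
      show "x \<oplus>\<^bsub>?F\<^esub> y \<in> carrier ?F"
        unfolding *(1,4) using * nz' by (auto simp: fraction_add[OF dom] intro!: poisson_Frac_fraction_closed)
      show "x \<oplus>\<^bsub>?F\<^esub> y = y \<oplus>\<^bsub>?F\<^esub> x"
        unfolding *(1,4) fraction_add[OF dom *(2,3,5,6)] fraction_add[OF dom *(5,6,2,3)]
        using * by (simp add: m_ac a_ac)
      fix z assume "z \<in> carrier ?F"
      then obtain e f where z: "z = fraction R e f" "e \<in> carrier R" "f \<in> carrier R - {\<zero>}"
        by (auto elim!: poisson_Frac_carrierE)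
      note nz'' = mult_nonzero[OF nz' z(3)] mult_nonzero[OF *(6) z(3)]
      show "(x \<oplus>\<^bsub>?F\<^esub> y) \<oplus>\<^bsub>?F\<^esub> z = x \<oplus>\<^bsub>?F\<^esub> (y \<oplus>\<^bsub>?F\<^esub> z)"
        unfolding *(1,4) z(1) fraction_add[OF dom *(2,3,5,6)] fraction_add[OF dom *(5,6) z(2,3)]
        using * z nz' nz'' by (subst (1 2) fraction_add[OF dom]) (auto simp: m_ac a_ac l_distr r_distr)
    next
      show "\<zero>\<^bsub>?F\<^esub> \<in> carrier ?F"
        unfolding poisson_Frac_zero by (intro poisson_Frac_fraction_closed) auto
      fix x assume "x \<in> carrier ?F"
      then obtain a b where *: "x = fraction R a b" "a \<in> carrier R" "b \<in> carrier R - {\<zero>}"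
        by (auto elim!: poisson_Frac_carrierE)
      note nz' = mult_nonzero[OF *(3,3)]
      show "\<zero>\<^bsub>?F\<^esub> \<oplus>\<^bsub>?F\<^esub> x = x"
        unfolding poisson_Frac_zero *(1) using * by (simp add: fraction_add[OF dom])
      have "fraction R (\<ominus> a) b \<oplus>\<^bsub>?F\<^esub> x = fraction R (\<ominus> a \<otimes> b \<oplus> a \<otimes> b) (b \<otimes> b)"
        unfolding *(1) using * by (simp add: fraction_add[OF dom])
      also have "\<ominus> a \<otimes> b \<oplus> a \<otimes> b = \<zero>" using * by (simp add: l_minus l_neg)
      also have "fraction R \<zero> (b \<otimes> b) = \<zero>\<^bsub>?F\<^esub>" using nz' by (subst fraction_eq_zero_iff) auto
      finally show "\<exists>y\<in>carrier ?F. y \<oplus>\<^bsub>?F\<^esub> x = \<zero>\<^bsub>?F\<^esub>"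
        using * by (intro bexI[of _ "fraction R (\<ominus> a) b"] poisson_Frac_fraction_closed) auto
    qed
    show "comm_monoid ?F"
    proof (rule comm_monoidI)
      show "\<one>\<^bsub>?F\<^esub> \<in> carrier ?F"
        unfolding poisson_Frac_one by (intro poisson_Frac_fraction_closed) auto
      fix x y assume "x \<in> carrier ?F" "y \<in> carrier ?F"
      then obtain a b c d where *: "x = fraction R a b" "a \<in> carrier R" "b \<in> carrier R - {\<zero>}"
        "y = fraction R c d" "c \<in> carrier R" "d \<in> carrier R - {\<zero>}"
        by (auto elim!: poisson_Frac_carrierE)
      note nz' = mult_nonzero[OF *(3,6)]
      show "x \<otimes>\<^bsub>?F\<^esub> y \<in> carrier ?F"
        unfolding *(1,4) using * nz' by (auto simp: fraction_mult[OF dom] intro!: poisson_Frac_fraction_closed)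
      show "x \<otimes>\<^bsub>?F\<^esub> y = y \<otimes>\<^bsub>?F\<^esub> x"
        unfolding *(1,4) fraction_mult[OF dom *(2,3,5,6)] fraction_mult[OF dom *(5,6,2,3)]
        using * by (simp add: m_ac a_ac)
      show "\<one>\<^bsub>?F\<^esub> \<otimes>\<^bsub>?F\<^esub> x = x"
        unfolding poisson_Frac_one *(1) using * by (simp add: fraction_mult[OF dom])
      fix z assume "z \<in> carrier ?F"
      then obtain e f where z: "z = fraction R e f" "e \<in> carrier R" "f \<in> carrier R - {\<zero>}"
        by (auto elim!: poisson_Frac_carrierE)
      note nz'' = mult_nonzero[OF nz' z(3)] mult_nonzero[OF *(6) z(3)]
      show "(x \<otimes>\<^bsub>?F\<^esub> y) \<otimes>\<^bsub>?F\<^esub> z = x \<otimes>\<^bsub>?F\<^esub> (y \<otimes>\<^bsub>?F\<^esub> z)"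
        unfolding *(1,4) z(1) fraction_mult[OF dom *(2,3,5,6)] fraction_mult[OF dom *(5,6) z(2,3)]
        using * z nz' nz'' by (subst (1 2) fraction_mult[OF dom]) (auto simp: m_ac)
    qed
    fix x y z assume "x \<in> carrier ?F" "y \<in> carrier ?F" "z \<in> carrier ?F"
    moreover from \<open>z \<in> carrier ?F\<close> obtain e f where
      "z = fraction R e f" "e \<in> carrier R" "f \<in> carrier R - {\<zero>}"
      by (auto elim!: poisson_Frac_carrierE)
    ultimately obtain a b c d where *: "x = fraction R a b" "a \<in> carrier R" "b \<in> carrier R - {\<zero>}"
      "y = fraction R c d" "c \<in> carrier R" "d \<in> carrier R - {\<zero>}"
      "z = fraction R e f" "e \<in> carrier R" "f \<in> carrier R - {\<zero>}"
      by (auto elim!: poisson_Frac_carrierE)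
    note nz' = mult_nonzero[OF *(3,6)] mult_nonzero[OF *(3,9)] mult_nonzero[OF *(6,9)]
    note nz'' = mult_nonzero[OF nz'(1) *(9)] mult_nonzero[OF nz'(2,3)]
    show "(x \<oplus>\<^bsub>?F\<^esub> y) \<otimes>\<^bsub>?F\<^esub> z = x \<otimes>\<^bsub>?F\<^esub> z \<oplus>\<^bsub>?F\<^esub> y \<otimes>\<^bsub>?F\<^esub> z"
      unfolding *(1,4,7) fraction_mult[OF dom *(2,3,8,9)] fraction_mult[OF dom *(5,6,8,9)]
        fraction_add[OF dom *(2,3,5,6)]
      using * nz' nz'' by (subst fraction_add[OF dom] fraction_mult[OF dom]; (subst fraction_mult[OF dom])?; (subst fraction_eq_iff)?) (auto simp: m_ac l_distr r_distr)
  qed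
  then interpret F: cring ?F .
  show ?thesis
  proof (rule F.cring_fieldI2)
    show "\<zero>\<^bsub>?F\<^esub> \<noteq> \<one>\<^bsub>?F\<^esub>"
      using fraction_eq_zero_iff[of \<one> \<one>] by (simp add: poisson_Frac_one)
    fix x assume x: "x \<in> carrier ?F" "x \<noteq> \<zero>\<^bsub>?F\<^esub>"
    then obtain a b where *: "x = fraction R a b" "a \<in> carrier R" "b \<in> carrier R - {\<zero>}"
      by (auto elim!: poisson_Frac_carrierE)
    then have a: "a \<in> carrier R - {\<zero>}" using x(2) fraction_eq_zero_iff by auto
    have "x \<otimes>\<^bsub>?F\<^esub> fraction R b a = \<one>\<^bsub>?F\<^esub>"
      unfolding *(1) poisson_Frac_one using * a mult_nonzero[OF *(3) a]
      by (simp add: fraction_mult[OF dom] fraction_eq_iff m_ac)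
    then show "\<exists>y\<in>carrier ?F. x \<otimes>\<^bsub>?F\<^esub> y = \<one>\<^bsub>?F\<^esub>"
      using * a by (intro bexI[of _ "fraction R b a"] poisson_Frac_fraction_closed) auto
  qed
qed

end

text \<open>Stated for arbitrary prime ideals, since residue rings are also formed for maximal
  ideals that need not be Poisson.\<close>

lemma domain_poisson_quotient:
  assumes "primeideal P R"
  shows "domain (poisson_quotient R P)"
proof -
  let ?Q = "poisson_quotient R P"
  interpret D: "domain" "R Quot P" by (rule primeideal.quotient_is_domain[OF assms])
  have "cring ?Q"
  proof (rule cringI)
    show "abelian_group ?Q"
    proof (rule abelian_groupI)
      show "\<exists>y\<in>carrier ?Q. y \<oplus>\<^bsub>?Q\<^esub> x = \<zero>\<^bsub>?Q\<^esub>" if "x \<in> carrier ?Q" for x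
        using that D.l_neg D.a_inv_closed unfolding poisson_quotient_sel by blast
    qed (simp_all only: poisson_quotient_sel D.a_closed D.zero_closed D.a_ac
        D.l_zero D.r_zero)
    show "comm_monoid ?Q"
      by (rule comm_monoidI)
        (simp_all only: poisson_quotient_sel D.m_closed D.one_closed D.m_ac
          D.l_one D.r_one)
  qed (simp_all only: poisson_quotient_sel D.l_distr D.a_closed D.m_closed)
  then show ?thesis
    using D.one_not_zero D.integral
    by (simp add: domain_def domain_axioms_def poisson_quotient_sel)
qed

text \<open>A homogenized polynomial relation of degree \<open>d\<close>: for \<open>v\<close>
  outside a prime \<open>P\<close> it says that \<open>u/v\<close> is algebraic over the base field.
  Only the leading coefficient has to be nonzero.\<close>

definition algebraic_mod :: "'k::comm_ring_1 mpoly set \<Rightarrow> 'k mpoly \<Rightarrow> 'k mpoly \<Rightarrow> bool" where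
  "algebraic_mod P u v \<longleftrightarrow>
    (\<exists>d c. c d \<noteq> 0 \<and> (\<Sum>r\<le>d. mpoly_const (c r) * u ^ r * v ^ (d - r)) \<in> P)"

section \<open>Arithmetic and algebraic elements in Frac (A/P)\<close>

locale mpoly_prime_quotient = mpoly_prime n P for n and P :: "'k::field_char_0 mpoly set" +
  fixes a :: 'k
begin

abbreviation "A \<equiv> A_poisson n a"
abbreviation "Q \<equiv> poisson_quotient A P"
abbreviation "F \<equiv> poisson_Frac Q"
abbreviation "cl x \<equiv> P +>\<^bsub>A\<^esub> x"
abbreviation "fr u v \<equiv> fraction Q (cl u) (cl v)"

lemma primeideal: "primeideal P A"
  by (simp add: primeideal_A_poisson_iff mpoly_prime_axioms)

sublocale I: primeideal P A by (rule primeideal)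

sublocale Q: "domain" Q by (rule domain_poisson_quotient[OF primeideal])

sublocale F: field F by (rule field_poisson_Frac[OF Q.domain_axioms])

lemma cl_hom: "ring_hom_ring A Q cl"
  using I.rcos_ring_hom
  by (intro ring_hom_ringI2 I.ring_axioms Q.ring_axioms) (simp add: ring_hom_def poisson_quotient_sel)

lemmas cl_hom_facts = ring_hom_memE[OF ring_hom_ring.homh[OF cl_hom]]

lemma cl_closed: "x \<in> mpoly_carrier n \<Longrightarrow> cl x \<in> carrier Q"
  using cl_hom_facts(1)[of x] by (simp add: A_poisson_sel)

lemma cl_mult: "\<lbrakk>x \<in> mpoly_carrier n; y \<in> mpoly_carrier n\<rbrakk> \<Longrightarrow> cl x \<otimes>\<^bsub>Q\<^esub> cl y = cl (x * y)"
  using cl_hom_facts(2)[of x y] by (simp add: A_poisson_sel)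

lemma cl_add: "\<lbrakk>x \<in> mpoly_carrier n; y \<in> mpoly_carrier n\<rbrakk> \<Longrightarrow> cl x \<oplus>\<^bsub>Q\<^esub> cl y = cl (x + y)"
  using cl_hom_facts(3)[of x y] by (simp add: A_poisson_sel)

lemma cl_diff:
  assumes "x \<in> mpoly_carrier n" "y \<in> mpoly_carrier n"
  shows "cl x \<ominus>\<^bsub>Q\<^esub> cl y = cl (x - y)"
proof -
  have "cl x = cl (x - y) \<oplus>\<^bsub>Q\<^esub> cl y" using assms by (simp add: cl_add mpoly_carrier_intros)
  then show ?thesis
    using assms by (simp add: a_minus_def Q.a_assoc Q.r_neg cl_closed mpoly_carrier_intros)
qed

lemma one_Q: "\<one>\<^bsub>Q\<^esub> = cl 1"
  using cl_hom_facts(4) by (simp add: A_poisson_sel)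

lemma cl_eq_zero_iff: "x \<in> mpoly_carrier n \<Longrightarrow> cl x = \<zero>\<^bsub>Q\<^esub> \<longleftrightarrow> x \<in> P"
  using I.a_rcos_self[of x] I.a_rcos_const[of x] 
  by (auto simp: poisson_quotient_sel FactRing_def A_poisson_sel)

lemma cl_eq_iff:
  assumes "x \<in> mpoly_carrier n" "y \<in> mpoly_carrier n"
  shows "cl x = cl y \<longleftrightarrow> x - y \<in> P"
  using cl_eq_zero_iff[of "x - y"] cl_diff[OF assms] Q.r_right_minus_eq[of "cl x" "cl y"] assms
  by (simp add: cl_closed mpoly_carrier_intros)

lemma Q_carrierE:
  assumes "x \<in> carrier Q"
  obtains y where "x = cl y" "y \<in> mpoly_carrier n"
  using assms unfolding poisson_quotient_sel FactRing_def A_RCOSETS_def'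
  by (auto simp: A_poisson_sel)

lemma cl_nonzero: "\<lbrakk>v \<in> mpoly_carrier n; v \<notin> P\<rbrakk> \<Longrightarrow> cl v \<in> carrier Q - {\<zero>\<^bsub>Q\<^esub>}"
  by (simp add: cl_closed cl_eq_zero_iff)

lemma fr_closed:
  "\<lbrakk>u \<in> mpoly_carrier n; v \<in> mpoly_carrier n; v \<notin> P\<rbrakk> \<Longrightarrow> fr u v \<in> carrier F"
  by (intro poisson_Frac_fraction_closed[OF Q.domain_axioms] cl_closed cl_nonzero)

lemma F_carrierE:
  assumes "z \<in> carrier F"
  obtains u v where "z = fr u v" "u \<in> mpoly_carrier n" "v \<in> mpoly_carrier n" "v \<notin> P"
proof -
  obtain x y where xy: "z = fraction Q x y" "x \<in> carrier Q" "y \<in> carrier Q - {\<zero>\<^bsub>Q\<^esub>}"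
    using poisson_Frac_carrierE[OF Q.domain_axioms assms] .
  obtain u where u: "x = cl u" "u \<in> mpoly_carrier n" using Q_carrierE[OF xy(2)] .
  obtain v where v: "y = cl v" "v \<in> mpoly_carrier n" using Q_carrierE[of y] xy(3) by blast
  show ?thesis using that[of u v] xy u v cl_eq_zero_iff by auto
qed

lemma fr_mult:
  assumes "u \<in> mpoly_carrier n" "v \<in> mpoly_carrier n" "v \<notin> P"
    "u' \<in> mpoly_carrier n" "v' \<in> mpoly_carrier n" "v' \<notin> P"
  shows "fr u v \<otimes>\<^bsub>F\<^esub> fr u' v' = fr (u * u') (v * v')"
  using assms by (simp add: fraction_mult[OF Q.domain_axioms] cl_closed cl_nonzero cl_mult cl_eq_zero_iff)

lemma fr_add:
  assumes "u \<in> mpoly_carrier n" "v \<in> mpoly_carrier n" "v \<notin> P"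
    "u' \<in> mpoly_carrier n" "v' \<in> mpoly_carrier n" "v' \<notin> P"
  shows "fr u v \<oplus>\<^bsub>F\<^esub> fr u' v' = fr (u * v' + u' * v) (v * v')"
  using assms by (simp add: fraction_add[OF Q.domain_axioms] cl_closed cl_nonzero cl_mult cl_add
      cl_eq_zero_iff mpoly_carrier_mult)

lemma fr_eq_iff:
  assumes "u \<in> mpoly_carrier n" "v \<in> mpoly_carrier n" "v \<notin> P"
    "u' \<in> mpoly_carrier n" "v' \<in> mpoly_carrier n" "v' \<notin> P"
  shows "fr u v = fr u' v' \<longleftrightarrow> u * v' - u' * v \<in> P"
  using assms by (simp add: Q.fraction_eq_iff cl_closed cl_nonzero cl_mult cl_eq_iff
      cl_eq_zero_iff mpoly_carrier_mult)

lemma one_F: "\<one>\<^bsub>F\<^esub> = fr 1 1"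
  by (simp add: poisson_Frac_one[OF Q.domain_axioms] one_Q)

lemma fr_eq_zero_iff:
  "\<lbrakk>u \<in> mpoly_carrier n; v \<in> mpoly_carrier n; v \<notin> P\<rbrakk> \<Longrightarrow> fr u v = \<zero>\<^bsub>F\<^esub> \<longleftrightarrow> u \<in> P"
  by (simp add: fraction_eq_zero_iff[OF Q.domain_axioms] cl_closed cl_nonzero cl_eq_zero_iff)

lemma zero_F: "\<zero>\<^bsub>F\<^esub> = fr 0 1"
  using fr_eq_zero_iff[of 0 1] one zero by (simp add: mpoly_carrier_intros)

lemma power_notin: "\<lbrakk>v \<in> mpoly_carrier n; v \<notin> P\<rbrakk> \<Longrightarrow> v ^ m \<notin> P"
  using power by blast

lemma mult_notin:
  "\<lbrakk>v \<in> mpoly_carrier n; v \<notin> P; w \<in> mpoly_carrier n; w \<notin> P\<rbrakk> \<Longrightarrow> v * w \<notin> P"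
  using prime by blast

lemma fr_power:
  assumes "u \<in> mpoly_carrier n" "v \<in> mpoly_carrier n" "v \<notin> P"
  shows "fr u v [^]\<^bsub>F\<^esub> (m::nat) = fr (u ^ m) (v ^ m)"
  using assms
  by (induction m) (simp_all add: one_F fr_mult mpoly_carrier_power power_notin mult.commute)

abbreviation "KF \<equiv> range (\<lambda>c. fr (mpoly_const c) 1)"

lemma subfield_KF: "subfield KF F"
proof -
  note [simp] = mpoly_carrier_intros one
  have "subring KF F"
  proof (rule F.subringI)
    show "KF \<subseteq> carrier F" by (auto intro!: fr_closed)
    show "\<one>\<^bsub>F\<^esub> \<in> KF" unfolding one_F by (simp flip: mpoly_const_simps(5))
    fix h assume "h \<in> KF"
    then obtain c where c: "h = fr (mpoly_const c) 1" by blast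
    have "fr (mpoly_const (- c)) 1 \<oplus>\<^bsub>F\<^esub> h = \<zero>\<^bsub>F\<^esub>"
      unfolding c by (simp add: fr_add fr_eq_zero_iff zero mpoly_const_simps)
    then have "\<ominus>\<^bsub>F\<^esub> h = fr (mpoly_const (- c)) 1"
      unfolding c by (intro F.minus_equality) (auto intro!: fr_closed)
    then show "\<ominus>\<^bsub>F\<^esub> h \<in> KF" by simp
    fix h' assume "h' \<in> KF"
    then obtain d where d: "h' = fr (mpoly_const d) 1" by blast
    show "h \<otimes>\<^bsub>F\<^esub> h' \<in> KF" unfolding c d by (simp add: fr_mult flip: mpoly_const_simps(2))
    show "h \<oplus>\<^bsub>F\<^esub> h' \<in> KF" unfolding c d by (simp add: fr_add flip: mpoly_const_simps(1))
  qed
  then show ?thesis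
  proof (rule F.subfieldI')
    fix h assume h: "h \<in> KF - {\<zero>\<^bsub>F\<^esub>}"
    then obtain c where c: "h = fr (mpoly_const c) 1" by blast
    have "c \<noteq> 0" using h unfolding c by (auto simp: fr_eq_zero_iff const)
    then have "h \<otimes>\<^bsub>F\<^esub> fr (mpoly_const (inverse c)) 1 = \<one>\<^bsub>F\<^esub>"
      unfolding c one_F by (simp add: fr_mult mpoly_const_simps(5) flip: mpoly_const_simps(2))
    then have "inv\<^bsub>F\<^esub> h = fr (mpoly_const (inverse c)) 1"
      unfolding c by (intro F.comm_inv_char) (auto intro!: fr_closed)
    then show "inv\<^bsub>F\<^esub> h \<in> KF" by simp
  qed
qed

text \<open>The numerator of \<open>p(u/v)\<close> over the denominator
  \<open>v ^ length cs\<close>. This exponent exceeds the degree by one, which keeps the recursion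
  uniform down to the empty list at the cost of a surplus factor \<open>v\<close>.\<close>

fun hompoly :: "'k list \<Rightarrow> 'k mpoly \<Rightarrow> 'k mpoly \<Rightarrow> 'k mpoly" where
  "hompoly [] u v = 0"
| "hompoly (c # cs) u v = v * (mpoly_const c * u ^ length cs + hompoly cs u v)"

lemma hompoly_closed:
  "\<lbrakk>u \<in> mpoly_carrier n; v \<in> mpoly_carrier n\<rbrakk> \<Longrightarrow> hompoly cs u v \<in> mpoly_carrier n"
  by (induction cs) (auto intro!: mpoly_carrier_intros mpoly_carrier_mult mpoly_carrier_power)

lemma hompoly_eq_sum:
  "hompoly (c # cs) u v =
    v * (\<Sum>r\<le>length cs. mpoly_const (rev (c # cs) ! r) * u ^ r * v ^ (length cs - r))"
proof (induction cs arbitrary: c)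
  case (Cons d cs)
  have "(\<Sum>r\<le>length cs. mpoly_const (rev (c # d # cs) ! r) * u ^ r * v ^ (Suc (length cs) - r)) =
    v * (\<Sum>r\<le>length cs. mpoly_const (rev (d # cs) ! r) * u ^ r * v ^ (length cs - r))"
    unfolding sum_distrib_left
    by (intro sum.cong) (auto simp: nth_append Suc_diff_le)
  then show ?case using Cons[of d] by (simp add: nth_append del: hompoly.simps(2)) (simp add: algebra_simps)
qed (simp add: algebra_simps)

lemma eval_hompoly:
  assumes uv: "u \<in> mpoly_carrier n" "v \<in> mpoly_carrier n" "v \<notin> P"
  shows "F.eval (map (\<lambda>c. fr (mpoly_const c) 1) cs) (fr u v) = fr (hompoly cs u v) (v ^ length cs)"
proof (induction cs)
  case Nil
  then show ?case by (simp add: zero_F)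
next
  case (Cons c cs)
  note [simp] = mpoly_carrier_intros mpoly_carrier_power mpoly_carrier_mult hompoly_closed
    power_notin mult_notin uv one
  show ?case
    by (simp add: Cons fr_power fr_mult fr_add fr_eq_iff) (simp add: algebra_simps zero)
qed

text \<open>Denominators are cleared with \<open>hompoly\<close>, and its surplus factor
  \<open>v\<close> is removed by primality. Univariate coefficient lists start at the leading term
  whereas \<open>algebraic_mod\<close> indexes by degree, hence the reversals.\<close>

lemma algebraic_iff:
  assumes uv: "u \<in> mpoly_carrier n" "v \<in> mpoly_carrier n" "v \<notin> P"
  shows "(F.algebraic over KF) (fr u v) \<longleftrightarrow> algebraic_mod P u v"
proof
  let ?k = "\<lambda>c. fr (mpoly_const c) 1"
  note [simp] = mpoly_carrier_intros one
  have k0: "?k c = \<zero>\<^bsub>F\<^esub> \<longleftrightarrow> c = 0" for c by (simp add: fr_eq_zero_iff const)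
  {
    assume "(F.algebraic over KF) (fr u v)"
    then obtain p where p: "p \<in> carrier (univ_poly F KF)" "p \<noteq> []" "F.eval p (fr u v) = \<zero>\<^bsub>F\<^esub>"
      using F.algebraicE[OF subfieldE(1)[OF subfield_KF] fr_closed[OF uv]] by metis
    then have "set p \<subseteq> KF" "lead_coeff p \<noteq> \<zero>\<^bsub>F\<^esub>"
      by (auto simp: univ_poly_carrier[symmetric] polynomial_def)
    then obtain cs where cs: "p = map ?k cs" using ex_map_conv[of p ?k] by blast
    then obtain c ds where cds: "cs = c # ds" using p(2) by (cases cs) auto
    have "c \<noteq> 0" using \<open>lead_coeff p \<noteq> \<zero>\<^bsub>F\<^esub>\<close> k0 unfolding cs cds by simp
    have "hompoly cs u v \<in> P"
      using p(3) unfolding cs eval_hompoly[OF uv]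
      by (simp add: fr_eq_zero_iff uv hompoly_closed mpoly_carrier_power power_notin)
    then have "v * (\<Sum>r\<le>length ds. mpoly_const (rev (c # ds) ! r) * u ^ r * v ^ (length ds - r)) \<in> P"
      unfolding cds hompoly_eq_sum .
    then have "(\<Sum>r\<le>length ds. mpoly_const (rev (c # ds) ! r) * u ^ r * v ^ (length ds - r)) \<in> P"
      using uv prime by (meson mpoly_carrier_intros mpoly_carrier_mult mpoly_carrier_power mpoly_carrier_sum)
    then show "algebraic_mod P u v"
      unfolding algebraic_mod_def using \<open>c \<noteq> 0\<close>
      by (intro exI[of _ "length ds"] exI[of _ "\<lambda>r. rev (c # ds) ! r"]) (simp add: nth_append)
  }
  assume "algebraic_mod P u v"
  then obtain d c where dc: "c d \<noteq> 0" "(\<Sum>r\<le>d. mpoly_const (c r) * u ^ r * v ^ (d - r)) \<in> P"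
    unfolding algebraic_mod_def by blast
  define cs where "cs = rev (map c [0..<d])"
  have "rev (c d # cs) = map c [0..<Suc d]" by (simp add: cs_def)
  moreover have "length cs = d" by (simp add: cs_def)
  ultimately have "hompoly (c d # cs) u v = v * (\<Sum>r\<le>d. mpoly_const (map c [0..<Suc d] ! r) * u ^ r * v ^ (d - r))"
    using hompoly_eq_sum[of "c d" cs u v] by simp
  also have "\<dots> = v * (\<Sum>r\<le>d. mpoly_const (c r) * u ^ r * v ^ (d - r))"
    by (intro arg_cong[of _ _ "\<lambda>x. v * x"] sum.cong) (auto simp del: upt_Suc)
  finally have "hompoly (c d # cs) u v \<in> P" using dc(2) uv mult by (simp del: hompoly.simps)
  then have "F.eval (map ?k (c d # cs)) (fr u v) = \<zero>\<^bsub>F\<^esub>"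
    unfolding eval_hompoly[OF uv]
    by (rule fr_eq_zero_iff[OF hompoly_closed mpoly_carrier_power power_notin, OF uv(1,2,2,2,3), THEN iffD2])
  moreover have "map ?k (c d # cs) \<in> carrier (univ_poly F KF)"
    using dc(1) k0 by (auto simp: univ_poly_carrier[symmetric] polynomial_def)
  ultimately show "(F.algebraic over KF) (fr u v)" by (intro F.algebraicI[of "map ?k (c d # cs)"]) auto
qed

end

section \<open>Maximal ideals\<close>

lemma mpoly_sum_single: "p = (\<Sum>m\<in>Poly_Mapping.keys p. Poly_Mapping.single m (Poly_Mapping.lookup p m))"
  by (rule poly_mapping_eqI)
    (simp add: lookup_sum lookup_single when_def in_keys_iff)

lemma single_eq_prod_var:
  "Poly_Mapping.single m (1::'k::comm_ring_1) =
    (\<Prod>i\<in>Poly_Mapping.keys m. mpoly_var i ^ Poly_Mapping.lookup m i)"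
proof (induction m rule: update_induct)
  case const
  then show ?case by simp
next
  case (update f i k)
  have pow: "mpoly_var i ^ k = (Poly_Mapping.single (Poly_Mapping.single i k) 1 :: 'k mpoly)" for k
    by (induction k) (simp_all add: mpoly_var_def mult_single flip: single_add)
  have "Poly_Mapping.update i k f = Poly_Mapping.single i k + f"
    using update(1) by (intro poly_mapping_eqI)
      (auto simp: lookup_update lookup_add lookup_single in_keys_iff when_def)
  then have "Poly_Mapping.single (Poly_Mapping.update i k f) (1::'k) =
      mpoly_var i ^ k * Poly_Mapping.single f 1"
    by (simp add: mult_single pow)
  also have "Poly_Mapping.single f (1::'k) =
      (\<Prod>j\<in>Poly_Mapping.keys f. mpoly_var j ^ Poly_Mapping.lookup (Poly_Mapping.update i k f) j)"
    unfolding update.IH using update.hyps(1)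
    by (intro prod.cong) (auto simp: lookup_update)
  also have "mpoly_var i ^ k * \<dots> = (\<Prod>j\<in>insert i (Poly_Mapping.keys f).
      mpoly_var j ^ Poly_Mapping.lookup (Poly_Mapping.update i k f) j)"
    using update.hyps(1) by (subst prod.insert) (auto simp: lookup_update)
  also have "insert i (Poly_Mapping.keys f) = Poly_Mapping.keys (Poly_Mapping.update i k f)"
    using update.hyps by (auto simp: in_keys_iff lookup_update split: if_splits)
  finally show ?case .
qed

lemma single_eq_const_mult: "Poly_Mapping.single m (c :: 'k::comm_ring_1) = mpoly_const c * Poly_Mapping.single m 1"
  by (simp add: mpoly_const_def mult_single)

lemma mpoly_carrier_induct [consumes 1, case_names const var add mult]:
  assumes p: "p \<in> mpoly_carrier n"
    and const: "\<And>c. S (mpoly_const c)" and var: "\<And>i. i \<le> n \<Longrightarrow> S (mpoly_var i)"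
    and add: "\<And>p q. \<lbrakk>p \<in> mpoly_carrier n; q \<in> mpoly_carrier n; S p; S q\<rbrakk> \<Longrightarrow> S (p + q)"
    and mult: "\<And>p q. \<lbrakk>p \<in> mpoly_carrier n; q \<in> mpoly_carrier n; S p; S q\<rbrakk> \<Longrightarrow> S (p * q)"
  shows "S (p :: 'k::comm_ring_1 mpoly)"
proof -
  define T where "T p \<longleftrightarrow> p \<in> mpoly_carrier n \<and> S p" for p :: "'k mpoly"
  note C = mpoly_carrier_intros mpoly_carrier_mult
  have T: "T (mpoly_const c)" "i \<le> n \<Longrightarrow> T (mpoly_var i)" "T p \<Longrightarrow> T q \<Longrightarrow> T (p + q)"
    "T p \<Longrightarrow> T q \<Longrightarrow> T (p * q)" for c i p q
    using const var add mult C by (auto simp: T_def)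
  have T0: "T 0" using T(1)[of 0] by (simp add: mpoly_const_simps)
  have T1: "T 1" using T(1)[of 1] by (simp add: mpoly_const_simps)
  have Tpow: "T p \<Longrightarrow> T (p ^ k)" for p k by (induction k) (auto intro: T T1)
  have Tprod: "(\<And>i. i \<in> I \<Longrightarrow> T (f i)) \<Longrightarrow> T (prod f I)" for f and I :: "nat set"
    by (induction I rule: infinite_finite_induct) (auto intro: T T1)
  have Tsum: "(\<And>i. i \<in> I \<Longrightarrow> T (f i)) \<Longrightarrow> T (sum f I)" for f and I :: "(nat \<Rightarrow>\<^sub>0 nat) set"
    by (induction I rule: infinite_finite_induct) (auto intro: T T0)
  have "T (Poly_Mapping.single m c)" if "m \<in> Poly_Mapping.keys p" for m c
  proof -
    have "Poly_Mapping.keys m \<subseteq> {0..n}" using p that unfolding mpoly_carrier_def by blast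
    then show ?thesis
      unfolding single_eq_const_mult[of m c] single_eq_prod_var by (intro T Tprod Tpow) auto
  qed
  then have "T p" by (subst mpoly_sum_single) (rule Tsum)
  then show ?thesis by (simp add: T_def)
qed

context mpoly_prime_quotient
begin

lemma fr_in_subring:
  assumes E: "subring E F" and K: "KF \<subseteq> E" and var: "\<And>i. i \<le> n \<Longrightarrow> fr (mpoly_var i) 1 \<in> E"
    and x: "x \<in> mpoly_carrier n"
  shows "fr x 1 \<in> E"
  using x
proof (induction rule: mpoly_carrier_induct)
  case (add p q)
  have "fr (p + q) 1 = fr p 1 \<oplus>\<^bsub>F\<^esub> fr q 1"
    using add by (simp add: fr_add mpoly_carrier_intros one)
  then show ?case using add subringE(7)[OF E] by simp
next
  case (mult p q)
  have "fr (p * q) 1 = fr p 1 \<otimes>\<^bsub>F\<^esub> fr q 1"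
    using mult by (simp add: fr_mult mpoly_carrier_intros one)
  then show ?case using mult subringE(6)[OF E] by simp
qed (use K var in auto)

text \<open>By \<open>loc\<close> the localization of \<open>A/P\<close> at \<open>f\<close> is
  already a field. So \<open>Frac (A/P)\<close> is generated as a ring over the base field by
  \<open>1/f\<close> and the variables, and Zariski's lemma applies. The case \<open>f = 1\<close>
  is that of a maximal ideal.\<close>

lemma algebraic_mod_if_localization_field:
  assumes f: "f \<in> mpoly_carrier n" "f \<notin> P"
    and loc: "\<And>y. \<lbrakk>y \<in> mpoly_carrier n; y \<notin> P\<rbrakk> \<Longrightarrow> \<exists>z\<in>mpoly_carrier n. \<exists>m. y * z - f ^ m \<in> P"
    and u: "u \<in> mpoly_carrier n"
  shows "algebraic_mod P u 1"
proof -
  let ?xs = "fr 1 f # map (\<lambda>i. fr (mpoly_var i) 1) [0..<Suc n]"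
  let ?E = "F.finite_extension KF ?xs"
  note [simp] = mpoly_carrier_intros mpoly_carrier_mult mpoly_carrier_power one f power_notin mult_notin
  have xs: "set ?xs \<subseteq> carrier F" by (auto intro!: fr_closed)
  have K: "subring KF F" by (rule subfieldE(1)[OF subfield_KF])
  have E: "subring ?E F" by (rule F.finite_extension_is_subring[OF K xs])
  have KE: "KF \<subseteq> ?E" by (rule F.finite_extension_incl[OF subringE(1)[OF K] xs])
  have xE: "set ?xs \<subseteq> ?E" by (rule F.finite_extension_mem[OF K xs])
  have E1: "fr x 1 \<in> ?E" if "x \<in> mpoly_carrier n" for x
  proof (rule fr_in_subring[OF E KE _ that])
    fix i assume "i \<le> n"
    then have "fr (mpoly_var i) 1 \<in> set ?xs" by (auto simp del: upt_Suc)
    then show "fr (mpoly_var i) 1 \<in> ?E" using xE by blast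
  qed
  have fE: "fr 1 f [^]\<^bsub>F\<^esub> (m::nat) \<in> ?E" for m
  proof (induction m)
    case (Suc m)
    have "fr 1 f \<in> ?E" using xE by simp
    then show ?case using subringE(6)[OF E Suc] by simp
  qed (use subringE(3)[OF E] in simp)
  have "carrier F \<subseteq> ?E"
  proof
    fix w assume "w \<in> carrier F"
    then obtain x y where xy: "w = fr x y" "x \<in> mpoly_carrier n" "y \<in> mpoly_carrier n" "y \<notin> P"
      using F_carrierE by blast
    obtain z m where z: "z \<in> mpoly_carrier n" "y * z - f ^ m \<in> P" using loc[OF xy(3,4)] by blast
    have "x * f ^ m - x * z * y = - x * (y * z - f ^ m)" by (simp add: algebra_simps)
    then have "x * f ^ m - x * z * y \<in> P" using mult[of "- x", OF _ z(2)] xy(2) by simp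
    then have "w = fr (x * z) 1 \<otimes>\<^bsub>F\<^esub> fr 1 f [^]\<^bsub>F\<^esub> m"
      using xy z(1) by (simp add: fr_power fr_mult fr_eq_iff)
    then show "w \<in> ?E" using subringE(6)[OF E E1 fE] xy(2) z(1) by simp
  qed
  then have "?E = carrier F" using subringE(1)[OF E] by blast
  then have "(F.algebraic over KF) (fr u 1)"
    by (intro F.zariski_lemma[OF subfield_KF xs] fr_closed u) auto
  then show ?thesis using algebraic_iff[OF u] by simp
qed

end

lemma (in mpoly_ideal) adjoin:
  assumes x: "x \<in> mpoly_carrier n"
  shows "mpoly_ideal n {i + r * x |i r. i \<in> I \<and> r \<in> mpoly_carrier n}" (is "mpoly_ideal n ?J")
proof
  note C = mpoly_carrier_intros mpoly_carrier_mult
  show "?J \<subseteq> mpoly_carrier n" using sub x by (auto intro!: C)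
  show "0 \<in> ?J" using zero C(6) by (intro CollectI exI[of _ 0]) auto
  fix y assume "y \<in> ?J"
  then obtain i r where y: "y = i + r * x" "i \<in> I" "r \<in> mpoly_carrier n" by blast
  show "s * y \<in> ?J" if s: "s \<in> mpoly_carrier n" for s
  proof -
    have "s * y = s * i + (s * r) * x" by (simp add: y(1) algebra_simps)
    then show ?thesis using mult[OF s y(2)] C(8)[OF s y(3)] by blast
  qed
  fix z assume "z \<in> ?J"
  then obtain j s where z: "z = j + s * x" "j \<in> I" "s \<in> mpoly_carrier n" by blast
  have "y + z = (i + j) + (r + s) * x" by (simp add: y(1) z(1) algebra_simps)
  then show "y + z \<in> ?J" using add[OF y(2) z(2)] C(3)[OF y(3) z(3)] by blast
qed

lemma (in mpoly_ideal) adjoin_incl: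
  "y \<in> I \<Longrightarrow> y \<in> {i + r * x |i r. i \<in> I \<and> r \<in> mpoly_carrier n}"
  using mpoly_carrier_intros(6) by (intro CollectI exI[of _ y] exI[of _ 0]) auto

lemma (in mpoly_ideal) adjoin_mem: "x \<in> {i + r * x |i r. i \<in> I \<and> r \<in> mpoly_carrier n}"
  using mpoly_carrier_intros(7) zero by (intro CollectI exI[of _ 0] exI[of _ 1]) auto

text \<open>A relation without constant term can be divided by \<open>x\<close>, which is outside
  the prime. A relation \<open>c 0 + x w\<close> with nonzero constant term exhibits
  \<open>- w / c 0\<close> as an inverse.\<close>

lemma (in mpoly_prime) invertible_if_algebraic_mod:
  assumes x: "x \<in> mpoly_carrier n" "x \<notin> I" and alg: "algebraic_mod I x 1"
  shows "\<exists>y\<in>mpoly_carrier n. x * y - 1 \<in> I"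
proof -
  note C = mpoly_carrier_intros mpoly_carrier_mult mpoly_carrier_power mpoly_carrier_sum
  have "\<exists>y\<in>mpoly_carrier n. x * y - 1 \<in> I"
    if "c d \<noteq> 0" "(\<Sum>r\<le>d. mpoly_const (c r) * x ^ r) \<in> I" for c d
    using that
  proof (induction d arbitrary: c)
    case 0
    then show ?case by (simp add: const)
  next
    case (Suc d)
    define w where "w = (\<Sum>r\<le>d. mpoly_const (c (Suc r)) * x ^ r)"
    have w: "w \<in> mpoly_carrier n" unfolding w_def by (intro C x)
    have eq: "(\<Sum>r\<le>Suc d. mpoly_const (c r) * x ^ r) = mpoly_const (c 0) + x * w"
      by (subst sum.atMost_Suc_shift) (simp add: w_def sum_distrib_left mult_ac)
    show ?case
    proof (cases "c 0 = 0")
      case True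
      then have "x * w \<in> I" using Suc(3) unfolding eq by (simp add: mpoly_const_simps)
      then have "w \<in> I" using prime x w by blast
      then show ?thesis using Suc(1)[of "\<lambda>r. c (Suc r)"] Suc(2) by (simp add: w_def)
    next
      case False
      let ?k = "mpoly_const (- inverse (c 0))"
      have "?k * mpoly_const (c 0) = mpoly_const (-1)" using False by (simp flip: mpoly_const_simps(2))
      then have "x * (?k * w) - 1 = ?k * (mpoly_const (c 0) + x * w)"
        by (simp add: algebra_simps mpoly_const_simps)
      then have "x * (?k * w) - 1 \<in> I" using mult[OF _ Suc(3)] C(1) unfolding eq by metis
      then show ?thesis using w by (intro bexI[of _ "?k * w"]) (auto intro: C)
    qed
  qed
  then show ?thesis using alg by (auto simp: algebraic_mod_def)
qed

lemma maximalideal_A_poisson_iff: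
  fixes M :: "'k::field_char_0 mpoly set"
  shows
  "maximalideal M (A_poisson n a) \<longleftrightarrow>
    mpoly_ideal n M \<and> 1 \<notin> M \<and> (\<forall>x\<in>mpoly_carrier n - M. \<exists>y\<in>mpoly_carrier n. x * y - 1 \<in> M)"
proof (intro iffI conjI)
  assume M: "maximalideal M (A_poisson n a)"
  then interpret maximalideal M "A_poisson n a" .
  interpret cring "A_poisson n a" by (rule cring_A_poisson)
  show mi: "mpoly_ideal n M" using is_ideal by (simp add: ideal_A_poisson_iff)
  interpret I: mpoly_ideal n M by (rule mi)
  show "1 \<notin> M" using one_imp_carrier I_notcarr by (auto simp: A_poisson_sel)
  show "\<forall>x\<in>mpoly_carrier n - M. \<exists>y\<in>mpoly_carrier n. x * y - 1 \<in> M"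
  proof
    fix x assume x: "x \<in> mpoly_carrier n - M"
    let ?J = "{i + r * x |i r. i \<in> M \<and> r \<in> mpoly_carrier n}"
    have J: "mpoly_ideal n ?J" using x by (intro I.adjoin) auto
    have "M \<subseteq> ?J" using I.adjoin_incl by blast
    moreover have "x \<in> ?J" using I.adjoin_mem .
    ultimately have "?J = mpoly_carrier n"
      using I_maximal[of ?J] J x by (auto simp: ideal_A_poisson_iff A_poisson_sel mpoly_ideal.sub)
    then have "1 \<in> ?J" by (simp add: mpoly_carrier_intros)
    then obtain i r where ir: "1 = i + r * x" "i \<in> M" "r \<in> mpoly_carrier n" by auto
    then have "x * r - 1 = - i" by (simp add: algebra_simps)
    then show "\<exists>y\<in>mpoly_carrier n. x * y - 1 \<in> M" using ir I.uminus by metis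
  qed
next
  assume *: "mpoly_ideal n M \<and> 1 \<notin> M \<and> (\<forall>x\<in>mpoly_carrier n - M. \<exists>y\<in>mpoly_carrier n. x * y - 1 \<in> M)"
  then interpret I: mpoly_ideal n M by simp
  show "maximalideal M (A_poisson n a)"
  proof (rule maximalidealI)
    show "ideal M (A_poisson n a)" by (simp add: ideal_A_poisson_iff I.mpoly_ideal_axioms)
    show "carrier (A_poisson n a) \<noteq> M" using * by (auto simp: A_poisson_sel mpoly_carrier_intros)
    fix J assume J: "ideal J (A_poisson n a)" "M \<subseteq> J" "J \<subseteq> carrier (A_poisson n a)"
    then interpret J: mpoly_ideal n J by (simp add: ideal_A_poisson_iff)
    show "J = M \<or> J = carrier (A_poisson n a)"
    proof (cases "J \<subseteq> M")
      case False
      then obtain x where x: "x \<in> J" "x \<notin> M" by blast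
      then obtain y where y: "y \<in> mpoly_carrier n" "x * y - 1 \<in> M" using * J.sub by blast
      have "1 \<in> J" using J.diff[OF J.mult_right[OF x(1) y(1)] subsetD[OF J(2) y(2)]] by simp
      then have "mpoly_carrier n \<subseteq> J" using J.mult[of _ 1] by auto
      then show ?thesis using J.sub by (auto simp: A_poisson_sel)
    qed (use J(2) in auto)
  qed
qed

lemma maximal_imp_mpoly_prime:
  fixes M :: "'k::field_char_0 mpoly set"
  assumes "maximalideal M (A_poisson n a)"
  shows "mpoly_prime n M"
  using cring.maximalideal_prime[OF cring_A_poisson assms] by (simp add: primeideal_A_poisson_iff)

lemma (in mpoly_prime) maximal_if_algebraic_mod:
  assumes "\<And>x. x \<in> mpoly_carrier n \<Longrightarrow> algebraic_mod I x 1"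
  shows "maximalideal I (A_poisson n a)"
  unfolding maximalideal_A_poisson_iff
  using invertible_if_algebraic_mod assms mpoly_ideal_axioms one by auto

lemma maximal_imp_algebraic_mod:
  fixes M :: "'k::field_char_0 mpoly set"
  assumes M: "maximalideal M (A_poisson n a)" and u: "u \<in> mpoly_carrier n"
  shows "algebraic_mod M u 1"
proof -
  interpret mpoly_prime n M by (rule maximal_imp_mpoly_prime[OF M])
  interpret mpoly_prime_quotient n M a ..
  show ?thesis
    using M unfolding maximalideal_A_poisson_iff
    by (intro algebraic_mod_if_localization_field[of 1] u) (auto simp: mpoly_carrier_intros one)
qed

text \<open>Zorn's lemma gives an ideal \<open>M\<close> that is maximal among those above
  \<open>P\<close> without powers of \<open>f\<close>. It is prime, and modulo \<open>M\<close>
  every element outside \<open>M\<close> divides a power of \<open>f\<close>. Thus the localization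
  at \<open>f\<close> is a field, the residue ring is algebraic by Zariski's lemma, and
  \<open>M\<close> is a genuine maximal ideal.\<close>

lemma exists_maximal_avoiding:
  fixes P :: "'k::field_char_0 mpoly set"
  assumes "mpoly_prime n P" and f: "f \<in> mpoly_carrier n" "f \<notin> P"
  shows "\<exists>M. maximalideal M (A_poisson n a) \<and> P \<subseteq> M \<and> f \<notin> M"
proof -
  interpret P: mpoly_prime n P by fact
  let ?S = "{I. mpoly_ideal n I \<and> P \<subseteq> I \<and> (\<forall>m. f ^ m \<notin> I)}"
  have "\<exists>M\<in>?S. \<forall>J\<in>?S. M \<subseteq> J \<longrightarrow> J = M"
  proof (rule subset_Zorn_nonempty)
    show "?S \<noteq> {}" using P.mpoly_ideal_axioms P.power f by blast
    fix C assume C: "C \<noteq> {}" "subset.chain ?S C"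
    have CS: "mpoly_ideal n I" "P \<subseteq> I" "f ^ m \<notin> I" if "I \<in> C" for I m
      using C(2) that by (auto simp: subset_chain_def)
    have lin: "I \<subseteq> J \<or> J \<subseteq> I" if "I \<in> C" "J \<in> C" for I J
      using C(2) that by (auto simp: subset_chain_def)
    have "mpoly_ideal n (\<Union>C)"
    proof
      show "\<Union>C \<subseteq> mpoly_carrier n" using CS(1) mpoly_ideal.sub by blast
      show "0 \<in> \<Union>C" using C(1) CS(1) mpoly_ideal.zero by blast
      show "r * x \<in> \<Union>C" if "r \<in> mpoly_carrier n" "x \<in> \<Union>C" for r x
        using that CS(1) mpoly_ideal.mult by blast
      fix x y assume "x \<in> \<Union>C" "y \<in> \<Union>C"
      then obtain I where "I \<in> C" "x \<in> I" "y \<in> I" using lin by blast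
      then show "x + y \<in> \<Union>C" using CS(1) mpoly_ideal.add by blast
    qed
    then show "\<Union>C \<in> ?S" using C(1) CS(2,3) by blast
  qed
  then obtain M where MS: "M \<in> ?S" and mx: "\<forall>J\<in>?S. M \<subseteq> J \<longrightarrow> J = M" ..
  have M: "mpoly_ideal n M" "P \<subseteq> M" "f ^ m \<notin> M" for m
    using MS by auto
  have max: "J = M" if "mpoly_ideal n J" "P \<subseteq> J" "\<forall>m. f ^ m \<notin> J" "M \<subseteq> J" for J
    using mx that by simp
  interpret M: mpoly_ideal n M by fact
  have loc: "\<exists>z\<in>mpoly_carrier n. \<exists>m. y * z - f ^ m \<in> M" if y: "y \<in> mpoly_carrier n" "y \<notin> M" for y
  proof -
    let ?J = "{i + r * y |i r. i \<in> M \<and> r \<in> mpoly_carrier n}"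
    have "mpoly_ideal n ?J" by (rule M.adjoin[OF y(1)])
    moreover have "M \<subseteq> ?J" "y \<in> ?J" using M.adjoin_incl M.adjoin_mem by blast+
    ultimately obtain m where "f ^ m \<in> ?J" using max[of ?J] M(2) y(2) by blast
    then obtain i r where ir: "f ^ m = i + r * y" "i \<in> M" "r \<in> mpoly_carrier n" by blast
    then have "y * r - f ^ m = - i" by (simp add: algebra_simps)
    then show ?thesis using ir(2,3) M.uminus by metis
  qed
  have "mpoly_prime n M"
  proof
    show "1 \<notin> M" using M(3)[of 0] by simp
    fix x y assume xy: "x \<in> mpoly_carrier n" "y \<in> mpoly_carrier n" "x * y \<in> M"
    show "x \<in> M \<or> y \<in> M"
    proof (rule ccontr)
      assume "\<not> ?thesis"
      then obtain z m w k where z: "z \<in> mpoly_carrier n" "x * z - f ^ m \<in> M"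
        and w: "w \<in> mpoly_carrier n" "y * w - f ^ k \<in> M" using loc xy by metis
      note C = mpoly_carrier_mult mpoly_carrier_power
      have "f ^ (m + k) = (z * w) * (x * y) - (y * w) * (x * z - f ^ m) - f ^ m * (y * w - f ^ k)"
        by (simp add: algebra_simps power_add)
      also have "\<dots> \<in> M" by (intro M.diff M.mult C z w xy f)
      finally show False using M(3) by blast
    qed
  qed
  then interpret Mp: mpoly_prime n M .
  interpret Mq: mpoly_prime_quotient n M a ..
  have "maximalideal M (A_poisson n a)"
    using Mp.maximal_if_algebraic_mod Mq.algebraic_mod_if_localization_field[OF f(1) _ loc] M(3)[of 1]
    by simp
  then show ?thesis using M(2) M(3)[of 1] by auto
qed

section \<open>Poisson primes\<close>

definition pbr :: "nat \<Rightarrow> 'k::comm_ring_1 \<Rightarrow> 'k mpoly \<Rightarrow> 'k mpoly \<Rightarrow> 'k mpoly" where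
  "pbr n a f g = Delta n f * Gamma n a g - Gamma n a f * Delta n g"

lemma pbr_closed:
  "\<lbrakk>f \<in> mpoly_carrier n; g \<in> mpoly_carrier n\<rbrakk> \<Longrightarrow> pbr n a f g \<in> mpoly_carrier n"
  unfolding pbr_def
  by (intro mpoly_carrier_intros mpoly_carrier_mult mpoly_carrier_Delta mpoly_carrier_Gamma)

lemma bracket_A_poisson: "\<lbrace>x, y\<rbrace>\<^bsub>A_poisson n a\<^esub> = pbr n a x y"
  by (simp add: A_poisson_sel pbr_def)

lemma pbr_swap: "pbr n a g f = - pbr n a f g"
  by (simp add: pbr_def)

lemma pbr_mult_left: "pbr n a (f * g) h = f * pbr n a g h + pbr n a f h * g"
  by (simp add: pbr_def Delta_mult Gamma_mult algebra_simps)

lemma pbr_diff_left: "pbr n a (f - g) h = pbr n a f h - pbr n a g h"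
  by (simp add: pbr_def Delta_diff Gamma_diff algebra_simps)

lemma pbr_add_left: "pbr n a (f + g) h = pbr n a f h + pbr n a g h"
  by (simp add: pbr_def Delta_add Gamma_add algebra_simps)

lemma pbr_const_left [simp]: "pbr n a (mpoly_const c) h = 0"
  by (simp add: pbr_def)

lemma pbr_zero_left [simp]: "pbr n a 0 h = 0"
  by (simp add: pbr_def)

lemma pbr_one [simp]: "pbr n a 1 h = 0" "pbr n a h 1 = 0"
  using pbr_const_left[of n a 1 h] pbr_swap[of n a h 1] by (simp_all add: mpoly_const_simps)

text \<open>Cramer's rule for the linear system with coefficients \<open>\<Delta> g\<close>, \<open>\<Gamma> g\<close>, \<open>\<Delta> h\<close>, \<open>\<Gamma> h\<close>.\<close>

lemma Delta_mult_pbr: "Delta n x * pbr n a g h = Delta n g * pbr n a x h - Delta n h * pbr n a x g"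
  and Gamma_mult_pbr: "Gamma n a x * pbr n a g h = Gamma n a g * pbr n a x h - Gamma n a h * pbr n a x g"
  by (simp_all add: pbr_def algebra_simps)

lemma poisson_ideal_A_poisson_iff:
  "poisson_ideal I (A_poisson n a) \<longleftrightarrow>
    mpoly_ideal n I \<and> (\<forall>x\<in>mpoly_carrier n. \<forall>y\<in>I. pbr n a y x \<in> I)"
proof -
  have "pbr n a x y \<in> I \<longleftrightarrow> pbr n a y x \<in> I" if "mpoly_ideal n I" for x y
    using mpoly_ideal.uminus[OF that, of "pbr n a x y"] mpoly_ideal.uminus[OF that, of "pbr n a y x"]
    by (auto simp: pbr_swap[of n a y x])
  then show ?thesis
    unfolding poisson_ideal_def ideal_A_poisson_iff bracket_A_poisson by (auto simp: A_poisson_sel)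
qed

lemma PSpec_A_poisson_iff:
  "P \<in> PSpec (A_poisson n a) \<longleftrightarrow>
    mpoly_prime n P \<and> (\<forall>x\<in>mpoly_carrier n. \<forall>y\<in>P. pbr n a y x \<in> P)"
  unfolding PSpec_def primeideal_A_poisson_iff mem_Collect_eq poisson_ideal_A_poisson_iff
  by (auto simp: mpoly_prime_def)

locale mpoly_poisson_prime = mpoly_prime_quotient n P a
  for n and P :: "'k::field_char_0 mpoly set" and a +
  assumes bracket: "\<lbrakk>x \<in> mpoly_carrier n; y \<in> P\<rbrakk> \<Longrightarrow> pbr n a y x \<in> P"
begin

lemma PSpec: "P \<in> PSpec A"
  using bracket mpoly_prime_axioms by (simp add: PSpec_A_poisson_iff)

lemma bracket_cl:
  assumes "x \<in> mpoly_carrier n" "y \<in> mpoly_carrier n"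
  shows "\<lbrace>cl x, cl y\<rbrace>\<^bsub>Q\<^esub> = cl (pbr n a x y)"
proof -
  have "poisson_ideal P A" using PSpec by (simp add: PSpec_def)
  then show ?thesis
    using poisson_algebra.bracket_coset[OF poisson_algebra_A_poisson, of P n a x y] assms
    by (simp add: A_poisson_sel(1) bracket_A_poisson)
qed

lemma bracket_fr:
  assumes "u \<in> mpoly_carrier n" "v \<in> mpoly_carrier n" "v \<notin> P"
    "g \<in> mpoly_carrier n" "h \<in> mpoly_carrier n" "h \<notin> P"
  shows "\<lbrace>fr u v, fr g h\<rbrace>\<^bsub>F\<^esub> =
    fr (h * (pbr n a u g * v - pbr n a v g * u) - g * (pbr n a u h * v - pbr n a v h * u))
      ((v * v) * (h * h))"
proof -
  note [simp] = mpoly_carrier_intros(3-5) mpoly_carrier_mult pbr_closed cl_closed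
  have PQ: "poisson_algebra ((\<lambda>c. cl c) ` range mpoly_const) Q"
    by (rule poisson_algebra.poisson_algebra_quotient(2)[OF poisson_algebra_A_poisson PSpec])
  have eq: "pbr n a u g * (v * h) - pbr n a u h * (v * g) - pbr n a v g * (u * h) + pbr n a v h * (u * g) =
      h * (pbr n a u g * v - pbr n a v g * u) - g * (pbr n a u h * v - pbr n a v h * u)"
    by (simp add: algebra_simps)
  show ?thesis
    unfolding fraction_bracket[OF Q.domain_axioms PQ cl_closed[OF assms(1)] cl_nonzero[OF assms(2,3)]
        cl_closed[OF assms(4)] cl_nonzero[OF assms(5,6)]] eq[symmetric]
    using assms by (simp add: bracket_cl cl_mult cl_add cl_diff)
qed

text \<open>The right-hand condition is the numerator of the bracket of \<open>u/v\<close> with a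
  polynomial, by the quotient rule. Polynomials suffice as tests, because the bracket with
  \<open>g/h\<close> is a combination of the brackets with \<open>g\<close> and
  \<open>h\<close>.\<close>

lemma fr_center_iff:
  assumes "u \<in> mpoly_carrier n" "v \<in> mpoly_carrier n" "v \<notin> P"
  shows "fr u v \<in> poisson_center F \<longleftrightarrow> (\<forall>g\<in>mpoly_carrier n. pbr n a u g * v - pbr n a v g * u \<in> P)"
    (is "_ \<longleftrightarrow> (\<forall>g\<in>_. ?c g \<in> P)")
proof
  note [simp] = mpoly_carrier_intros mpoly_carrier_mult pbr_closed assms mult_notin
  assume "fr u v \<in> poisson_center F"
  then have *: "\<lbrace>fr u v, fr g 1\<rbrace>\<^bsub>F\<^esub> = \<zero>\<^bsub>F\<^esub>" if "g \<in> mpoly_carrier n" for g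
    using that fr_closed[of g 1] one by (auto simp: poisson_center_def)
  show "\<forall>g\<in>mpoly_carrier n. ?c g \<in> P"
  proof
    fix g :: "'k mpoly" assume g: "g \<in> mpoly_carrier n"
    have "fr (?c g) (v * v) = \<zero>\<^bsub>F\<^esub>"
      using *[OF g] bracket_fr[OF assms g, of 1] one by simp
    then show "?c g \<in> P" using g by (subst (asm) fr_eq_zero_iff) auto
  qed
next
  note [simp] = mpoly_carrier_intros mpoly_carrier_mult pbr_closed assms mult_notin
  assume c: "\<forall>g\<in>mpoly_carrier n. ?c g \<in> P"
  have "\<lbrace>fr u v, x\<rbrace>\<^bsub>F\<^esub> = \<zero>\<^bsub>F\<^esub>" if x: "x \<in> carrier F" for x
  proof -
    obtain g h where gh: "x = fr g h" "g \<in> mpoly_carrier n" "h \<in> mpoly_carrier n" "h \<notin> P"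
      using F_carrierE[OF x] .
    have "h * ?c g - g * ?c h \<in> P"
      using diff[OF mult[OF gh(3)] mult[OF gh(2)], OF c[rule_format, OF gh(2)] c[rule_format, OF gh(3)]] .
    then show ?thesis
      unfolding gh(1) bracket_fr[OF assms gh(2-4)] using gh by (subst fr_eq_zero_iff) auto
  qed
  then show "fr u v \<in> poisson_center F"
    using fr_closed[OF assms] by (simp add: poisson_center_def)
qed

lemma poisson_rational_iff:
  "poisson_rational (range mpoly_const) A P \<longleftrightarrow>
    (\<forall>u\<in>mpoly_carrier n. \<forall>v\<in>mpoly_carrier n - P.
      (\<forall>g\<in>mpoly_carrier n. pbr n a u g * v - pbr n a v g * u \<in> P) \<longrightarrow> algebraic_mod P u v)"
proof -
  have K: "(\<lambda>c. fraction Q (cl c) \<one>\<^bsub>Q\<^esub>) ` range mpoly_const = KF"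
    by (simp add: image_image one_Q)
  have "poisson_rational (range mpoly_const) A P \<longleftrightarrow>
      (\<forall>z\<in>poisson_center F. (F.algebraic over KF) z)"
    unfolding poisson_rational_def Let_def K using PSpec by simp
  also have "\<dots> \<longleftrightarrow> (\<forall>u\<in>mpoly_carrier n. \<forall>v\<in>mpoly_carrier n - P.
      fr u v \<in> poisson_center F \<longrightarrow> (F.algebraic over KF) (fr u v))"
  proof (intro iffI ballI impI)
    fix z
    assume *: "\<forall>u\<in>mpoly_carrier n. \<forall>v\<in>mpoly_carrier n - P.
      fr u v \<in> poisson_center F \<longrightarrow> (F.algebraic over KF) (fr u v)" and z: "z \<in> poisson_center F"
    then have "z \<in> carrier F" by (simp add: poisson_center_def)
    then obtain u v where uv: "z = fr u v" "u \<in> mpoly_carrier n" "v \<in> mpoly_carrier n" "v \<notin> P"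
      using F_carrierE by blast
    then show "(F.algebraic over KF) z" using *[rule_format, of u v] z by simp
  qed auto
  also have "\<dots> \<longleftrightarrow> (\<forall>u\<in>mpoly_carrier n. \<forall>v\<in>mpoly_carrier n - P.
      (\<forall>g\<in>mpoly_carrier n. pbr n a u g * v - pbr n a v g * u \<in> P) \<longrightarrow> algebraic_mod P u v)"
    by (intro ball_cong refl) (simp add: fr_center_iff algebraic_iff)
  finally show ?thesis .
qed

text \<open>Cramer's rule writes \<open>Delta n x * pbr n a g h\<close> through the brackets of
  \<open>x\<close> with \<open>g\<close> and \<open>h\<close>, which lie in \<open>P\<close>; the
  factor outside \<open>P\<close> cancels by primality. The same holds for
  \<open>Gamma n a x\<close>.\<close>

lemma Delta_Gamma_stable:
  assumes gh: "g \<in> mpoly_carrier n" "h \<in> mpoly_carrier n" "pbr n a g h \<notin> P" and x: "x \<in> P"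
  shows "Delta n x \<in> P" "Gamma n a x \<in> P"
proof -
  note C = mpoly_carrier_Delta mpoly_carrier_Gamma
  have xC: "x \<in> mpoly_carrier n" using x sub by blast
  have "Delta n x * pbr n a g h \<in> P"
    by (subst Delta_mult_pbr)
      (rule diff[OF mult[OF C(1)[OF gh(1)] bracket[OF gh(2) x]] mult[OF C(1)[OF gh(2)] bracket[OF gh(1) x]]])
  moreover have "Gamma n a x * pbr n a g h \<in> P"
    by (subst Gamma_mult_pbr)
      (rule diff[OF mult[OF C(2)[OF gh(1)] bracket[OF gh(2) x]] mult[OF C(2)[OF gh(2)] bracket[OF gh(1) x]]])
  ultimately show "Delta n x \<in> P" "Gamma n a x \<in> P"
    using prime[OF C(1)[OF xC] pbr_closed[OF gh(1,2), of a]] prime[OF C(2)[OF xC] pbr_closed[OF gh(1,2), of a]] gh(3)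
    by simp_all
qed

end

lemma mpoly_poisson_prime_iff: "mpoly_poisson_prime n P a \<longleftrightarrow> P \<in> PSpec (A_poisson n a)"
  unfolding PSpec_A_poisson_iff mpoly_poisson_prime_def mpoly_prime_quotient_def
    mpoly_poisson_prime_axioms_def by auto

text \<open>If the open part is cut out by \<open>S\<close>, some \<open>f\<close> in
  \<open>S\<close> is outside \<open>P\<close>. A larger Poisson prime stays in the closed part, so
  it must leave the open one and contain \<open>f\<close>. Conversely, \<open>P\<close> is the only
  Poisson prime above \<open>P\<close> that avoids \<open>f\<close>.\<close>

lemma poisson_locally_closed_iff:
  fixes P :: "'k::field_char_0 mpoly set"
  shows "poisson_locally_closed (A_poisson n a) P \<longleftrightarrow> P \<in> PSpec (A_poisson n a) \<and>
    (\<exists>f\<in>mpoly_carrier n - P. \<forall>Q\<in>PSpec (A_poisson n a). P \<subset> Q \<longrightarrow> f \<in> Q)"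
proof -
  let ?A = "A_poisson n a" and ?T = "zariski_topology (A_poisson n a)"
  have PC: "Q \<subseteq> mpoly_carrier n" "1 \<notin> Q" if "Q \<in> PSpec ?A" for Q :: "'k mpoly set"
  proof -
    interpret mpoly_prime n Q using that by (simp add: PSpec_A_poisson_iff)
    show "Q \<subseteq> mpoly_carrier n" "1 \<notin> Q" by (fact sub, fact one)
  qed
  have "openin ?T (PSpec ?A)"
    unfolding openin_zariski_topology using PC(2)
    by (intro exI[of _ "{1}"]) (auto simp: zariski_closed_def A_poisson_sel mpoly_carrier_intros)
  moreover have "U \<subseteq> PSpec ?A" if "openin ?T U" for U
    using that by (auto simp: openin_zariski_topology)
  ultimately have top: "topspace ?T = PSpec ?A" unfolding topspace_def by blast
  have cl: "closedin ?T C \<longleftrightarrow> (\<exists>S\<subseteq>mpoly_carrier n. C = zariski_closed ?A S)" for C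
  proof
    assume "closedin ?T C"
    then have "C \<subseteq> PSpec ?A" "openin ?T (PSpec ?A - C)" by (auto simp: closedin_def top)
    then obtain S where S: "S \<subseteq> carrier ?A" "PSpec ?A - C = PSpec ?A - zariski_closed ?A S"
      unfolding openin_zariski_topology by blast
    then have "C = zariski_closed ?A S" using \<open>C \<subseteq> _\<close> by (auto simp: zariski_closed_def)
    then show "\<exists>S\<subseteq>mpoly_carrier n. C = zariski_closed ?A S" using S(1) by (auto simp: A_poisson_sel)
  next
    assume "\<exists>S\<subseteq>mpoly_carrier n. C = zariski_closed ?A S"
    then show "closedin ?T C"
      unfolding closedin_def top openin_zariski_topology
      by (auto simp: A_poisson_sel zariski_closed_def)
  qed
  show ?thesis
  proof (intro iffI conjI)
    assume *: "poisson_locally_closed ?A P"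
    then show P: "P \<in> PSpec ?A" by (simp add: poisson_locally_closed_def)
    obtain U C where UC: "openin ?T U" "closedin ?T C" "{P} = U \<inter> C"
      using * by (auto simp: poisson_locally_closed_def locally_closed_in_def)
    obtain S where S: "S \<subseteq> mpoly_carrier n" "U = PSpec ?A - zariski_closed ?A S"
      using UC(1) by (auto simp: openin_zariski_topology A_poisson_sel)
    obtain S' where S': "S' \<subseteq> mpoly_carrier n" "C = zariski_closed ?A S'" using UC(2) cl by blast
    have PU: "P \<in> U" "P \<in> C" using UC(3) by auto
    then obtain f where f: "f \<in> S" "f \<notin> P" using S(2) P by (auto simp: zariski_closed_def)
    have "f \<in> Q" if Q: "Q \<in> PSpec ?A" "P \<subset> Q" for Q
    proof -
      have "Q \<in> C" using PU(2) Q by (auto simp: S'(2) zariski_closed_def)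
      then have "Q \<notin> U" using UC(3) Q(2) by auto
      then show ?thesis using S(2) Q(1) f(1) by (auto simp: zariski_closed_def)
    qed
    then show "\<exists>f\<in>mpoly_carrier n - P. \<forall>Q\<in>PSpec ?A. P \<subset> Q \<longrightarrow> f \<in> Q" using f S(1) by blast
  next
    assume *: "P \<in> PSpec ?A \<and> (\<exists>f\<in>mpoly_carrier n - P. \<forall>Q\<in>PSpec ?A. P \<subset> Q \<longrightarrow> f \<in> Q)"
    then obtain f where f: "f \<in> mpoly_carrier n - P" "\<And>Q. Q \<in> PSpec ?A \<Longrightarrow> P \<subset> Q \<Longrightarrow> f \<in> Q" by blast
    have "openin ?T (PSpec ?A - zariski_closed ?A {f})"
      unfolding openin_zariski_topology using f(1) by (auto simp: A_poisson_sel intro!: exI[of _ "{f}"])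
    moreover have "closedin ?T (zariski_closed ?A P)"
      unfolding cl using PC(1)[of P] * by (intro exI[of _ P]) simp
    moreover have "{P} = (PSpec ?A - zariski_closed ?A {f}) \<inter> zariski_closed ?A P"
    proof (rule Set.set_eqI)
      fix Q
      show "Q \<in> {P} \<longleftrightarrow> Q \<in> (PSpec ?A - zariski_closed ?A {f}) \<inter> zariski_closed ?A P"
      proof (cases "Q = P")
        case True
        then show ?thesis using conjunct1[OF *] f(1) by (simp add: zariski_closed_def)
      next
        case False
        then have "f \<in> Q" if "Q \<in> PSpec ?A" "P \<subseteq> Q" using f(2)[of Q] that by blast
        then show ?thesis using False by (auto simp: zariski_closed_def)
      qed
    qed
    ultimately show "poisson_locally_closed ?A P"
      using * unfolding poisson_locally_closed_def locally_closed_in_def by blast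
  qed
qed

section \<open>Primitive ideals\<close>

text \<open>The condition from \<open>fr_center_iff\<close>: for a Poisson prime \<open>P\<close>
  and \<open>v\<close> outside it, the fraction \<open>u/v\<close> is Poisson central.\<close>

definition poisson_central_mod ::
  "nat \<Rightarrow> 'k::comm_ring_1 \<Rightarrow> 'k mpoly set \<Rightarrow> 'k mpoly \<Rightarrow> 'k mpoly \<Rightarrow> bool" where
  "poisson_central_mod n a P u v \<longleftrightarrow>
    (\<forall>g\<in>mpoly_carrier n. pbr n a u g * v - pbr n a v g * u \<in> P)"

lemma (in mpoly_ideal) power_diff_mem:
  assumes "x \<in> mpoly_carrier n" "y \<in> mpoly_carrier n" "x - y \<in> I"
  shows "x ^ r - y ^ r \<in> I"
proof (induction r)
  case (Suc r)
  have "x ^ Suc r - y ^ Suc r = x * (x ^ r - y ^ r) + y ^ r * (x - y)" by (simp add: algebra_simps)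
  then show ?case using add[OF mult[OF assms(1) Suc] mult[OF mpoly_carrier_power[OF assms(2)] assms(3)]] by simp
qed (simp add: zero)

context mpoly_poisson_prime
begin

text \<open>The denominators of a Poisson central fraction form a Poisson ideal.\<close>

lemma central_denominator:
  assumes u: "u \<in> mpoly_carrier n" and v: "v \<in> mpoly_carrier n" "v \<notin> P"
    and cen: "poisson_central_mod n a P u v"
    and core: "\<And>I. poisson_ideal I A \<Longrightarrow> I \<subseteq> M \<Longrightarrow> I \<subseteq> P"
  shows "\<exists>b\<in>mpoly_carrier n - M. \<exists>c\<in>mpoly_carrier n. b * u - c * v \<in> P"
proof -
  note C = mpoly_carrier_intros mpoly_carrier_mult pbr_closed
  let ?I = "{b \<in> mpoly_carrier n. \<exists>c\<in>mpoly_carrier n. b * u - c * v \<in> P}"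
  have id: "mpoly_ideal n ?I"
  proof
    have "0 * u - 0 * v \<in> P" using zero by simp
    then show "0 \<in> ?I" using C(6) by blast
  next
    fix x y :: "'k mpoly" assume "x \<in> ?I" "y \<in> ?I"
    then obtain c d where *: "x \<in> mpoly_carrier n" "y \<in> mpoly_carrier n" "c \<in> mpoly_carrier n"
      "d \<in> mpoly_carrier n" "x * u - c * v \<in> P" "y * u - d * v \<in> P" by blast
    have "(x + y) * u - (c + d) * v = (x * u - c * v) + (y * u - d * v)" by (simp add: algebra_simps)
    then have "(x + y) * u - (c + d) * v \<in> P" using add[OF *(5,6)] by simp
    then show "x + y \<in> ?I" using C(3)[OF *(1,2)] C(3)[OF *(3,4)] by blast
  next
    fix r x :: "'k mpoly" assume r: "r \<in> mpoly_carrier n" and "x \<in> ?I"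
    then obtain c where *: "x \<in> mpoly_carrier n" "c \<in> mpoly_carrier n" "x * u - c * v \<in> P" by blast
    have "(r * x) * u - (r * c) * v = r * (x * u - c * v)" by (simp add: algebra_simps)
    then have "(r * x) * u - (r * c) * v \<in> P" using mult[OF r *(3)] by simp
    then show "r * x \<in> ?I" using C(8)[OF r *(1)] C(8)[OF r *(2)] by blast
  qed auto
  have "pbr n a b g \<in> ?I" if g: "g \<in> mpoly_carrier n" and b: "b \<in> ?I" for b g :: "'k mpoly"
  proof -
    obtain c where c: "b \<in> mpoly_carrier n" "c \<in> mpoly_carrier n" "b * u - c * v \<in> P" using b by blast
    let ?e = "b * u - c * v" and ?z = "pbr n a u g * v - pbr n a v g * u"
    have z: "?z \<in> P" using cen g by (simp add: poisson_central_mod_def)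
    \<comment> \<open>Bracketing \<open>b u - c v\<close> with \<open>g\<close> also produces
      \<open>b {u,g} - c {v,g}\<close>. After multiplication by \<open>v\<close>, centrality turns
      this into a multiple of \<open>b u - c v\<close>; the factor \<open>v\<close> cancels
      afterwards.\<close>
    have "v * (pbr n a b g * u - pbr n a c g * v) = v * pbr n a ?e g - b * ?z - pbr n a v g * ?e"
      by (simp add: pbr_diff_left pbr_mult_left algebra_simps)
    also have "\<dots> \<in> P"
      by (rule diff[OF diff[OF mult[OF v(1) bracket[OF g c(3)]] mult[OF c(1) z]] mult[OF C(9)[OF v(1) g] c(3)]])
    finally have "pbr n a b g * u - pbr n a c g * v \<in> P"
      using prime[OF v(1), of "pbr n a b g * u - pbr n a c g * v"] v(2) C(5)[OF C(8)[OF C(9)[OF c(1) g] u] C(8)[OF C(9)[OF c(2) g] v(1)]]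
      by simp
    then show ?thesis using C(9)[OF c(1) g] C(9)[OF c(2) g] by blast
  qed
  then have "poisson_ideal ?I A" using id by (simp only: poisson_ideal_A_poisson_iff) blast
  \<comment> \<open>The given denominator \<open>v\<close>, with \<open>c = u\<close>, shows that
    this Poisson ideal is not inside \<open>P\<close>; by the core property it is not inside
    \<open>M\<close> either.\<close>
  moreover have "v \<in> ?I" using v(1) u zero by (auto intro!: bexI[of _ u] simp: mult.commute)
  ultimately have "\<not> ?I \<subseteq> M" using core[of ?I] v(2) by blast
  then show ?thesis by blast
qed

text \<open>The sum is \<open>v ^ d * p(u/v)\<close>, so the fraction in question is the inverse of
  \<open>p(u/v)\<close>. Sums, products and inverses of central fractions are central; the
  cross-multiplied condition is proved without dividing.\<close>

lemma central_homogeneous: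
  assumes u: "u \<in> mpoly_carrier n" and v: "v \<in> mpoly_carrier n" "v \<notin> P"
    and cen: "poisson_central_mod n a P u v"
  shows "poisson_central_mod n a P (v ^ d) (\<Sum>r\<le>d. mpoly_const (p r) * u ^ r * v ^ (d - r))"
  unfolding poisson_central_mod_def
proof
  fix g :: "'k mpoly" assume g: "g \<in> mpoly_carrier n"
  let ?U = "\<Sum>r\<le>d. mpoly_const (p r) * u ^ r * v ^ (d - r)"
  note C = mpoly_carrier_intros mpoly_carrier_mult pbr_closed mpoly_carrier_power mpoly_carrier_sum
  \<comment> \<open>\<open>E k x\<close> expresses that \<open>x / v ^ k\<close> is Poisson central,
    tested on the fixed \<open>g\<close>. Products add the exponents \<open>k\<close>, sums keep
    them.\<close>
  define E where "E k x \<longleftrightarrow> x \<in> mpoly_carrier n \<and> pbr n a x g * v - of_nat k * pbr n a v g * x \<in> P" for k :: nat and x :: "'k mpoly"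
  have Em: "E (j + k) (x * y)" if "E j x" "E k y" for j k x y
  proof -
    have "pbr n a (x * y) g * v - of_nat (j + k) * pbr n a v g * (x * y) =
        x * (pbr n a y g * v - of_nat k * pbr n a v g * y) + y * (pbr n a x g * v - of_nat j * pbr n a v g * x)"
      by (simp add: pbr_mult_left algebra_simps)
    then show ?thesis using that by (auto simp: E_def intro: add mult C)
  qed
  have E0: "E 0 (mpoly_const c)" for c by (simp add: E_def zero C)
  have Epow: "E 1 x \<Longrightarrow> E k (x ^ k)" for x k
  proof (induction k)
    case 0
    then show ?case using E0[of 1] by (simp add: mpoly_const_simps)
  next
    case (Suc k)
    then show ?case using Em[of 1 x k "x ^ k"] by simp
  qed
  have Eu: "E 1 u" and Ev: "E 1 v"
    using cen g u v zero by (simp_all add: E_def poisson_central_mod_def mult.commute)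
  have Eadd: "E k (x + y)" if "E k x" "E k y" for k x y
  proof -
    have "pbr n a (x + y) g * v - of_nat k * pbr n a v g * (x + y) =
       (pbr n a x g * v - of_nat k * pbr n a v g * x) + (pbr n a y g * v - of_nat k * pbr n a v g * y)"
      by (simp add: pbr_add_left algebra_simps)
    then show ?thesis using that by (auto simp: E_def intro: add C)
  qed
  have Esum: "(\<And>i. i \<in> J \<Longrightarrow> E k (f i)) \<Longrightarrow> E k (sum f J)" for k f and J :: "nat set"
  proof (induction J rule: infinite_finite_induct)
    case (insert i J)
    then show ?case by (simp add: Eadd)
  qed (simp_all add: E_def zero C)
  have "E d (mpoly_const (p r) * u ^ r * v ^ (d - r))" if "r \<le> d" for r
    using Em[OF Em[OF E0 Epow[OF Eu, of r]] Epow[OF Ev, of "d - r"]] that by simp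
  then have EU: "E d ?U" by (intro Esum) auto
  have EV: "E d (v ^ d)" by (rule Epow[OF Ev])
  have UC: "?U \<in> mpoly_carrier n" using EU by (simp add: E_def)
  let ?x = "pbr n a (v ^ d) g * ?U - pbr n a ?U g * v ^ d"
  have "v * ?x = ?U * (pbr n a (v ^ d) g * v - of_nat d * pbr n a v g * v ^ d)
      - v ^ d * (pbr n a ?U g * v - of_nat d * pbr n a v g * ?U)"
    by (simp add: algebra_simps)
  also have "\<dots> \<in> P"
    by (rule diff[OF mult[OF UC conjunct2[OF EV[unfolded E_def]]]
          mult[OF C(10)[OF v(1)] conjunct2[OF EU[unfolded E_def]]]])
  finally show "?x \<in> P"
    using prime[OF v(1), of ?x] v(2) C(5)[OF C(8)[OF C(9)[OF C(10)[OF v(1)] g] UC] C(8)[OF C(9)[OF UC g] C(10)[OF v(1)]]]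
    by blast
qed

text \<open>In the local ring of fractions with denominator outside \<open>M\<close>, the central
  fraction \<open>u/v\<close> has the form \<open>c/b\<close>, and its residue is a root of some
  \<open>p\<close>. If \<open>p(u/v)\<close> were nonzero, its inverse would be central as well and
  would again have a denominator outside \<open>M\<close>, although \<open>p(u/v)\<close> lies in
  the maximal ideal of the local ring. Hence \<open>p(u/v) = 0\<close>.\<close>

lemma central_algebraic_if_primitive:
  assumes M: "maximalideal M A" "P \<subseteq> M"
    and core: "\<And>I. poisson_ideal I A \<Longrightarrow> I \<subseteq> M \<Longrightarrow> I \<subseteq> P"
    and u: "u \<in> mpoly_carrier n" and v: "v \<in> mpoly_carrier n" "v \<notin> P"
    and cen: "poisson_central_mod n a P u v"
  shows "algebraic_mod P u v"
proof -
  note C = mpoly_carrier_intros mpoly_carrier_mult mpoly_carrier_power mpoly_carrier_sum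
  interpret M: mpoly_prime n M by (rule maximal_imp_mpoly_prime[OF M(1)])
  interpret Mq: mpoly_prime_quotient n M a ..
  obtain b c where b: "b \<in> mpoly_carrier n" "b \<notin> M" and c: "c \<in> mpoly_carrier n"
    and bc: "b * u - c * v \<in> P" using central_denominator[OF u v cen core] by blast
  obtain b' where b': "b' \<in> mpoly_carrier n" "b * b' - 1 \<in> M"
    using M(1) b unfolding maximalideal_A_poisson_iff by blast
  have cb: "c * b' \<in> mpoly_carrier n" by (intro C c b')
  have "(c * b') * b - c * 1 = c * (b * b' - 1)" by (simp add: algebra_simps)
  then have "Mq.fr (c * b') 1 = Mq.fr c b"
    using M.mult[OF c b'(2)] by (subst Mq.fr_eq_iff[OF cb C(7) M.one c b]) simp
  then have "algebraic_mod M c b"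
    using maximal_imp_algebraic_mod[OF M(1) cb] Mq.algebraic_iff[OF cb C(7) M.one] Mq.algebraic_iff[OF c b]
    by simp
  then obtain d p where p: "p d \<noteq> 0" and w: "(\<Sum>r\<le>d. mpoly_const (p r) * c ^ r * b ^ (d - r)) \<in> M"
    (is "?w \<in> M") unfolding algebraic_mod_def by blast
  let ?U = "\<Sum>r\<le>d. mpoly_const (p r) * u ^ r * v ^ (d - r)"
  have UC: "?U \<in> mpoly_carrier n" by (intro C u v)
  \<comment> \<open>This is \<open>p(u/v) = ?w / b ^ d\<close> with denominators cleared; it follows
    termwise from \<open>b u = c v\<close> modulo \<open>P\<close>.\<close>
  have bU: "b ^ d * ?U - ?w * v ^ d \<in> P"
  proof -
    have "b ^ d * (mpoly_const (p r) * u ^ r * v ^ (d - r)) - mpoly_const (p r) * c ^ r * b ^ (d - r) * v ^ d =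
        (mpoly_const (p r) * b ^ (d - r) * v ^ (d - r)) * ((b * u) ^ r - (c * v) ^ r)" if "r \<le> d" for r
    proof -
      have "b ^ d = b ^ r * b ^ (d - r)" "v ^ d = v ^ r * v ^ (d - r)"
        using that by (simp_all flip: power_add)
      then show ?thesis by (simp add: algebra_simps power_mult_distrib)
    qed
    then have "b ^ d * ?U - ?w * v ^ d =
        (\<Sum>r\<le>d. (mpoly_const (p r) * b ^ (d - r) * v ^ (d - r)) * ((b * u) ^ r - (c * v) ^ r))"
      unfolding sum_distrib_left sum_distrib_right sum_subtractf[symmetric] by (intro sum.cong) auto
    also have "\<dots> \<in> P"
      by (intro sum_mem mult power_diff_mem bc C b v c u)
    finally show ?thesis .
  qed
  have "?U \<in> P"
  proof (rule ccontr)
    assume U: "?U \<notin> P"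
    obtain e f where e: "e \<in> mpoly_carrier n" "e \<notin> M" and f: "f \<in> mpoly_carrier n"
      and ef: "e * v ^ d - f * ?U \<in> P"
      using central_denominator[OF C(9)[OF v(1)] UC U central_homogeneous[OF u v cen] core] by blast
    have "v ^ d * (b ^ d * e - f * ?w) = b ^ d * (e * v ^ d - f * ?U) + f * (b ^ d * ?U - ?w * v ^ d)"
      by (simp add: algebra_simps)
    then have "v ^ d * (b ^ d * e - f * ?w) \<in> P"
      using add[OF mult[OF C(9)[OF b(1)] ef] mult[OF f bU]] by simp
    moreover have bC: "b ^ d * e - f * ?w \<in> mpoly_carrier n" by (intro C b e f c)
    ultimately have "b ^ d * e - f * ?w \<in> M"
      using prime[OF C(9)[OF v(1)] bC] power_notin[OF v] M(2) by blast
    then have "b ^ d * e \<in> M" by (rule M.diff_cancel[OF _ M.mult[OF f w]])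
    then show False using M.prime[OF C(9)[OF b(1)] e(1)] e(2) M.power[OF b(1)] b(2) by blast
  qed
  then show ?thesis unfolding algebraic_mod_def using p by blast
qed

end

lemma primitive_imp_rational:
  fixes a :: "'k::field_char_0"
  assumes "poisson_primitive (A_poisson n a) P"
  shows "poisson_rational (range mpoly_const) (A_poisson n a) P"
proof -
  interpret mpoly_poisson_prime n P a
    using assms by (simp add: poisson_primitive_def mpoly_poisson_prime_iff)
  from assms have "\<exists>M. maximalideal M A \<and> P \<subseteq> M \<and> (\<forall>I. poisson_ideal I A \<and> I \<subseteq> M \<longrightarrow> I \<subseteq> P)"
    by (simp add: poisson_primitive_def)
  then obtain M where M: "maximalideal M A" "P \<subseteq> M" "\<forall>I. poisson_ideal I A \<and> I \<subseteq> M \<longrightarrow> I \<subseteq> P"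
    by (elim exE conjE)
  show ?thesis
    unfolding poisson_rational_iff
  proof (intro ballI impI)
    fix u v assume "u \<in> mpoly_carrier n" "v \<in> mpoly_carrier n - P"
      and "\<forall>g\<in>mpoly_carrier n. pbr n a u g * v - pbr n a v g * u \<in> P"
    then show "algebraic_mod P u v"
      using central_algebraic_if_primitive[OF M(1,2) M(3)[rule_format], of u v]
      by (simp add: poisson_central_mod_def)
  qed
qed

section \<open>Derivations and their cores\<close>

locale mpoly_derivation =
  fixes n :: nat and D :: "'k::field_char_0 mpoly \<Rightarrow> 'k mpoly"
  assumes D_add: "D (x + y) = D x + D y"
    and D_mult: "D (x * y) = D x * y + x * D y"
    and D_closed: "x \<in> mpoly_carrier n \<Longrightarrow> D x \<in> mpoly_carrier n"
begin

lemma D_zero [simp]: "D 0 = 0"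
  using D_add[of 0 0] by simp

lemma D_sum: "D (sum f J) = (\<Sum>i\<in>J. D (f i))"
  by (induction J rule: infinite_finite_induct) (auto simp: D_add)

lemma D_of_nat [simp]: "D (of_nat m) = 0"
proof -
  have "D 1 = 0" using D_mult[of 1 1] by simp
  then show ?thesis by (induction m) (auto simp: D_add)
qed

lemma D_of_nat_mult: "D (of_nat m * x) = of_nat m * D x"
  by (simp add: D_mult)

lemma pow_add: "(D ^^ m) (x + y) = (D ^^ m) x + (D ^^ m) y"
  by (induction m) (auto simp: D_add)

lemma pow_zero [simp]: "(D ^^ m) 0 = 0"
  by (induction m) auto

lemma pow_sum: "(D ^^ m) (sum f J) = (\<Sum>i\<in>J. (D ^^ m) (f i))"
  by (induction J rule: infinite_finite_induct) (auto simp: pow_add)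

lemma pow_closed: "x \<in> mpoly_carrier n \<Longrightarrow> (D ^^ m) x \<in> mpoly_carrier n"
  by (induction m) (auto simp: D_closed)

lemma leibniz: "(D ^^ m) (x * y) = (\<Sum>k\<le>m. of_nat (m choose k) * (D ^^ k) x * (D ^^ (m - k)) y)"
proof (induction m)
  case (Suc m)
  let ?A = "\<lambda>i j. (D ^^ i) x * (D ^^ j) y"
  have "(D ^^ Suc m) (x * y) = (\<Sum>k\<le>m. of_nat (m choose k) * D (?A k (m - k)))"
    by (simp add: Suc D_sum D_of_nat_mult mult.assoc)
  also have "\<dots> = (\<Sum>k\<le>m. of_nat (m choose k) * ?A (Suc k) (m - k)) +
      (\<Sum>k\<le>m. of_nat (m choose k) * ?A k (Suc m - k))"
    unfolding sum.distrib[symmetric] by (intro sum.cong) (auto simp: D_mult algebra_simps Suc_diff_le)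
  also have "(\<Sum>k\<le>m. of_nat (m choose k) * ?A k (Suc m - k)) =
      (\<Sum>k\<le>Suc m. of_nat (m choose k) * ?A k (Suc m - k))"
    by simp
  also have "\<dots> = ?A 0 (Suc m) + (\<Sum>k\<le>m. of_nat (m choose Suc k) * ?A (Suc k) (m - k))"
    by (subst sum.atMost_Suc_shift) simp
  also have "(\<Sum>k\<le>m. of_nat (m choose k) * ?A (Suc k) (m - k)) + \<dots> =
      ?A 0 (Suc m) + (\<Sum>k\<le>m. of_nat (Suc m choose Suc k) * ?A (Suc k) (m - k))"
    by (simp add: algebra_simps sum.distrib)
  also have "\<dots> = (\<Sum>k\<le>Suc m. of_nat (Suc m choose k) * ?A k (Suc m - k))"
    by (subst sum.atMost_Suc_shift) simp
  finally show ?case by (simp add: mult.assoc)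
qed simp

text \<open>For an ideal \<open>I\<close>, the largest \<open>D\<close>-stable ideal contained in
  \<open>I\<close>.\<close>

definition core :: "'k mpoly set \<Rightarrow> 'k mpoly set" where
  "core I = {x \<in> mpoly_carrier n. \<forall>m. (D ^^ m) x \<in> I}"

lemma core_subset: "core I \<subseteq> I"
  by (auto simp: core_def dest: spec[of _ 0])

lemma core_stable: "x \<in> core I \<Longrightarrow> D x \<in> core I"
proof -
  assume x: "x \<in> core I"
  have eq: "(D ^^ m) (D x) = (D ^^ Suc m) x" for m
    by (simp only: funpow_Suc_right o_apply)
  have "(D ^^ m) (D x) \<in> I" for m using x unfolding core_def eq by blast
  then show ?thesis using x by (auto simp: core_def D_closed)
qed

end

lemma of_nat_eq_mpoly_const: "(of_nat m :: 'k::comm_ring_1 mpoly) = mpoly_const (of_nat m)"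
  by (induction m) (simp_all add: mpoly_const_simps)

lemma (in mpoly_prime) of_nat_mult_mem:
  assumes "m > 0" "x \<in> mpoly_carrier n" "of_nat m * x \<in> I"
  shows "x \<in> I"
  using prime[of "of_nat m" x] assms const[of "of_nat m"]
  by (simp add: of_nat_eq_mpoly_const mpoly_carrier_intros)

text \<open>Primality of the core uses characteristic zero: if \<open>p\<close> and \<open>q\<close> are minimal with
  \<open>D\<^sup>p x, D\<^sup>q y \<notin> I\<close>, then \<open>D\<^sup>p\<^sup>+\<^sup>q (x y)\<close> is a nonzero multiple of \<open>D\<^sup>p x * D\<^sup>q y\<close> modulo \<open>I\<close>.\<close>

lemma (in mpoly_derivation) mpoly_prime_core:
  assumes "mpoly_prime n I"
  shows "mpoly_prime n (core I)"
proof -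
  interpret I: mpoly_prime n I by fact
  note C = mpoly_carrier_intros mpoly_carrier_mult
  have ofC: "of_nat k \<in> mpoly_carrier n" for k
    unfolding of_nat_eq_mpoly_const by (rule C)
  show ?thesis
  proof
    show "core I \<subseteq> mpoly_carrier n" by (auto simp: core_def)
    show "0 \<in> core I" by (simp add: core_def C I.zero)
    show "x + y \<in> core I" if "x \<in> core I" "y \<in> core I" for x y
      using that by (auto simp: core_def pow_add intro: C I.add)
    show "r * x \<in> core I" if "r \<in> mpoly_carrier n" "x \<in> core I" for r x
      using that by (auto simp: core_def leibniz intro!: C I.sum_mem I.mult ofC pow_closed)
    show "1 \<notin> core I" using core_subset I.one by blast
    fix x y assume x: "x \<in> mpoly_carrier n" and y: "y \<in> mpoly_carrier n" and xy: "x * y \<in> core I"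
    show "x \<in> core I \<or> y \<in> core I"
    proof (rule ccontr)
      assume "\<not> ?thesis"
      then have ex: "\<exists>p. (D ^^ p) x \<notin> I" "\<exists>q. (D ^^ q) y \<notin> I" using x y by (auto simp: core_def)
      define p where "p = (LEAST p. (D ^^ p) x \<notin> I)"
      define q where "q = (LEAST q. (D ^^ q) y \<notin> I)"
      have p: "(D ^^ p) x \<notin> I" "\<And>k. k < p \<Longrightarrow> (D ^^ k) x \<in> I"
        unfolding p_def using LeastI_ex[OF ex(1)] not_less_Least by blast+
      have q: "(D ^^ q) y \<notin> I" "\<And>k. k < q \<Longrightarrow> (D ^^ k) y \<in> I"
        unfolding q_def using LeastI_ex[OF ex(2)] not_less_Least by blast+
      let ?t = "\<lambda>k. of_nat ((p + q) choose k) * (D ^^ k) x * (D ^^ (p + q - k)) y"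
      have rest: "(\<Sum>k\<in>{..p + q} - {p}. ?t k) \<in> I"
      proof (rule I.sum_mem)
        fix k assume "k \<in> {..p + q} - {p}"
        then consider "k < p" | "p + q - k < q" by force
        then show "?t k \<in> I"
        proof cases
          case 1
          then show ?thesis by (intro I.mult_right I.mult p(2) ofC pow_closed x y)
        next
          case 2
          then show ?thesis by (intro I.mult C ofC pow_closed x y q(2))
        qed
      qed
      have "(\<Sum>k\<le>p + q. ?t k) = ?t p + (\<Sum>k\<in>{..p + q} - {p}. ?t k)"
        by (rule sum.remove) auto
      then have eq: "?t p = (\<Sum>k\<le>p + q. ?t k) - (\<Sum>k\<in>{..p + q} - {p}. ?t k)" by simp
      have "(\<Sum>k\<le>p + q. ?t k) \<in> I"
        using xy unfolding core_def leibniz[symmetric] by blast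
      then have "?t p \<in> I" unfolding eq using rest by (rule I.diff)
      then have "of_nat ((p + q) choose p) * ((D ^^ p) x * (D ^^ q) y) \<in> I" by (simp add: mult.assoc)
      then have "(D ^^ p) x * (D ^^ q) y \<in> I"
        by (rule I.of_nat_mult_mem[rotated 2]) (auto intro: C pow_closed x y)
      then show False using I.prime[OF pow_closed[OF x] pow_closed[OF y]] p(1) q(1) by blast
    qed
  qed
qed

global_interpretation Delta: mpoly_derivation n "Delta n" for n
  by unfold_locales (simp_all add: Delta_add Delta_mult mpoly_carrier_Delta)

global_interpretation Gamma: mpoly_derivation n "Gamma n a" for n a
  by unfold_locales (simp_all add: Gamma_add Gamma_mult mpoly_carrier_Gamma)

text \<open>Iterates the commutator identity \<open>Delta_Gamma\<close>. It is what lets the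
  \<Delta>-core of a \<Gamma>-stable ideal remain \<Gamma>-stable.\<close>

lemma Delta_pow_Gamma:
  fixes a :: "'k::field_char_0"
  shows "(Delta n ^^ m) (Gamma n a x) = Gamma n a ((Delta n ^^ m) x) + of_nat m * (Delta n ^^ m) x"
  by (induction m) (simp_all add: Delta_add Delta_Gamma Delta.D_of_nat_mult algebra_simps)

text \<open>A Poisson ideal avoiding a bracket \<open>b\<close> becomes stable under \<open>\<Delta>\<close> and \<open>\<Gamma>\<close> after inverting \<open>b\<close>.\<close>

lemma poisson_ideal_subset_core:
  assumes M: "mpoly_prime n M" and I: "poisson_ideal I (A_poisson n a)" "I \<subseteq> M"
    and gh: "g \<in> mpoly_carrier n" "h \<in> mpoly_carrier n" "pbr n a g h \<notin> M"
  shows "I \<subseteq> Delta.core n (Gamma.core n a M)"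
proof -
  interpret M: mpoly_prime n M by fact
  interpret I: mpoly_ideal n I using I(1) by (simp add: poisson_ideal_A_poisson_iff)
  have br: "pbr n a y x \<in> I" if "x \<in> mpoly_carrier n" "y \<in> I" for x y
    using I(1) that by (simp add: poisson_ideal_A_poisson_iff)
  note C = mpoly_carrier_Delta mpoly_carrier_Gamma mpoly_carrier_mult mpoly_carrier_power mpoly_carrier_intros
  define b where "b = pbr n a g h"
  have b: "b \<in> mpoly_carrier n" "b \<notin> M" unfolding b_def using gh pbr_closed by blast+
  \<comment> \<open>The contraction to polynomials of the ideal generated by \<open>I\<close> after
    inverting \<open>b\<close>. It stays inside \<open>M\<close> because \<open>M\<close> is prime
    and avoids \<open>b\<close>.\<close>
  define S where "S = {x \<in> mpoly_carrier n. \<exists>m. b ^ m * x \<in> I}"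
  have stab: "D x \<in> S" if x: "x \<in> S" and DC: "\<And>y. y \<in> mpoly_carrier n \<Longrightarrow> D y \<in> mpoly_carrier n"
    and D: "\<And>y z. D (y * z) = D y * z + y * D z"
    and Db: "\<And>y. y \<in> I \<Longrightarrow> D y * b \<in> I" for x D
  proof -
    obtain m where m: "x \<in> mpoly_carrier n" "b ^ m * x \<in> I" using x by (auto simp: S_def)
    have "b ^ (m + m + 1) * D x = b ^ m * (D (b ^ m * x) * b) - (b * D (b ^ m)) * (b ^ m * x)"
      by (simp add: D algebra_simps power_add)
    also have "\<dots> \<in> I"
      by (rule I.diff[OF I.mult[OF C(4)[OF b(1)] Db[OF m(2)]] I.mult[OF C(3)[OF b(1) DC[OF C(4)[OF b(1)]]] m(2)]])
    finally show ?thesis using DC[OF m(1)] unfolding S_def by blast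
  qed
  have SD: "Delta n x \<in> S" if "x \<in> S" for x
  proof (rule stab[OF that C(1) Delta_mult])
    show "Delta n y * b \<in> I" if "y \<in> I" for y
      unfolding b_def
      by (subst Delta_mult_pbr) (intro I.diff I.mult C br gh that)
  qed
  have SG: "Gamma n a x \<in> S" if "x \<in> S" for x
  proof (rule stab[OF that C(2) Gamma_mult])
    show "Gamma n a y * b \<in> I" if "y \<in> I" for y
      unfolding b_def
      by (subst Gamma_mult_pbr) (intro I.diff I.mult C br gh that)
  qed
  have SM: "S \<subseteq> M"
  proof
    fix x assume "x \<in> S"
    then obtain m where "x \<in> mpoly_carrier n" "b ^ m * x \<in> M" using I(2) by (auto simp: S_def)
    then show "x \<in> M" using M.prime[OF C(4)[OF b(1)]] M.power[OF b(1)] b(2) by blast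
  qed
  have SDp: "x \<in> S \<Longrightarrow> (Delta n ^^ m) x \<in> S" for x m by (induction m) (auto intro: SD)
  have SGp: "x \<in> S \<Longrightarrow> (Gamma n a ^^ m) x \<in> S" for x m by (induction m) (auto intro: SG)
  show ?thesis
  proof
    fix x assume x: "x \<in> I"
    have "b ^ 0 * x \<in> I" using x by simp
    then have xS: "x \<in> S" using x I.sub unfolding S_def by blast
    have "(Gamma n a ^^ p) ((Delta n ^^ q) x) \<in> M" for p q
      using SGp[OF SDp[OF xS]] SM by blast
    then show "x \<in> Delta.core n (Gamma.core n a M)"
      using x I.sub by (auto simp: Delta.core_def Gamma.core_def intro: Delta.pow_closed)
  qed
qed

text \<open>The inner core is \<Gamma>-stable, and by \<open>Delta_pow_Gamma\<close> the outer one
  inherits this while being \<Delta>-stable by construction. An ideal stable under both derivations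
  is Poisson; primality passes through both cores.\<close>

lemma core_in_PSpec:
  assumes "mpoly_prime n M"
  shows "Delta.core n (Gamma.core n a M) \<in> PSpec (A_poisson n a)"
proof -
  let ?G = "Gamma.core n a M" and ?N = "Delta.core n (Gamma.core n a M)"
  interpret G: mpoly_prime n ?G by (rule Gamma.mpoly_prime_core[OF assms])
  interpret N: mpoly_prime n ?N by (rule Delta.mpoly_prime_core[OF G.mpoly_prime_axioms])
  have ofC: "of_nat k \<in> mpoly_carrier n" for k
    unfolding of_nat_eq_mpoly_const by (rule mpoly_carrier_intros)
  have "Gamma n a x \<in> ?N" if x: "x \<in> ?N" for x
  proof -
    have D: "(Delta n ^^ m) x \<in> ?G" for m using x by (simp add: Delta.core_def)
    have "(Delta n ^^ m) (Gamma n a x) \<in> ?G" for m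
      unfolding Delta_pow_Gamma by (rule G.add[OF Gamma.core_stable[OF D] G.mult[OF ofC D]])
    then show ?thesis using x by (simp add: Delta.core_def mpoly_carrier_Gamma)
  qed
  moreover have "Delta n x \<in> ?N" if "x \<in> ?N" for x by (rule Delta.core_stable[OF that])
  ultimately have "pbr n a y x \<in> ?N" if "x \<in> mpoly_carrier n" "y \<in> ?N" for x y
    unfolding pbr_def using that
    by (intro N.diff N.mult_right) (auto intro: mpoly_carrier_Gamma mpoly_carrier_Delta)
  then show ?thesis using N.mpoly_prime_axioms by (simp add: PSpec_A_poisson_iff)
qed

lemma locally_closed_imp_primitive:
  fixes a :: "'k::field_char_0"
  assumes "poisson_locally_closed (A_poisson n a) P"
  shows "poisson_primitive (A_poisson n a) P"
proof -
  let ?A = "A_poisson n a"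
  have P: "P \<in> PSpec ?A" using assms by (simp add: poisson_locally_closed_def)
  obtain f where f: "f \<in> mpoly_carrier n" "f \<notin> P" and max: "\<And>Q. Q \<in> PSpec ?A \<Longrightarrow> P \<subset> Q \<Longrightarrow> f \<in> Q"
    using assms unfolding poisson_locally_closed_iff by blast
  have Pp: "mpoly_prime n P" using P by (simp add: PSpec_A_poisson_iff)
  obtain M where M: "maximalideal M ?A" "P \<subseteq> M" "f \<notin> M"
    using exists_maximal_avoiding[OF Pp f] by blast
  have Mp: "mpoly_prime n M" by (rule maximal_imp_mpoly_prime[OF M(1)])
  have "\<forall>I. poisson_ideal I ?A \<and> I \<subseteq> M \<longrightarrow> I \<subseteq> P"
  proof (cases "\<forall>g\<in>mpoly_carrier n. \<forall>h\<in>mpoly_carrier n. pbr n a g h \<in> M")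
    \<comment> \<open>With all brackets in \<open>M\<close>, the ideal \<open>M\<close> is itself a
      Poisson prime avoiding \<open>f\<close>, so it is \<open>P\<close>.\<close>
    case True
    then have "M \<in> PSpec ?A"
      using Mp mpoly_ideal.sub[of n M] unfolding PSpec_A_poisson_iff mpoly_prime_def by blast
    then have "M = P" using max[of M] M(2,3) by blast
    then show ?thesis by blast
  next
    case False
    then obtain g h where gh: "g \<in> mpoly_carrier n" "h \<in> mpoly_carrier n" "pbr n a g h \<notin> M" by blast
    let ?N = "Delta.core n (Gamma.core n a M)"
    have sub: "I \<subseteq> ?N" if "poisson_ideal I ?A" "I \<subseteq> M" for I
      by (rule poisson_ideal_subset_core[OF Mp that gh])
    have "P \<subseteq> ?N" using P M(2) by (intro sub) (auto simp: PSpec_def)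
    moreover have "f \<notin> ?N" using M(3) Delta.core_subset Gamma.core_subset by blast
    ultimately have "?N = P" using max[OF core_in_PSpec[OF Mp]] by blast
    then show ?thesis using sub by blast
  qed
  then show ?thesis unfolding poisson_primitive_def using P M(1,2) by blast
qed

section \<open>The Dixmier map and weight vectors\<close>

definition dixmier_coeff :: "nat \<Rightarrow> nat \<Rightarrow> 'k::field_char_0 mpoly \<Rightarrow> 'k mpoly" where
  "dixmier_coeff n k f = mpoly_const ((-1) ^ k / fact k) * (Delta n ^^ k) f"

text \<open>With \<open>s = X\<^sub>i\<^sub>+\<^sub>1 / X\<^sub>i\<close>, this is \<open>X\<^sub>i\<^sup>N\<close> times the Dixmier map \<open>\<Sum>\<^sub>k (-s)\<^sup>k / k! \<Delta>\<^sup>k f\<close>,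
  truncated at \<open>N\<close>.\<close>

definition dixmier :: "nat \<Rightarrow> nat \<Rightarrow> nat \<Rightarrow> 'k::field_char_0 mpoly \<Rightarrow> 'k mpoly" where
  "dixmier n i N f = (\<Sum>k\<le>N. mpoly_var (Suc i) ^ k * mpoly_var i ^ (N - k) * dixmier_coeff n k f)"

lemma dixmier_coeff_closed:
  "f \<in> mpoly_carrier n \<Longrightarrow> dixmier_coeff n k f \<in> mpoly_carrier n"
  unfolding dixmier_coeff_def by (intro mpoly_carrier_intros mpoly_carrier_mult Delta.pow_closed)

lemma dixmier_closed:
  "\<lbrakk>i < n; f \<in> mpoly_carrier n\<rbrakk> \<Longrightarrow> dixmier n i N f \<in> mpoly_carrier n"
  unfolding dixmier_def
  by (intro mpoly_carrier_sum mpoly_carrier_mult mpoly_carrier_power mpoly_carrier_intros dixmier_coeff_closed) auto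

lemma mpoly_const_diff: "mpoly_const (c - d) = mpoly_const c - (mpoly_const d :: 'k::comm_ring_1 mpoly)"
  by (simp add: mpoly_const_def single_diff)

lemma Delta_const_mult: "Delta n (mpoly_const c * f) = mpoly_const c * Delta n f"
  by (simp add: Delta_mult)

lemma Delta_pow_const_mult: "(Delta n ^^ k) (mpoly_const c * f) = mpoly_const c * (Delta n ^^ k) f"
  by (induction k) (simp_all add: Delta_const_mult)

lemma dixmier_sum: "dixmier n i N (sum f J) = (\<Sum>j\<in>J. dixmier n i N (f j))"
  unfolding dixmier_def dixmier_coeff_def Delta.pow_sum sum_distrib_left by (rule sum.swap)

lemma dixmier_const_mult: "dixmier n i N (mpoly_const c * f) = mpoly_const c * dixmier n i N f"
  unfolding dixmier_def dixmier_coeff_def Delta_pow_const_mult sum_distrib_left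
  by (intro sum.cong) (auto simp: mult_ac)

text \<open>The exponential of a derivation is multiplicative: divided by factorials, the Leibniz
  formula becomes a Cauchy product.\<close>

lemma dixmier_coeff_mult:
  "dixmier_coeff n m (f * g) = (\<Sum>k\<le>m. dixmier_coeff n k f * dixmier_coeff n (m - k) g)"
  unfolding dixmier_coeff_def Delta.leibniz sum_distrib_left
proof (intro sum.cong refl)
  fix k assume "k \<in> {..m}"
  then have k: "k \<le> m" by simp
  have "(-1) ^ m / fact m * of_nat (m choose k) = (-1) ^ k / fact k * ((-1) ^ (m - k) / fact (m - k) :: 'a)"
    using k by (simp add: binomial_fact field_simps flip: power_add)
  then have eq: "mpoly_const ((-1) ^ m / fact m) * of_nat (m choose k) =
      mpoly_const ((-1) ^ k / fact k) * (mpoly_const ((-1) ^ (m - k) / fact (m - k)) :: 'a mpoly)"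
    by (simp add: of_nat_eq_mpoly_const flip: mpoly_const_simps)
  show "mpoly_const ((-1) ^ m / fact m) * (of_nat (m choose k) * (Delta n ^^ k) f * (Delta n ^^ (m - k)) g) =
      mpoly_const ((-1) ^ k / fact k) * (Delta n ^^ k) f *
      (mpoly_const ((-1) ^ (m - k) / fact (m - k)) * (Delta n ^^ (m - k)) g)"
    using arg_cong[OF eq, of "\<lambda>x. x * ((Delta n ^^ k) f * (Delta n ^^ (m - k)) g)"] by (simp only: mult_ac)
qed

lemma Delta_pow_vanish:
  fixes f :: "'k::field_char_0 mpoly"
  assumes "(Delta n ^^ Suc N) f = 0" "k > N"
  shows "(Delta n ^^ k) f = 0"
proof -
  have "(Delta n ^^ k) f = (Delta n ^^ (k - Suc N)) ((Delta n ^^ Suc N) f)"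
    unfolding funpow_add[THEN fun_cong, unfolded o_apply, symmetric] using assms(2)
    by (simp del: funpow.simps)
  then show ?thesis using assms(1) by simp
qed

text \<open>Past the order of nilpotency no terms are added, so a larger truncation order only
  changes the power of \<open>X_i\<close> that clears denominators. This puts images of different
  polynomials over a common denominator.\<close>

lemma dixmier_extend:
  assumes "(Delta n ^^ Suc N) f = 0"
  shows "dixmier n i (N + M) f = mpoly_var i ^ M * dixmier n i N f"
proof -
  have "dixmier n i (N + M) f = (\<Sum>k\<le>N. mpoly_var (Suc i) ^ k * mpoly_var i ^ (N + M - k) * dixmier_coeff n k f)"
    unfolding dixmier_def dixmier_coeff_def
    by (rule sum.mono_neutral_right) (auto simp: Delta_pow_vanish[OF assms])
  also have "\<dots> = mpoly_var i ^ M * dixmier n i N f"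
    unfolding dixmier_def sum_distrib_left
  proof (intro sum.cong refl)
    fix k assume "k \<in> {..N}"
    then have "N + M - k = M + (N - k)" by simp
    then have "(mpoly_var i :: 'a mpoly) ^ (N + M - k) = mpoly_var i ^ M * mpoly_var i ^ (N - k)"
      by (simp only: power_add)
    then show "mpoly_var (Suc i) ^ k * mpoly_var i ^ (N + M - k) * dixmier_coeff n k f =
        mpoly_var i ^ M * (mpoly_var (Suc i) ^ k * mpoly_var i ^ (N - k) * dixmier_coeff n k f)"
      by (simp only: mult_ac)
  qed
  finally show ?thesis .
qed

lemma Delta_pow_mult_vanish:
  fixes f g :: "'k::field_char_0 mpoly"
  assumes f: "(Delta n ^^ Suc N) f = 0" and g: "(Delta n ^^ Suc M) g = 0"
  shows "(Delta n ^^ Suc (N + M)) (f * g) = 0"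
  unfolding Delta.leibniz
proof (intro sum.neutral ballI)
  fix k
  have "k > N \<or> Suc (N + M) - k > M" by linarith
  then show "of_nat (Suc (N + M) choose k) * (Delta n ^^ k) f * (Delta n ^^ (Suc (N + M) - k)) g = 0"
    using Delta_pow_vanish[OF f, of k] Delta_pow_vanish[OF g, of "Suc (N + M) - k"] by auto
qed

text \<open>Both truncation orders are large enough to lose nothing, so multiplicativity of the
  exponential survives. The Cauchy product runs over a triangle of index pairs and the product of
  sums over a rectangle, with the same nonzero terms.\<close>

lemma dixmier_mult:
  assumes f: "(Delta n ^^ Suc N) f = 0" and g: "(Delta n ^^ Suc M) g = 0"
  shows "dixmier n i (N + M) (f * g) = dixmier n i N f * dixmier n i M g"
proof -
  let ?t = "mpoly_var (Suc i) :: 'a mpoly" and ?c = "mpoly_var i :: 'a mpoly"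
  let ?G = "\<lambda>k l. ?t ^ (k + l) * ?c ^ (N + M - (k + l)) * (dixmier_coeff n k f * dixmier_coeff n l g)"
  have "dixmier n i (N + M) (f * g) = (\<Sum>m\<le>N + M. \<Sum>k\<le>m. ?G k (m - k))"
    unfolding dixmier_def dixmier_coeff_mult sum_distrib_left by (intro sum.cong) auto
  also have "\<dots> = (\<Sum>(k, l)\<in>{(k, l). k + l \<le> N + M}. ?G k l)"
    by (rule sum.triangle_reindex_eq[symmetric])
  also have "\<dots> = (\<Sum>(k, l)\<in>{..N} \<times> {..M}. ?G k l)"
  proof (rule sum.mono_neutral_right)
    show "finite {(k, l). k + l \<le> N + M}"
      by (rule finite_subset[of _ "{..N + M} \<times> {..N + M}"]) auto
    show "\<forall>x\<in>{(k, l). k + l \<le> N + M} - {..N} \<times> {..M}. (case x of (k, l) \<Rightarrow> ?G k l) = 0"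
    proof
      fix x assume x: "x \<in> {(k, l). k + l \<le> N + M} - {..N} \<times> {..M}"
      obtain k l where kl: "x = (k, l)" by (cases x)
      then have "k > N \<or> l > M" using x by auto
      then show "(case x of (k, l) \<Rightarrow> ?G k l) = 0"
        using Delta_pow_vanish[OF f, of k] Delta_pow_vanish[OF g, of l] by (auto simp: kl dixmier_coeff_def)
    qed
  qed auto
  also have "\<dots> = (\<Sum>(k, l)\<in>{..N} \<times> {..M}.
      (?t ^ k * ?c ^ (N - k) * dixmier_coeff n k f) * (?t ^ l * ?c ^ (M - l) * dixmier_coeff n l g))"
  proof (intro sum.cong refl)
    fix x assume x: "x \<in> {..N} \<times> {..M}"
    obtain k l where kl: "x = (k, l)" by (cases x)
    then have "N + M - (k + l) = (N - k) + (M - l)" using x by simp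
    then have "?G k l = (?t ^ k * ?c ^ (N - k) * dixmier_coeff n k f) * (?t ^ l * ?c ^ (M - l) * dixmier_coeff n l g)"
      by (simp only: power_add mult_ac)
    then show "(case x of (k, l) \<Rightarrow> ?G k l) = (case x of (k, l) \<Rightarrow>
        (?t ^ k * ?c ^ (N - k) * dixmier_coeff n k f) * (?t ^ l * ?c ^ (M - l) * dixmier_coeff n l g))"
      by (simp only: kl prod.case)
  qed
  also have "\<dots> = dixmier n i N f * dixmier n i M g"
    unfolding dixmier_def sum_product sum.cartesian_product ..
  finally show ?thesis .
qed

lemma Delta_pow_var: "j \<le> n \<Longrightarrow> (Delta n ^^ Suc j) (mpoly_var j :: 'k::field_char_0 mpoly) = 0"
proof (induction j)
  case (Suc j)
  have "(Delta n ^^ Suc (Suc j)) (mpoly_var (Suc j)) = (Delta n ^^ Suc j) (Delta n (mpoly_var (Suc j) :: 'k mpoly))"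
    by (simp only: funpow_Suc_right o_apply)
  also have "Delta n (mpoly_var (Suc j)) = (mpoly_var j :: 'k mpoly)" using Suc(2) by (simp add: Delta_var)
  also have "(Delta n ^^ Suc j) (mpoly_var j :: 'k mpoly) = 0" by (rule Suc.IH) (use Suc.prems in simp)
  finally show ?case .
qed (simp add: Delta_var)

lemma Delta_locally_nilpotent:
  "f \<in> mpoly_carrier n \<Longrightarrow> \<exists>N. (Delta n ^^ Suc N) (f :: 'k::field_char_0 mpoly) = 0"
proof (induction rule: mpoly_carrier_induct)
  case (const c)
  then show ?case by (intro exI[of _ 0]) simp
next
  case (var j)
  then show ?case using Delta_pow_var by blast
next
  case (add f g)
  then obtain N M where NM: "(Delta n ^^ Suc N) f = 0" "(Delta n ^^ Suc M) g = 0" by blast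
  then have "(Delta n ^^ Suc (max N M)) f = 0" "(Delta n ^^ Suc (max N M)) g = 0"
    using Delta_pow_vanish[OF NM(1), of "Suc (max N M)"] Delta_pow_vanish[OF NM(2), of "Suc (max N M)"]
    by (simp_all del: funpow.simps)
  then have "(Delta n ^^ Suc (max N M)) (f + g) = 0" by (simp only: Delta.pow_add add_0)
  then show ?case ..
next
  case (mult f g)
  then obtain N M where "(Delta n ^^ Suc N) f = 0" "(Delta n ^^ Suc M) g = 0" by blast
  then have "(Delta n ^^ Suc (N + M)) (f * g) = 0" by (rule Delta_pow_mult_vanish)
  then show ?case ..
qed

section \<open>Weights: eigenvalues of \<open>Gamma n a\<close> on monomials and
  eigenvectors\<close>

definition wt :: "nat \<Rightarrow> 'k::comm_ring_1 \<Rightarrow> (nat \<Rightarrow>\<^sub>0 nat) \<Rightarrow> 'k" where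
  "wt n a m = (\<Sum>i=0..n. (a + of_nat i) * of_nat (Poly_Mapping.lookup m i))"

lemma sum_single: "(\<Sum>i\<in>J. Poly_Mapping.single m (f i)) = Poly_Mapping.single m (sum f J)"
  by (induction J rule: infinite_finite_induct) (auto simp: single_add)

lemma Gamma_single: "Gamma n a (Poly_Mapping.single m c) = Poly_Mapping.single m (wt n a m * c)"
proof -
  have "mpoly_const (a + of_nat i) * mpoly_var i * mpoly_pderiv i (Poly_Mapping.single m c) =
      Poly_Mapping.single m ((a + of_nat i) * of_nat (Poly_Mapping.lookup m i) * c)" for i
  proof (cases "Poly_Mapping.lookup m i = 0")
    case False
    then have "Poly_Mapping.single i 1 + (m - Poly_Mapping.single i 1) = m"
      using exponent_diff_add[of m i "Poly_Mapping.single i 1"] by (simp add: add.commute)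
    then show ?thesis
      by (simp add: mpoly_pderiv_single mpoly_const_def mpoly_var_def mult_single mult.assoc)
  qed (simp add: mpoly_pderiv_single)
  then show ?thesis by (simp add: Gamma_def sum_single wt_def sum_distrib_right)
qed

lemma lookup_Gamma: "Poly_Mapping.lookup (Gamma n a f) m = wt n a m * Poly_Mapping.lookup f m"
proof (induction f rule: mpoly_induct)
  case (single m' c)
  then show ?case by (simp add: Gamma_single lookup_single when_def)
qed (simp_all add: Gamma_add lookup_add algebra_simps)

lemma lookup_mpoly_const_mult:
  "Poly_Mapping.lookup (mpoly_const c * f) m = c * Poly_Mapping.lookup (f :: 'k::comm_ring_1 mpoly) m"
proof (induction f rule: mpoly_induct)
  case (single m' d)
  then show ?case by (simp add: mpoly_const_def mult_single lookup_single when_def)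
qed (simp_all add: lookup_add algebra_simps)

definition Gamma_eigen :: "nat \<Rightarrow> 'k::comm_ring_1 \<Rightarrow> 'k mpoly \<Rightarrow> 'k \<Rightarrow> bool" where
  "Gamma_eigen n a f \<mu> \<longleftrightarrow> Gamma n a f = mpoly_const \<mu> * f"

lemma Gamma_eigen_iff: "Gamma_eigen n a f \<mu> \<longleftrightarrow> (\<forall>m\<in>Poly_Mapping.keys f. wt n a m = \<mu>)"
  for a :: "'k::field_char_0"
  unfolding Gamma_eigen_def
  by (auto simp: poly_mapping_eq_iff fun_eq_iff lookup_Gamma lookup_mpoly_const_mult in_keys_iff)

lemma Gamma_eigen_mult:
  "\<lbrakk>Gamma_eigen n a f \<mu>; Gamma_eigen n a g \<nu>\<rbrakk> \<Longrightarrow> Gamma_eigen n a (f * g) (\<mu> + \<nu>)"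
  by (simp add: Gamma_eigen_def Gamma_mult mpoly_const_simps algebra_simps)

lemma Gamma_eigen_const: "Gamma_eigen n a (mpoly_const c) 0"
  by (simp add: Gamma_eigen_def mpoly_const_simps)

lemma Gamma_eigen_var: "i \<le> n \<Longrightarrow> Gamma_eigen n a (mpoly_var i) (a + of_nat i)"
  by (simp add: Gamma_eigen_def Gamma_var)

lemma Gamma_eigen_power: "Gamma_eigen n a f \<mu> \<Longrightarrow> Gamma_eigen n a (f ^ k) (of_nat k * \<mu>)"
proof (induction k)
  case 0
  then show ?case using Gamma_eigen_const[of n a 1] by (simp add: mpoly_const_simps)
next
  case (Suc k)
  then show ?case using Gamma_eigen_mult[of n a f \<mu> "f ^ k" "of_nat k * \<mu>"] by (simp add: algebra_simps)
qed

lemma Gamma_eigen_Delta: "Gamma_eigen n a f \<mu> \<Longrightarrow> Gamma_eigen n a (Delta n f) (\<mu> - 1)"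
proof -
  assume "Gamma_eigen n a f \<mu>"
  then have "Delta n (mpoly_const \<mu> * f) = Gamma n a (Delta n f) + Delta n f"
    using Delta_Gamma[of n a f] by (simp add: Gamma_eigen_def)
  moreover have "mpoly_const (\<mu> - 1) * Delta n f = mpoly_const \<mu> * Delta n f - Delta n f"
    by (simp add: mpoly_const_diff mpoly_const_simps algebra_simps)
  ultimately show ?thesis by (simp add: Gamma_eigen_def Delta_mult)
qed

lemma Gamma_eigen_Delta_pow:
  "Gamma_eigen n a f \<mu> \<Longrightarrow> Gamma_eigen n a ((Delta n ^^ k) f) (\<mu> - of_nat k)"
proof (induction k)
  case (Suc k)
  then show ?case using Gamma_eigen_Delta[of n a "(Delta n ^^ k) f" "\<mu> - of_nat k"]
    by (simp add: algebra_simps)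
qed simp

lemma Gamma_eigen_sum:
  "(\<And>j. j \<in> J \<Longrightarrow> Gamma_eigen n a (f j) \<mu>) \<Longrightarrow> Gamma_eigen n a (sum f J) \<mu>"
  for a :: "'k::field_char_0"
  unfolding Gamma_eigen_def Gamma.D_sum sum_distrib_left by (intro sum.cong) auto

text \<open>Replacing a factor \<open>X_i\<close> by \<open>X_(i+1)\<close> raises the weight by one
  and each \<Delta> lowers it by one, so every term has the weight of the term \<open>k = 0\<close>,
  which is \<open>X_i ^ N * f\<close>.\<close>

lemma Gamma_eigen_dixmier:
  fixes a :: "'k::field_char_0"
  assumes f: "Gamma_eigen n a f \<mu>" and i: "i < n"
  shows "Gamma_eigen n a (dixmier n i N f) (\<mu> + of_nat N * (a + of_nat i))"
  unfolding dixmier_def dixmier_coeff_def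
proof (rule Gamma_eigen_sum)
  fix k assume "k \<in> {..N}"
  then obtain l where N: "N = k + l" using le_Suc_ex by auto
  have eq: "of_nat k * (a + of_nat (Suc i)) + of_nat (N - k) * (a + of_nat i) + (0 + (\<mu> - of_nat k)) =
      \<mu> + of_nat N * (a + of_nat i)"
    by (simp add: N algebra_simps)
  have "Gamma_eigen n a (mpoly_var (Suc i) ^ k * mpoly_var i ^ (N - k) *
      (mpoly_const ((- 1) ^ k / fact k) * (Delta n ^^ k) f))
      (of_nat k * (a + of_nat (Suc i)) + of_nat (N - k) * (a + of_nat i) + (0 + (\<mu> - of_nat k)))"
    by (intro Gamma_eigen_mult Gamma_eigen_power Gamma_eigen_var Gamma_eigen_const
        Gamma_eigen_Delta_pow f) (use i in auto)
  then show "Gamma_eigen n a (mpoly_var (Suc i) ^ k * mpoly_var i ^ (N - k) *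
      (mpoly_const ((- 1) ^ k / fact k) * (Delta n ^^ k) f)) (\<mu> + of_nat N * (a + of_nat i))"
    unfolding eq .
qed

text \<open>A minimal number of weights among the elements of \<open>J - P\<close> must be one, since
  \<open>\<Gamma> h - \<mu> h\<close> has fewer weights than \<open>h\<close>.\<close>

lemma exists_Gamma_eigen:
  fixes a :: "'k::field_char_0"
  assumes J: "mpoly_ideal n J" and JG: "\<And>x. x \<in> J \<Longrightarrow> Gamma n a x \<in> J"
    and P: "mpoly_prime n P" and JP: "\<not> J \<subseteq> P"
  shows "\<exists>h \<mu>. h \<in> J \<and> h \<notin> P \<and> Gamma_eigen n a h \<mu>"
proof -
  interpret J: mpoly_ideal n J by fact
  interpret P: mpoly_prime n P by fact
  let ?W = "\<lambda>h. wt n a ` Poly_Mapping.keys h"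
  obtain h where h: "h \<in> J" "h \<notin> P" and min: "\<And>g. g \<in> J \<Longrightarrow> g \<notin> P \<Longrightarrow> card (?W h) \<le> card (?W g)"
    using JP ex_has_least_nat[of "\<lambda>h. h \<in> J \<and> h \<notin> P" _ "\<lambda>h. card (?W h)"] by blast
  have red: "Gamma n a h - mpoly_const \<mu> * h \<in> P" if \<mu>: "\<mu> \<in> ?W h" for \<mu>
  proof (rule ccontr)
    let ?g = "Gamma n a h - mpoly_const \<mu> * h"
    assume "?g \<notin> P"
    moreover have "?g \<in> J" by (intro J.diff JG h J.mult mpoly_carrier_intros)
    moreover have "Poly_Mapping.lookup ?g m = (wt n a m - \<mu>) * Poly_Mapping.lookup h m" for m
      by (simp add: lookup_minus lookup_Gamma lookup_mpoly_const_mult left_diff_distrib)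
    then have "m \<in> Poly_Mapping.keys h \<and> wt n a m \<noteq> \<mu>" if "m \<in> Poly_Mapping.keys ?g" for m
      using that by (auto simp: in_keys_iff)
    then have "?W ?g \<subseteq> ?W h" "\<mu> \<notin> ?W ?g" by blast+
    then have "?W ?g \<subset> ?W h" using \<mu> by blast
    then have "card (?W ?g) < card (?W h)" by (intro psubset_card_mono) auto
    ultimately show False using min[of ?g] by simp
  qed
  have "h \<noteq> 0" using h(2) P.zero by auto
  then obtain m where m: "m \<in> Poly_Mapping.keys h" by (auto simp: poly_mapping_eq_iff fun_eq_iff in_keys_iff)
  have "wt n a m' = wt n a m" if m': "m' \<in> Poly_Mapping.keys h" for m'
  proof (rule ccontr)
    let ?d = "wt n a m - wt n a m'"
    assume "wt n a m' \<noteq> wt n a m"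
    have "mpoly_const ?d * h =
        (Gamma n a h - mpoly_const (wt n a m') * h) - (Gamma n a h - mpoly_const (wt n a m) * h)"
      by (simp add: mpoly_const_diff algebra_simps)
    also have "\<dots> \<in> P" using m m' by (intro P.diff red) auto
    finally have "mpoly_const ?d * h \<in> P" .
    then show False
      using P.prime[of "mpoly_const ?d" h] P.const[of ?d] h J.sub \<open>wt n a m' \<noteq> _\<close>
      by (auto intro: mpoly_carrier_intros)
  qed
  then have "Gamma_eigen n a h (wt n a m)" by (simp add: Gamma_eigen_iff)
  then show ?thesis using h by blast
qed

section \<open>Rational ideals\<close>

lemma (in mpoly_derivation) D_power_mem:
  assumes "mpoly_ideal n I" "x \<in> mpoly_carrier n" "D x \<in> I"
  shows "D (x ^ k) \<in> I"
proof -
  interpret I: mpoly_ideal n I by fact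
  show ?thesis
  proof (induction k)
    case 0
    show ?case using D_of_nat[of 1] I.zero by simp
  next
    case (Suc k)
    have "D x * x ^ k + x * D (x ^ k) \<in> I"
      by (intro I.add I.mult_right[OF assms(3) mpoly_carrier_power[OF assms(2)]] I.mult[OF assms(2) Suc])
    then show ?case by (simp add: D_mult)
  qed
qed

lemma (in mpoly_derivation) D_power_Suc: "D (x ^ Suc k) = of_nat (Suc k) * x ^ k * D x"
proof (induction k)
  case (Suc k)
  have "D (x ^ Suc (Suc k)) = D x * x ^ Suc k + x * D (x ^ Suc k)" by (subst power_Suc) (rule D_mult)
  then show ?case unfolding Suc by (simp add: algebra_simps)
qed simp

text \<open>With \<open>\<Delta> s = 1\<close>, the product rule makes the derivative of the sum of
  \<open>(-s)^k / k! * \<Delta>^k f\<close> telescope to its last term, which vanishes. Clearing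
  denominators is harmless because \<open>\<Delta> X_i\<close> lies in \<open>P\<close>.\<close>

lemma Delta_dixmier_mem:
  fixes P :: "'k::field_char_0 mpoly set"
  assumes P: "mpoly_ideal n P" and i: "i < n" and c: "Delta n (mpoly_var i) \<in> P"
    and f: "f \<in> mpoly_carrier n" "(Delta n ^^ Suc N) f = 0"
  shows "Delta n (dixmier n i N f) \<in> P"
proof -
  interpret P: mpoly_ideal n P by fact
  let ?c = "mpoly_var i :: 'k mpoly" and ?t = "mpoly_var (Suc i) :: 'k mpoly"
  let ?k = "\<lambda>k. mpoly_const ((-1) ^ k / fact k) :: 'k mpoly"
  let ?s = "\<lambda>k. ?t ^ k * ?c ^ (N - k) * dixmier_coeff n k f"
  note C = mpoly_carrier_mult mpoly_carrier_power mpoly_carrier_intros dixmier_coeff_closed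
  have cC: "?c \<in> mpoly_carrier n" and tC: "?t \<in> mpoly_carrier n" using i by (auto intro: C)
  have Dt: "Delta n ?t = ?c" using i by (simp add: Delta_var)
  have Dc: "Delta n (?c ^ m) \<in> P" for m by (rule Delta.D_power_mem[OF P cC c])
  have De: "Delta n (dixmier_coeff n k f) = ?k k * (Delta n ^^ Suc k) f" for k
    by (simp add: dixmier_coeff_def Delta_const_mult)
  \<comment> \<open>The subtracted product is the uncancelled end of the telescoping sum up to index
    \<open>K\<close>; for \<open>K = N\<close> it contains \<open>(Delta n ^^ Suc N) f\<close>,
    which is \<open>0\<close>.\<close>
  have "Delta n (\<Sum>k\<le>K. ?s k) - ?k K * ?t ^ K * ?c ^ (N - K) * (Delta n ^^ Suc K) f \<in> P" if "K \<le> N" for K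
    using that
  proof (induction K)
    case 0
    have "Delta n (?s 0) - ?k 0 * ?t ^ 0 * ?c ^ (N - 0) * (Delta n ^^ Suc 0) f =
        dixmier_coeff n 0 f * Delta n (?c ^ N)"
      using De[of 0] by (simp add: Delta_mult algebra_simps)
    also have "\<dots> \<in> P" by (rule P.mult[OF C(10)[OF f(1)] Dc])
    finally show ?case by simp
  next
    case (Suc K)
    let ?x = "Delta n (\<Sum>k\<le>K. ?s k)"
    have N: "?c ^ (N - K) = ?c * ?c ^ (N - Suc K)" using Suc(2) by (simp flip: power_Suc add: Suc_diff_Suc)
    have "of_nat (Suc K) * ((-1) ^ Suc K / fact (Suc K)) = - ((-1) ^ K / fact K :: 'k)"
      by (simp add: field_simps del: of_nat_Suc)
    then have k: "of_nat (Suc K) * ?k (Suc K) = - ?k K"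
      unfolding of_nat_eq_mpoly_const by (simp flip: mpoly_const_simps)
    have "Delta n (?s (Suc K)) =
        of_nat (Suc K) * ?t ^ K * ?c * ?c ^ (N - Suc K) * dixmier_coeff n (Suc K) f
        + ?t ^ Suc K * Delta n (?c ^ (N - Suc K)) * dixmier_coeff n (Suc K) f
        + ?t ^ Suc K * ?c ^ (N - Suc K) * (?k (Suc K) * (Delta n ^^ Suc (Suc K)) f)"
      unfolding Delta_mult Delta.D_power_Suc Dt De by (simp only: algebra_simps)
    also have "of_nat (Suc K) * ?t ^ K * ?c * ?c ^ (N - Suc K) * dixmier_coeff n (Suc K) f =
        (of_nat (Suc K) * ?k (Suc K)) * ?t ^ K * ?c ^ (N - K) * (Delta n ^^ Suc K) f"
      unfolding N dixmier_coeff_def by (simp only: mult_ac)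
    finally have eq: "Delta n (?s (Suc K)) =
        - ?k K * ?t ^ K * ?c ^ (N - K) * (Delta n ^^ Suc K) f
        + ?t ^ Suc K * Delta n (?c ^ (N - Suc K)) * dixmier_coeff n (Suc K) f
        + ?t ^ Suc K * ?c ^ (N - Suc K) * (?k (Suc K) * (Delta n ^^ Suc (Suc K)) f)"
      unfolding k .
    have "Delta n (\<Sum>k\<le>Suc K. ?s k) - ?k (Suc K) * ?t ^ Suc K * ?c ^ (N - Suc K) * (Delta n ^^ Suc (Suc K)) f =
        (?x - ?k K * ?t ^ K * ?c ^ (N - K) * (Delta n ^^ Suc K) f)
        + (?t ^ Suc K * dixmier_coeff n (Suc K) f) * Delta n (?c ^ (N - Suc K))"
      unfolding sum.atMost_Suc Delta_add eq
      by (simp add: algebra_simps del: funpow.simps power_Suc fact_Suc)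
    also have "\<dots> \<in> P"
      using Suc.prems by (intro P.add Suc.IH P.mult Dc C tC f) auto
    finally show ?case .
  qed
  from this[of N] show ?thesis using f(2) by (simp add: dixmier_def del: funpow.simps)
qed

text \<open>On the kernel of \<Delta> modulo \<open>P\<close> the Dixmier map is the identity, as
  only the term \<open>k = 0\<close> survives; \<open>X_i ^ N\<close> is the cleared
  denominator.\<close>

lemma dixmier_kernel:
  fixes P :: "'k::field_char_0 mpoly set"
  assumes P: "mpoly_ideal n P" and stab: "\<And>x. x \<in> P \<Longrightarrow> Delta n x \<in> P" and i: "i < n"
    and f: "Delta n f \<in> P"
  shows "dixmier n i N f - mpoly_var i ^ N * f \<in> P"
proof -
  interpret P: mpoly_ideal n P by fact
  note C = mpoly_carrier_mult mpoly_carrier_power mpoly_carrier_intros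
  have pow: "(Delta n ^^ Suc k) f \<in> P" for k
    by (induction k) (simp_all add: f stab)
  let ?s = "\<lambda>k. mpoly_var (Suc i) ^ k * mpoly_var i ^ (N - k) * dixmier_coeff n k f"
  have "dixmier n i N f = ?s 0 + (\<Sum>k\<in>{..N} - {0}. ?s k)"
    unfolding dixmier_def by (rule sum.remove) auto
  also have "?s 0 = mpoly_var i ^ N * f" by (simp add: dixmier_coeff_def mpoly_const_simps)
  finally have "dixmier n i N f - mpoly_var i ^ N * f = (\<Sum>k\<in>{..N} - {0}. ?s k)" by simp
  also have "\<dots> \<in> P"
  proof (rule P.sum_mem)
    fix k assume "k \<in> {..N} - {0}"
    then obtain l where "k = Suc l" by (cases k) auto
    then have "dixmier_coeff n k f \<in> P"
      unfolding dixmier_coeff_def using pow[of l] by (intro P.mult C) simp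
    then show "?s k \<in> P" using i by (intro P.mult C) auto
  qed
  finally show ?thesis .
qed

text \<open>A weight vector \<open>h\<close> in \<open>Q - P\<close> killed by \<open>\<Delta>\<close> modulo \<open>P\<close> equals, up to a power of \<open>X\<^sub>i\<close>, the
  Dixmier image of a combination of monomials of the same weight. The quotient of the image of any
  such monomial by \<open>h\<close> is a Poisson central fraction, so it is algebraic and the image lies in \<open>Q\<close>.\<close>

lemma stable_prime_contains_dixmier:
  fixes P :: "'k::field_char_0 mpoly set"
  assumes P: "mpoly_prime n P" and PD: "\<And>x. x \<in> P \<Longrightarrow> Delta n x \<in> P"
    and i: "i < n" and iP: "mpoly_var i \<notin> P" and DiP: "Delta n (mpoly_var i) \<in> P"
    and alg: "\<And>u v. u \<in> mpoly_carrier n \<Longrightarrow> v \<in> mpoly_carrier n \<Longrightarrow> v \<notin> P \<Longrightarrow>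
      poisson_central_mod n a P u v \<Longrightarrow> algebraic_mod P u v"
    and Q: "mpoly_prime n Q" and PQ: "P \<subset> Q"
    and QD: "\<And>x. x \<in> Q \<Longrightarrow> Delta n x \<in> Q" and QG: "\<And>x. x \<in> Q \<Longrightarrow> Gamma n a x \<in> Q"
    and iQ: "mpoly_var i \<notin> Q"
  shows "\<exists>j\<le>n. dixmier n i j (mpoly_var j) \<in> Q - P"
proof (rule ccontr)
  assume "\<not> ?thesis"
  then have Y: "dixmier n i j (mpoly_var j) \<in> Q \<Longrightarrow> dixmier n i j (mpoly_var j) \<in> P" if "j \<le> n" for j
    using that by blast
  interpret P: mpoly_prime n P by fact
  interpret Q: mpoly_prime n Q by fact
  note C = mpoly_carrier_mult mpoly_carrier_power mpoly_carrier_intros mpoly_carrier_Delta mpoly_carrier_Gamma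
  let ?c = "mpoly_var i :: 'k mpoly"
  have cC: "?c \<in> mpoly_carrier n" using i by (intro C) simp
  obtain h0 \<mu>0 where h0: "h0 \<in> Q" "h0 \<notin> P" "Gamma_eigen n a h0 \<mu>0"
    using exists_Gamma_eigen[OF Q.mpoly_ideal_axioms QG P] PQ by blast
  have "\<exists>k. (Delta n ^^ Suc k) h0 \<in> P"
    using Delta_locally_nilpotent[of h0 n] h0(1) Q.sub P.zero by (metis subsetD)
  \<comment> \<open>\<open>h\<close> is the last iterate of \<open>h0\<close> under \<Delta> outside
    \<open>P\<close>. It stays in the stable ideal \<open>Q\<close>, and its weight is that of
    \<open>h0\<close> shifted by \<open>k\<close>.\<close>
  define k where "k = (LEAST k. (Delta n ^^ Suc k) h0 \<in> P)"
  define h where "h = (Delta n ^^ k) h0"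
  define \<mu> where "\<mu> = \<mu>0 - of_nat k"
  have Dh: "Delta n h \<in> P"
    using LeastI_ex[OF \<open>\<exists>k. _ k\<close>] unfolding h_def k_def by simp
  have hP: "h \<notin> P"
  proof (cases k)
    case (Suc l)
    then have "l < k" by simp
    then show ?thesis using not_less_Least[of l "\<lambda>k. (Delta n ^^ Suc k) h0 \<in> P"] Suc by (simp add: h_def k_def)
  qed (simp add: h_def h0)
  have hQ: "h \<in> Q"
    unfolding h_def by (induction k) (simp_all add: h0 QD)
  have hC: "h \<in> mpoly_carrier n" using hQ Q.sub by blast
  have he: "Gamma_eigen n a h \<mu>"
    unfolding h_def \<mu>_def by (rule Gamma_eigen_Delta_pow[OF h0(3)])

  \<comment> \<open>\<open>H\<close> holds for the variables by the assumption to be refuted and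
    passes to products, because the untruncated Dixmier map is multiplicative and \<open>Q\<close>
    is prime. So it reaches all monomials of \<open>h\<close>.\<close>
  define H where "H f \<longleftrightarrow> f \<in> mpoly_carrier n \<and> (\<exists>N. (Delta n ^^ Suc N) f = 0 \<and>
      (dixmier n i N f \<in> Q \<longrightarrow> dixmier n i N f \<in> P))" for f :: "'k mpoly"
  have H1: "H 1"
  proof -
    have "Delta n (mpoly_const 1) = (0 :: 'k mpoly)" by (rule Delta_const)
    then have "(Delta n ^^ Suc 0) 1 = (0 :: 'k mpoly)" by (simp add: mpoly_const_simps)
    moreover have "dixmier n i 0 1 = (1 :: 'k mpoly)"
      by (simp add: dixmier_def dixmier_coeff_def mpoly_const_simps)
    ultimately show ?thesis unfolding H_def using Q.one C by metis
  qed
  have Hvar: "H (mpoly_var j)" if "j \<le> n" for j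
    unfolding H_def using Delta_pow_var[OF that] Y[OF that] C(4)[OF that] by blast
  have Hmult: "H (f * g)" if fg: "H f" "H g" for f g
  proof -
    obtain N where N: "f \<in> mpoly_carrier n" "(Delta n ^^ Suc N) f = 0"
      "dixmier n i N f \<in> Q \<longrightarrow> dixmier n i N f \<in> P" using fg(1) unfolding H_def by blast
    obtain M where M: "g \<in> mpoly_carrier n" "(Delta n ^^ Suc M) g = 0"
      "dixmier n i M g \<in> Q \<longrightarrow> dixmier n i M g \<in> P" using fg(2) unfolding H_def by blast
    note dC = dixmier_closed[OF i N(1), of N] dixmier_closed[OF i M(1), of M]
    have "dixmier n i N f * dixmier n i M g \<in> P" if "dixmier n i N f * dixmier n i M g \<in> Q"
    proof -
      have "dixmier n i N f \<in> P \<or> dixmier n i M g \<in> P" using Q.prime[OF dC that] N(3) M(3) by blast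
      then show ?thesis using P.mult[OF dC(1)] P.mult_right[OF _ dC(2)] by blast
    qed
    then have "dixmier n i (N + M) (f * g) \<in> Q \<longrightarrow> dixmier n i (N + M) (f * g) \<in> P"
      unfolding dixmier_mult[OF N(2) M(2)] by blast
    then show ?thesis
      unfolding H_def using Delta_pow_mult_vanish[OF N(2) M(2)] C(1)[OF N(1) M(1)] by blast
  qed
  have Hpow: "H f \<Longrightarrow> H (f ^ m)" for f m by (induction m) (auto intro: Hmult H1)
  have Hprod: "(\<And>j. j \<in> J \<Longrightarrow> H (f j)) \<Longrightarrow> H (prod f J)" for f and J :: "nat set"
    by (induction J rule: infinite_finite_induct) (auto intro: Hmult H1)
  let ?s = "\<lambda>m. Poly_Mapping.single m (1::'k)"
  have Hs: "H (?s m)" if "m \<in> Poly_Mapping.keys h" for m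
  proof -
    have "Poly_Mapping.keys m \<subseteq> {0..n}" using hC that unfolding mpoly_carrier_def by blast
    then show ?thesis unfolding single_eq_prod_var by (intro Hprod Hpow Hvar) auto
  qed
  then have "\<forall>m\<in>Poly_Mapping.keys h. \<exists>N. (Delta n ^^ Suc N) (?s m) = 0 \<and>
      (dixmier n i N (?s m) \<in> Q \<longrightarrow> dixmier n i N (?s m) \<in> P)"
    unfolding H_def by blast
  then obtain Nm where Nm: "\<And>m. m \<in> Poly_Mapping.keys h \<Longrightarrow> (Delta n ^^ Suc (Nm m)) (?s m) = 0"
    "\<And>m. m \<in> Poly_Mapping.keys h \<Longrightarrow> dixmier n i (Nm m) (?s m) \<in> Q \<Longrightarrow> dixmier n i (Nm m) (?s m) \<in> P"
    by metis
  \<comment> \<open>A common truncation order for the monomials of \<open>h\<close>. Passing to it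
    multiplies each image by a power of \<open>X_i\<close>, which lies neither in \<open>P\<close>
    nor in \<open>Q\<close>.\<close>
  define N where "N = sum Nm (Poly_Mapping.keys h)"
  have le: "Nm m \<le> N" if "m \<in> Poly_Mapping.keys h" for m
    unfolding N_def using that by (intro member_le_sum) auto
  have ext: "dixmier n i N (?s m) = ?c ^ (N - Nm m) * dixmier n i (Nm m) (?s m)"
    if "m \<in> Poly_Mapping.keys h" for m
    using dixmier_extend[OF Nm(1)[OF that], of i "N - Nm m"] le[OF that] by simp
  have sC: "?s m \<in> mpoly_carrier n" if "m \<in> Poly_Mapping.keys h" for m
    using Hs[OF that] by (simp add: H_def)

  define u where "u = ?c ^ N * h"
  have uP: "u \<notin> P"
    unfolding u_def using P.prime[OF C(2)[OF cC] hC] P.power[OF cC] iP hP by blast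
  have uC: "u \<in> mpoly_carrier n" unfolding u_def by (intro C cC hC)
  \<comment> \<open>The Dixmier image of \<open>h\<close> is \<open>u\<close> modulo
    \<open>P\<close>, hence outside \<open>P\<close>. As a combination of images of monomials it
    forces one of these images to be outside \<open>P\<close>.\<close>
  have "dixmier n i N h - u \<in> P"
    unfolding u_def by (rule dixmier_kernel[OF P.mpoly_ideal_axioms PD i Dh])
  then have "dixmier n i N h \<notin> P" using P.diff_cancel' uP by blast
  moreover have "h = (\<Sum>m\<in>Poly_Mapping.keys h. mpoly_const (Poly_Mapping.lookup h m) * ?s m)"
    unfolding single_eq_const_mult[symmetric] by (rule mpoly_sum_single)
  then have "dixmier n i N h =
      (\<Sum>m\<in>Poly_Mapping.keys h. mpoly_const (Poly_Mapping.lookup h m) * dixmier n i N (?s m))"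
    unfolding dixmier_const_mult[symmetric] dixmier_sum[symmetric] by (rule arg_cong)
  ultimately have "(\<Sum>m\<in>Poly_Mapping.keys h. mpoly_const (Poly_Mapping.lookup h m) * dixmier n i N (?s m)) \<notin> P"
    by simp
  moreover have "(\<Sum>m\<in>Poly_Mapping.keys h. mpoly_const (Poly_Mapping.lookup h m) * dixmier n i N (?s m)) \<in> P"
    if "\<forall>m\<in>Poly_Mapping.keys h. dixmier n i N (?s m) \<in> P"
    using that by (intro P.sum_mem P.mult C(3)) auto
  ultimately have "\<not> (\<forall>m\<in>Poly_Mapping.keys h. dixmier n i N (?s m) \<in> P)" by metis
  then obtain m where m: "m \<in> Poly_Mapping.keys h" "dixmier n i N (?s m) \<notin> P" by blast
  define v where "v = dixmier n i N (?s m)"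
  have dC: "dixmier n i (Nm m) (?s m) \<in> mpoly_carrier n" by (rule dixmier_closed[OF i sC[OF m(1)]])
  have vC: "v \<in> mpoly_carrier n" unfolding v_def by (rule dixmier_closed[OF i sC[OF m(1)]])
  have vQ: "v \<notin> Q"
  proof
    assume "v \<in> Q"
    then have "dixmier n i (Nm m) (?s m) \<in> Q"
      unfolding v_def ext[OF m(1)] using Q.prime[OF C(2)[OF cC] dC] Q.power[OF cC] iQ by blast
    then have "v \<in> P" unfolding v_def ext[OF m(1)] using Nm(2)[OF m(1)] by (intro P.mult C(2) cC)
    then show False using m(2) by (simp add: v_def)
  qed

  have "(Delta n ^^ Suc N) (?s m) = 0"
    using Delta_pow_vanish[OF Nm(1)[OF m(1)], of "Suc N"] le[OF m(1)] by simp
  then have Dv: "Delta n v \<in> P"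
    unfolding v_def by (rule Delta_dixmier_mem[OF P.mpoly_ideal_axioms i DiP sC[OF m(1)]])
  have Du: "Delta n u \<in> P"
    unfolding u_def Delta_mult
    using Delta.D_power_mem[OF P.mpoly_ideal_axioms cC DiP] Dh
    by (intro P.add P.mult[OF C(2)[OF cC]] P.mult_right hC)
  define \<nu> where "\<nu> = \<mu> + of_nat N * (a + of_nat i)"
  have "Gamma_eigen n a (?s m) \<mu>"
    using he m(1) by (simp add: Gamma_eigen_iff)
  then have ev: "Gamma_eigen n a v \<nu>" unfolding v_def \<nu>_def by (rule Gamma_eigen_dixmier[OF _ i])
  have eu: "Gamma_eigen n a u \<nu>"
    unfolding u_def \<nu>_def using Gamma_eigen_mult[OF Gamma_eigen_power[OF Gamma_eigen_var] he, of i N] i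
    by (simp add: add.commute)
  have "poisson_central_mod n a P v u"
    unfolding poisson_central_mod_def
  proof
    fix g :: "'k mpoly" assume g: "g \<in> mpoly_carrier n"
    \<comment> \<open>The terms with \<open>Delta n g\<close> cancel because \<open>u\<close> and
      \<open>v\<close> have the same weight; the remaining ones contain \<open>Delta n u\<close> or
      \<open>Delta n v\<close>.\<close>
    have "pbr n a v g * u - pbr n a u g * v = (Gamma n a g * u) * Delta n v - (Gamma n a g * v) * Delta n u"
      using ev eu by (simp add: Gamma_eigen_def pbr_def algebra_simps)
    also have "\<dots> \<in> P" by (intro P.diff P.mult Dv Du C g uC vC)
    finally show "pbr n a v g * u - pbr n a u g * v \<in> P" .
  qed
  then have "algebraic_mod P v u" by (rule alg[OF vC uC uP])
  then obtain d p where dp: "p d \<noteq> 0" "(\<Sum>r\<le>d. mpoly_const (p r) * v ^ r * u ^ (d - r)) \<in> P"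
    unfolding algebraic_mod_def by blast
  let ?t = "\<lambda>r. mpoly_const (p r) * v ^ r * u ^ (d - r)"
  have uQ: "u \<in> Q" unfolding u_def by (intro Q.mult C cC hQ)
  have rest: "(\<Sum>r<d. ?t r) \<in> Q"
  proof (rule Q.sum_mem)
    fix r assume "r \<in> {..<d}"
    then obtain l where "d - r = Suc l" by (metis Suc_diff_Suc lessThan_iff)
    then have "u ^ (d - r) \<in> Q" using Q.mult_right[OF uQ C(2)[OF uC]] by simp
    then show "?t r \<in> Q" by (intro Q.mult C vC)
  qed
  have "(\<Sum>r\<le>d. ?t r) = (\<Sum>r<d. ?t r) + mpoly_const (p d) * v ^ d"
    unfolding lessThan_Suc_atMost[symmetric] by simp
  then have "mpoly_const (p d) * v ^ d = (\<Sum>r\<le>d. ?t r) - (\<Sum>r<d. ?t r)" by simp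
  also have "\<dots> \<in> Q" using dp(2) PQ rest by (intro Q.diff) auto
  finally show False
    using Q.prime[OF C(3) C(2)[OF vC]] Q.const[of "p d"] dp(1) Q.power[OF vC] vQ by blast
qed

lemma rational_imp_locally_closed:
  fixes a :: "'k::field_char_0"
  assumes rat: "poisson_rational (range mpoly_const) (A_poisson n a) P"
  shows "poisson_locally_closed (A_poisson n a) P"
proof -
  interpret mpoly_poisson_prime n P a
    using rat by (simp add: poisson_rational_def mpoly_poisson_prime_iff)
  note C = mpoly_carrier_mult mpoly_carrier_power mpoly_carrier_intros
  have alg: "algebraic_mod P u v"
    if "u \<in> mpoly_carrier n" "v \<in> mpoly_carrier n" "v \<notin> P" "poisson_central_mod n a P u v" for u v
    using rat that unfolding poisson_rational_iff poisson_central_mod_def by blast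
  have "\<exists>f\<in>mpoly_carrier n - P. \<forall>Q\<in>PSpec A. P \<subset> Q \<longrightarrow> f \<in> Q"
  proof (cases "\<forall>g\<in>mpoly_carrier n. \<forall>h\<in>mpoly_carrier n. pbr n a g h \<in> P")
    case True
    \<comment> \<open>When all brackets vanish modulo \<open>P\<close>, every \<open>u/1\<close> is
      central. Rationality then makes \<open>A/P\<close> algebraic, hence a field, so no prime lies
      strictly above \<open>P\<close> and \<open>1\<close> is a separating element.\<close>
    have "algebraic_mod P u 1" if u: "u \<in> mpoly_carrier n" for u
      using True u by (intro alg C one) (auto simp: poisson_central_mod_def)
    then have max: "\<forall>x\<in>mpoly_carrier n - P. \<exists>y\<in>mpoly_carrier n. x * y - 1 \<in> P"
      using invertible_if_algebraic_mod by blast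
    have "1 \<in> Q" if PQ: "Q \<in> PSpec A" "P \<subset> Q" for Q
    proof -
      interpret Q: mpoly_prime n Q using PQ(1) by (simp add: PSpec_A_poisson_iff)
      obtain x where x: "x \<in> Q" "x \<notin> P" using PQ(2) by blast
      then obtain y where y: "y \<in> mpoly_carrier n" "x * y - 1 \<in> P" using max Q.sub by blast
      then show ?thesis using Q.diff_cancel'[of "x * y" 1] Q.mult_right[OF x(1) y(1)] PQ(2) by blast
    qed
    then show ?thesis using one C(9) by blast
  next
    case False
    then obtain g h where gh: "g \<in> mpoly_carrier n" "h \<in> mpoly_carrier n" "pbr n a g h \<notin> P" by blast
    have "\<exists>i. i < n \<and> mpoly_var i \<notin> P"
    proof (rule ccontr)
      assume "\<not> ?thesis"
      then have *: "mpoly_var i \<in> P" if "i < n" for i using that by blast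
      have "Delta n x \<in> P" if "x \<in> mpoly_carrier n" for x
        unfolding Delta_def using that by (intro sum_mem mult_right mpoly_carrier_pderiv *) auto
      then have "pbr n a g h \<in> P"
        unfolding pbr_def using gh by (intro diff mult_right mult mpoly_carrier_Gamma) auto
      then show False using gh(3) by blast
    qed
    then obtain i where i: "i < n" "mpoly_var i \<notin> P" and least: "\<And>j. j < i \<Longrightarrow> \<not> (j < n \<and> mpoly_var j \<notin> P)"
      using exists_least_iff[of "\<lambda>i. i < n \<and> mpoly_var i \<notin> P"] by blast
    have iC: "mpoly_var i \<in> mpoly_carrier n" using i by (intro C) simp
    \<comment> \<open>For \<open>i = 0\<close> this derivative is \<open>0\<close>; otherwise it is
      the preceding variable, which is in \<open>P\<close> by minimality.\<close>
    have Di: "Delta n (mpoly_var i) \<in> P"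
      using least[of "i - 1"] i(1) zero by (auto simp: Delta_var)
    define Y :: "nat \<Rightarrow> 'k mpoly" where "Y j = dixmier n i j (mpoly_var j)" for j
    have YC: "Y j \<in> mpoly_carrier n" if "j \<le> n" for j
      unfolding Y_def using that i by (intro dixmier_closed C)
    let ?J = "{j. j \<le> n \<and> Y j \<notin> P}"
    have prodC: "(\<Prod>j\<in>S. Y j) \<in> mpoly_carrier n" if "S \<subseteq> {..n}" for S
      using finite_subset[OF that] that by (induction S rule: finite_induct) (auto intro!: C YC)
    have prodP: "(\<Prod>j\<in>S. Y j) \<notin> P" if "S \<subseteq> ?J" for S
    proof -
      have "finite S" using that by (rule finite_subset) auto
      then show ?thesis using that
      proof (induction S rule: finite_induct)
        case (insert j S)
        have "(\<Prod>j\<in>S. Y j) \<in> mpoly_carrier n" using insert.prems by (intro prodC) auto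
        then show ?case using insert mult_notin[OF YC] by simp
      qed (use one in simp)
    qed
    \<comment> \<open>Suppose a Poisson prime \<open>Q\<close> above \<open>P\<close> avoids
      \<open>?f\<close>. The bracket outside \<open>Q\<close> makes \<open>Q\<close> stable, and
      \<open>X_i\<close> outside \<open>Q\<close> allows the Dixmier argument, which puts into
      \<open>Q\<close> some \<open>Y j\<close> outside \<open>P\<close>. That is a factor of the
      last product.\<close>
    let ?f = "pbr n a g h * (mpoly_var i * (\<Prod>j\<in>?J. Y j))"
    have JC: "(\<Prod>j\<in>?J. Y j) \<in> mpoly_carrier n" by (intro prodC) auto
    have bC: "pbr n a g h \<in> mpoly_carrier n" by (rule pbr_closed[OF gh(1,2)])
    have "?f \<in> mpoly_carrier n" by (intro C bC iC JC)
    moreover have "?f \<notin> P"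
      by (intro mult_notin bC gh C iC JC i prodP order.refl)
    moreover have "?f \<in> Q" if Q: "Q \<in> PSpec A" "P \<subset> Q" for Q
    proof (rule ccontr)
      assume fQ: "?f \<notin> Q"
      interpret Q: mpoly_poisson_prime n Q a using Q(1) by (simp add: mpoly_poisson_prime_iff)
      have bQ: "pbr n a g h \<notin> Q"
        using fQ Q.mult_right[OF _ C(1)[OF iC JC]] by blast
      have iQ: "mpoly_var i \<notin> Q"
        using fQ Q.mult[OF bC] Q.mult_right[OF _ JC] by blast
      have "\<exists>j\<le>n. dixmier n i j (mpoly_var j) \<in> Q - P"
        by (rule stable_prime_contains_dixmier[OF mpoly_prime_axioms Delta_Gamma_stable(1)[OF gh]
              i Di alg Q.mpoly_prime_axioms Q(2) Q.Delta_Gamma_stable[OF gh(1,2) bQ] iQ])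
      then obtain j where j: "j \<in> ?J" "Y j \<in> Q" by (auto simp: Y_def)
      have "(\<Prod>j\<in>?J. Y j) = Y j * (\<Prod>j\<in>?J - {j}. Y j)" using j(1) by (intro prod.remove) auto
      then have "(\<Prod>j\<in>?J. Y j) \<in> Q" using Q.mult_right[OF j(2) prodC[of "?J - {j}"]] by auto
      then show False using fQ by (blast intro: Q.mult bC iC)
    qed
    ultimately show ?thesis by blast
  qed
  then show ?thesis unfolding poisson_locally_closed_iff using PSpec by blast
qed

theorem theorem8p6:
  fixes n :: nat and a :: "'k::field_char_0"
  assumes "n \<ge> 1"
  shows "poisson_dixmier_moeglin (range mpoly_const) (A_poisson n a)"
proof -
  have "poisson_primitive (A_poisson n a) P \<longleftrightarrow> poisson_locally_closed (A_poisson n a) P"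
    "poisson_locally_closed (A_poisson n a) P \<longleftrightarrow> poisson_rational (range mpoly_const) (A_poisson n a) P" for P
    by (metis primitive_imp_rational rational_imp_locally_closed locally_closed_imp_primitive)+
  then show ?thesis unfolding poisson_dixmier_moeglin_def by (intro conjI Collect_cong)
qed

end
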